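(* Let $n\ge 1$, let $\Theta\in\mathbb{R}$ be a constant, and let $u\in C^\infty(\mathbb{R}^n\setminus\{0\})$ be homogeneous of degree $2$ and satisfy the special Lagrangian equation $\sum_{i=1}^n\arctan\lambda_i(D^2u(x))=\Theta$ for all $x\in\mathbb{R}^n\setminus\{0\}$. Let $\lambda_{\min}(x)$ and $\lambda_{\max}(x)$ be the smallest and largest eigenvalues of $D^2u(x)$. Suppose that either $\arctan\lambda_{\min}(x)>(\Theta-\pi)/n$ for all $x\in\mathbb{R}^n\setminus\{0\}$, or $\arctan\lambda_{\max}(x)<(\Theta+\pi)/n$ for all $x\in\mathbb{R}^n\setminus\{0\}$. Then $u$ is (the restriction to $\mathbb{R}^n\setminus\{0\}$ of) a quadratic polynomial.
   Context: For a real-valued smooth function $u$, $\lambda_1(D^2u)\le\dots\le\lambda_n(D^2u)$ denote the eigenvalues of the Hessian matrix $D^2u$, listed with multiplicity. Homogeneous of degree $2$ means $u(tx)=t^2u(x)$ for all $t>0$ and $x\ne 0$. Here $\arctan$ takes values in $(-\pi/2,\pi/2)$. *)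

theory Defs
  imports "HOL-Analysis.Analysis" "HOL-Computational_Algebra.Polynomial"
begin

(* For an open set S, this is the usual class C^k: f is differentiable on S and all of its
   directional derivatives are of class C^(k-1). Functions are total, but for open S the
   values outside S play no role. *)
primrec Ck_on :: "nat \<Rightarrow> 'a::real_normed_vector set \<Rightarrow> ('a \<Rightarrow> 'b::real_normed_vector) \<Rightarrow> bool" where
  "Ck_on 0 S f \<longleftrightarrow> continuous_on S f"
| "Ck_on (Suc k) S f \<longleftrightarrow> (\<forall>x\<in>S. f differentiable (at x)) \<and>
     (\<forall>v. Ck_on k S (\<lambda>x. frechet_derivative f (at x) v))"

definition smooth_on :: "'a::real_normed_vector set \<Rightarrow> ('a \<Rightarrow> 'b::real_normed_vector) \<Rightarrow> bool" where
  "smooth_on S f \<longleftrightarrow> (\<forall>k. Ck_on k S f)"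

definition partial_deriv :: "'n::finite \<Rightarrow> (real^'n \<Rightarrow> real) \<Rightarrow> real^'n \<Rightarrow> real" where
  "partial_deriv i f x = frechet_derivative f (at x) (axis i 1)"

definition hessian :: "(real^'n::finite \<Rightarrow> real) \<Rightarrow> real^'n \<Rightarrow> real^'n^'n" where
  "hessian f x = (\<chi> i j. partial_deriv i (partial_deriv j f) x)"

definition charpoly :: "real^'n::finite^'n \<Rightarrow> real poly" where
  "charpoly A = det (mat [:0, 1:] - (\<chi> i j. [:A $ i $ j:]))"

(* The i-th smallest real root of the characteristic polynomial, counted with multiplicity,
   with i running from 1 to CARD('n). For a symmetric matrix, such as the Hessian of a smooth
   function, the characteristic polynomial has exactly CARD('n) real roots and algebraic and
   geometric multiplicities agree; for other matrices the list may be shorter. *)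
definition eigval :: "nat \<Rightarrow> real^'n::finite^'n \<Rightarrow> real" where
  "eigval i A = sorted_list_of_multiset (proots (charpoly A)) ! (i - 1)"

definition eigval_min :: "real^'n::finite^'n \<Rightarrow> real" where
  "eigval_min A = eigval 1 A"

definition eigval_max :: "real^'n::finite^'n \<Rightarrow> real" where
  "eigval_max A = eigval CARD('n) A"

definition homogeneous_deg2 :: "('a::real_vector \<Rightarrow> real) \<Rightarrow> bool" where
  "homogeneous_deg2 u \<longleftrightarrow> (\<forall>t>0. \<forall>x. x \<noteq> 0 \<longrightarrow> u (t *\<^sub>R x) = t^2 * u x)"

(* Polynomials of degree at most 2; the zero polynomial is included. *)
definition quadratic_polynomial :: "(real^'n::finite \<Rightarrow> real) \<Rightarrow> bool" where
  "quadratic_polynomial q \<longleftrightarrow> (\<exists>(A::real^'n^'n) b c. \<forall>x.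
     q x = (\<Sum>i\<in>UNIV. \<Sum>j\<in>UNIV. A $ i $ j * x $ i * x $ j) + (\<Sum>i\<in>UNIV. b i * x $ i) + c)"

end

theory Submission
  imports Defs
begin

text \<open>
  Put \<open>\<theta>\<^sub>j = arctan \<lambda>\<^sub>j\<close>. In the first case the angles \<open>A\<^sub>j = \<theta>\<^sub>j - (\<Theta> - \<pi>) / n\<close> are positive with sum \<open>\<pi>\<close>, in
  the second case the same holds for \<open>A\<^sub>j = (\<Theta> + \<pi>) / n - \<theta>\<^sub>j\<close>. The function \<open>G = \<Sum>\<^sub>j ln (sin A\<^sub>j)\<close> is a
  smooth function of the Hessian, namely \<open>ln det N - ln \<bar>det Z\<bar>\<close> with \<open>N = cos c D\<^sup>2u - sin c\<close> and
  \<open>Z = 1 + i D\<^sup>2u\<close>. Differentiating the equation \<open>det Z = \<bar>det Z\<bar> exp (i \<Theta>)\<close> twice gives, for the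
  linearized operator \<open>L\<close> of the equation and in an eigenbasis of \<open>D\<^sup>2u\<close>,
  \<open>L G = - \<Sum>\<^sub>a\<^sub>b\<^sub>i (1 + cot A\<^sub>a cot A\<^sub>b) h\<^sub>a\<^sub>b\<^sub>i\<^sup>2\<close>, where \<open>h\<close> is the third derivative of \<open>u\<close> scaled by
  \<open>(1 + \<lambda>\<^sup>2)\<^sup>-\<^sup>1\<^sup>/\<^sup>2\<close> in each slot, which is trace-free by the first derivative of the equation. Since
  the \<open>A\<^sub>j\<close> are positive with sum \<open>\<pi>\<close>, the right-hand side is at most \<open>- \<Sum> h\<^sub>a\<^sub>b\<^sub>i\<^sup>2\<close>. As \<open>G\<close> is homogeneous of
  degree 0 it attains its minimum, so it is constant by the strong minimum principle, whence
  \<open>D\<^sup>3u = 0\<close> for \<open>n \<ge> 2\<close>, and Euler's identity \<open>2 u = x \<bullet> D\<^sup>2u x\<close> finishes the proof.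
\<close>

section \<open>Directional derivatives of smooth functions\<close>

text \<open>A single eigenvalue need not be differentiable where eigenvalues cross. This is why G is
  written through determinants of matrix pencils, which are smooth in the entries of the Hessian;
  their derivatives are computed in an eigenframe frozen at one point. The constant c is forced:
  shifting all n angles equally must leave the sum \<pi>. The main obstacle is that 1 + cot A_a cot
  A_b can be negative when one angle is obtuse, so the estimate is not true term by term. Full
  symmetry of h replaces cot A_a cot A_b by the average over the three pairs of slots. Triples of
  distinct indices are then harmless, and triples with a repeated index are controlled, row by row,
  by the trace condition. Homogeneity also makes the eigenvalues bounded, which gives uniform
  ellipticity on the whole punctured space. For n = 1 the only angle is \<pi>, so G would be the
  logarithm of 0, and the punctured line is disconnected; there the equation itself determines the
  second derivative.\<close>

definition dir_deriv :: "'a::real_normed_vector \<Rightarrow> ('a \<Rightarrow> 'b::real_normed_vector) \<Rightarrow> 'a \<Rightarrow> 'b" where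
  "dir_deriv v f = (\<lambda>x. frechet_derivative f (at x) v)"

lemma smooth_on_dir_deriv: "smooth_on S f \<Longrightarrow> smooth_on S (dir_deriv v f)"
  unfolding smooth_on_def dir_deriv_def by (metis Ck_on.simps(2))

lemma smooth_on_imp_continuous_on: "smooth_on S f \<Longrightarrow> continuous_on S f"
  unfolding smooth_on_def by (metis Ck_on.simps(1))

lemma smooth_on_has_derivative:
  assumes "smooth_on S f" "x \<in> S"
  shows "(f has_derivative (\<lambda>v. dir_deriv v f x)) (at x)"
proof -
  have "Ck_on (Suc 0) S f" using assms(1) unfolding smooth_on_def by blast
  hence "f differentiable (at x)" using assms(2) by simp
  thus ?thesis unfolding dir_deriv_def frechet_derivative_works .
qed

lemma has_derivative_imp_dir_deriv_eq: "(f has_derivative f') (at x) \<Longrightarrow> dir_deriv v f x = f' v"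
  unfolding dir_deriv_def using frechet_derivative_at by metis

lemma linear_dir_deriv:
  assumes "smooth_on S f" "x \<in> S"
  shows "linear (\<lambda>v. dir_deriv v f x)"
  using smooth_on_has_derivative[OF assms] by (rule has_derivative_linear)

lemma dir_deriv_cong:
  assumes "open S" "x \<in> S" "smooth_on S f" "\<And>y. y \<in> S \<Longrightarrow> f y = g y"
  shows "dir_deriv v f x = dir_deriv v g x"
proof -
  have "(g has_derivative (\<lambda>v. dir_deriv v f x)) (at x)"
    by (rule has_derivative_transform_within_open[OF smooth_on_has_derivative[OF assms(3,2)] assms(1,2,4)])
  from has_derivative_imp_dir_deriv_eq[OF this] show ?thesis by simp
qed

lemma line_has_vector_derivative:
  assumes "smooth_on S f" "x + t *\<^sub>R v \<in> S"
  shows "((\<lambda>t. f (x + t *\<^sub>R v)) has_vector_derivative dir_deriv v f (x + t *\<^sub>R v)) (at t)"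
proof -
  have "((\<lambda>t. x + t *\<^sub>R v) has_derivative (\<lambda>h. h *\<^sub>R v)) (at t)" by (auto intro!: derivative_eq_intros)
  from has_derivative_compose[OF this smooth_on_has_derivative[OF assms]]
  show ?thesis unfolding has_vector_derivative_def
    using linear_cmul[OF linear_dir_deriv[OF assms]] by simp
qed

text \<open>The mean value theorem is applied in direction \<open>v\<close> to a difference in
  direction \<open>w\<close>, then in direction \<open>w\<close>. The left-hand side is symmetric in
  \<open>v\<close> and \<open>w\<close>, while the right-hand side is not; this asymmetry yields
  Schwarz's theorem.\<close>

lemma second_difference_mean_value:
  fixes f :: "'a::real_normed_vector \<Rightarrow> real"
  assumes f: "smooth_on S f" and s: "s > 0"
    and S: "\<And>\<alpha> \<beta>. 0 \<le> \<alpha> \<Longrightarrow> \<alpha> \<le> s \<Longrightarrow> 0 \<le> \<beta> \<Longrightarrow> \<beta> \<le> s \<Longrightarrow> x + \<alpha> *\<^sub>R v + \<beta> *\<^sub>R w \<in> S"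
  obtains \<xi> \<eta> where "0 < \<xi>" "\<xi> < s" "0 < \<eta>" "\<eta> < s"
    "f (x + s *\<^sub>R v + s *\<^sub>R w) - f (x + s *\<^sub>R v) - f (x + s *\<^sub>R w) + f x
      = s * s * dir_deriv w (dir_deriv v f) (x + \<xi> *\<^sub>R v + \<eta> *\<^sub>R w)"
proof -
  let ?\<phi> = "\<lambda>r. f ((x + s *\<^sub>R w) + r *\<^sub>R v) - f (x + r *\<^sub>R v)"
  have d: "(?\<phi> has_real_derivative dir_deriv v f ((x + s *\<^sub>R w) + r *\<^sub>R v) - dir_deriv v f (x + r *\<^sub>R v)) (at r)"
    if "0 \<le> r" "r \<le> s" for r
    unfolding has_real_derivative_iff_has_vector_derivative
    using S[OF that, of s] S[OF that, of 0] s
    by (intro has_vector_derivative_diff line_has_vector_derivative[OF f]) (auto simp: algebra_simps)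
  from MVT2[OF s d] obtain \<xi> where \<xi>: "0 < \<xi>" "\<xi> < s" and
    1: "?\<phi> s - ?\<phi> 0 = (s - 0) * (dir_deriv v f ((x + s *\<^sub>R w) + \<xi> *\<^sub>R v) - dir_deriv v f (x + \<xi> *\<^sub>R v))"
    by blast
  let ?\<psi> = "\<lambda>r. dir_deriv v f ((x + \<xi> *\<^sub>R v) + r *\<^sub>R w)"
  have d': "(?\<psi> has_real_derivative dir_deriv w (dir_deriv v f) ((x + \<xi> *\<^sub>R v) + r *\<^sub>R w)) (at r)"
    if "0 \<le> r" "r \<le> s" for r
    unfolding has_real_derivative_iff_has_vector_derivative
    using S[of \<xi> r] \<xi> that by (intro line_has_vector_derivative[OF smooth_on_dir_deriv[OF f]]) auto
  from MVT2[OF s d'] obtain \<eta> where \<eta>: "0 < \<eta>" "\<eta> < s" and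
    2: "?\<psi> s - ?\<psi> 0 = (s - 0) * dir_deriv w (dir_deriv v f) ((x + \<xi> *\<^sub>R v) + \<eta> *\<^sub>R w)"
    by blast
  have "f (x + s *\<^sub>R v + s *\<^sub>R w) - f (x + s *\<^sub>R v) - f (x + s *\<^sub>R w) + f x = ?\<phi> s - ?\<phi> 0"
    by (simp add: algebra_simps)
  also have "\<dots> = s * (?\<psi> s - ?\<psi> 0)" unfolding 1 by (simp add: algebra_simps)
  also have "\<dots> = s * s * dir_deriv w (dir_deriv v f) (x + \<xi> *\<^sub>R v + \<eta> *\<^sub>R w)" unfolding 2 by simp
  finally show ?thesis using that \<xi> \<eta> by blast
qed

text \<open>Schwarz's theorem. The same second difference represents both mixed derivatives, each at
  some point of a small parallelogram at \<open>x\<close>, so the two take a common value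
  arbitrarily close to \<open>x\<close>; by continuity they cannot differ there.\<close>

lemma dir_deriv_commute:
  fixes f :: "'a::real_normed_vector \<Rightarrow> real"
  assumes S: "open S" "x \<in> S" and f: "smooth_on S f"
  shows "dir_deriv v (dir_deriv w f) x = dir_deriv w (dir_deriv v f) x"
proof (rule ccontr)
  let ?F = "dir_deriv v (dir_deriv w f)" and ?G = "dir_deriv w (dir_deriv v f)"
  assume ne: "?F x \<noteq> ?G x"
  define e where "e = \<bar>?F x - ?G x\<bar> / 2"
  have e: "e > 0" using ne by (simp add: e_def)
  have cont: "isCont g x" if "smooth_on S g" for g :: "'a \<Rightarrow> real"
    using smooth_on_imp_continuous_on[OF that] S by (simp add: continuous_on_eq_continuous_at)
  have "isCont ?F x" "isCont ?G x" by (intro cont smooth_on_dir_deriv f)+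
  with e obtain d1 d2 where d: "d1 > 0" "\<And>y. dist y x < d1 \<Longrightarrow> dist (?F y) (?F x) < e"
     "d2 > 0" "\<And>y. dist y x < d2 \<Longrightarrow> dist (?G y) (?G x) < e"
    unfolding continuous_at_eps_delta by metis
  obtain d3 where d3: "d3 > 0" "ball x d3 \<subseteq> S" using S open_contains_ball by blast
  define d0 where "d0 = min d1 (min d2 d3)"
  have d0: "d0 > 0" using d d3 by (simp add: d0_def)
  \<comment> \<open>With \<open>s * K = d0 / 2\<close> the whole parallelogram of side parameter
    \<open>s\<close> lies in the ball of radius \<open>d0\<close>. The summand 1 keeps
    \<open>K\<close> positive when both directions vanish.\<close>
  define K where "K = norm v + norm w + 1"
  define s where "s = d0 / (2 * K)"
  have nn: "K > 0" unfolding K_def by (intro add_nonneg_pos add_nonneg_nonneg) auto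
  have s: "s > 0" using d0 nn by (simp add: s_def)
  have near: "dist (x + \<alpha> *\<^sub>R v + \<beta> *\<^sub>R w) x < d0" if "0 \<le> \<alpha>" "\<alpha> \<le> s" "0 \<le> \<beta>" "\<beta> \<le> s" for \<alpha> \<beta>
  proof -
    have "dist (x + \<alpha> *\<^sub>R v + \<beta> *\<^sub>R w) x = norm (\<alpha> *\<^sub>R v + \<beta> *\<^sub>R w)" by (simp add: dist_norm add.assoc)
    also have "\<dots> \<le> \<alpha> * norm v + \<beta> * norm w" using that by (intro norm_triangle_le) simp
    also have "\<dots> \<le> s * norm v + s * norm w" using that by (intro add_mono mult_right_mono) auto
    also have "\<dots> \<le> s * K" using s by (simp add: K_def algebra_simps)
    also have "\<dots> = d0 / 2" using nn by (simp add: s_def)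
    also have "\<dots> < d0" using d0 by simp
    finally show ?thesis .
  qed
  have in_S: "x + \<alpha> *\<^sub>R v + \<beta> *\<^sub>R w \<in> S" if "0 \<le> \<alpha>" "\<alpha> \<le> s" "0 \<le> \<beta>" "\<beta> \<le> s" for \<alpha> \<beta>
    using near[OF that] d3 by (auto simp: d0_def dist_commute subset_iff)
  obtain \<xi> \<eta> where 1: "0 < \<xi>" "\<xi> < s" "0 < \<eta>" "\<eta> < s"
    "f (x + s *\<^sub>R v + s *\<^sub>R w) - f (x + s *\<^sub>R v) - f (x + s *\<^sub>R w) + f x = s * s * ?G (x + \<xi> *\<^sub>R v + \<eta> *\<^sub>R w)"
    by (rule second_difference_mean_value[OF f s in_S])
  have in_S': "x + \<alpha> *\<^sub>R w + \<beta> *\<^sub>R v \<in> S" if "0 \<le> \<alpha>" "\<alpha> \<le> s" "0 \<le> \<beta>" "\<beta> \<le> s" for \<alpha> \<beta>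
    using in_S[of \<beta> \<alpha>] that by (simp add: algebra_simps)
  obtain \<xi>' \<eta>' where 2: "0 < \<xi>'" "\<xi>' < s" "0 < \<eta>'" "\<eta>' < s"
    "f (x + s *\<^sub>R w + s *\<^sub>R v) - f (x + s *\<^sub>R w) - f (x + s *\<^sub>R v) + f x = s * s * ?F (x + \<xi>' *\<^sub>R w + \<eta>' *\<^sub>R v)"
    by (rule second_difference_mean_value[OF f s in_S'])
  have "s * s * ?G (x + \<xi> *\<^sub>R v + \<eta> *\<^sub>R w) = s * s * ?F (x + \<xi>' *\<^sub>R w + \<eta>' *\<^sub>R v)"
    using 1(5) 2(5) by (simp add: algebra_simps)
  hence eq: "?G (x + \<xi> *\<^sub>R v + \<eta> *\<^sub>R w) = ?F (x + \<eta>' *\<^sub>R v + \<xi>' *\<^sub>R w)" using s by (simp add: algebra_simps)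
  have "dist (?G (x + \<xi> *\<^sub>R v + \<eta> *\<^sub>R w)) (?G x) < e" "dist (?F (x + \<eta>' *\<^sub>R v + \<xi>' *\<^sub>R w)) (?F x) < e"
    using near[of \<xi> \<eta>] near[of \<eta>' \<xi>'] 1 2 by (auto intro!: d simp: d0_def)
  thus False using eq by (auto simp: dist_real_def e_def abs_if split: if_splits)
qed

section \<open>Homogeneity and Euler's identity\<close>

lemma dir_deriv_homogeneous:
  fixes f :: "'a::real_normed_vector \<Rightarrow> real"
  assumes f: "smooth_on (- {0}) f" and h: "\<And>t x. 0 < t \<Longrightarrow> x \<noteq> 0 \<Longrightarrow> f (t *\<^sub>R x) = t ^ Suc k * f x"
    and t: "0 < t" and x: "x \<noteq> 0"
  shows "dir_deriv v f (t *\<^sub>R x) = t ^ k * dir_deriv v f x"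
proof -
  have tx: "t *\<^sub>R x \<in> - {0}" using t x by simp
  have "((\<lambda>y. t *\<^sub>R y) has_derivative (\<lambda>h. t *\<^sub>R h)) (at x)" by (auto intro!: derivative_eq_intros)
  from has_derivative_compose[OF this smooth_on_has_derivative[OF f tx]]
  have 1: "((\<lambda>y. f (t *\<^sub>R y)) has_derivative (\<lambda>h. dir_deriv (t *\<^sub>R h) f (t *\<^sub>R x))) (at x)" .
  have "((\<lambda>y. t ^ Suc k * f y) has_derivative (\<lambda>h. t ^ Suc k * dir_deriv h f x)) (at x)"
    using smooth_on_has_derivative[OF f, of x] x by (intro has_derivative_mult_right) auto
  hence 2: "((\<lambda>y. f (t *\<^sub>R y)) has_derivative (\<lambda>h. t ^ Suc k * dir_deriv h f x)) (at x)"
    by (rule has_derivative_transform_within_open[where s = "- {0}"]) (use x h t in auto)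
  have "dir_deriv (t *\<^sub>R v) f (t *\<^sub>R x) = t ^ Suc k * dir_deriv v f x"
    using has_derivative_unique[OF 1 2] by metis
  moreover have "dir_deriv (t *\<^sub>R v) f (t *\<^sub>R x) = t * dir_deriv v f (t *\<^sub>R x)"
    using linear_cmul[OF linear_dir_deriv[OF f tx]] by simp
  ultimately show ?thesis using t by simp
qed

text \<open>On the ray through \<open>x\<close> the function is \<open>(1 + t)^2 * u x\<close>, and
  this is differentiated twice at \<open>t = 0\<close>. The range -1 < t < 1 keeps the ray away from
  the origin.\<close>

lemma euler_second_derivative:
  assumes u: "smooth_on (- {0}) u" and h: "homogeneous_deg2 u" and x: "x \<noteq> 0"
  shows "dir_deriv x (dir_deriv x u) x = 2 * u x"
proof -
  have line: "x + t *\<^sub>R x = (1 + t) *\<^sub>R x" for t by (simp add: algebra_simps)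
  have first: "dir_deriv x u (x + t *\<^sub>R x) = 2 * (1 + t) * u x" if t: "t \<in> {-1<..<1}" for t
  proof -
    have "((\<lambda>t. u (x + t *\<^sub>R x)) has_vector_derivative dir_deriv x u (x + t *\<^sub>R x)) (at t)"
      using x t by (intro line_has_vector_derivative[OF u]) (simp add: line)
    moreover have "((\<lambda>t. (1 + t)^2 * u x) has_vector_derivative 2 * (1 + t) * u x) (at t)"
      unfolding has_real_derivative_iff_has_vector_derivative[symmetric] by (auto intro!: derivative_eq_intros)
    hence "((\<lambda>t. u (x + t *\<^sub>R x)) has_vector_derivative 2 * (1 + t) * u x) (at t)"
      by (rule has_vector_derivative_transform_within_open[where S = "{-1<..<1}"])
        (use t x h in \<open>auto simp: line homogeneous_deg2_def\<close>)
    ultimately show ?thesis by (rule vector_derivative_unique_at)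
  qed
  have "((\<lambda>t. dir_deriv x u (x + t *\<^sub>R x)) has_vector_derivative dir_deriv x (dir_deriv x u) (x + 0 *\<^sub>R x)) (at 0)"
    using x by (intro line_has_vector_derivative[OF smooth_on_dir_deriv[OF u]]) simp
  moreover have "((\<lambda>t. 2 * (1 + t) * u x) has_vector_derivative 2 * u x) (at 0)"
    unfolding has_real_derivative_iff_has_vector_derivative[symmetric] by (auto intro!: derivative_eq_intros)
  hence "((\<lambda>t. dir_deriv x u (x + t *\<^sub>R x)) has_vector_derivative 2 * u x) (at 0)"
    by (rule has_vector_derivative_transform_within_open[where S = "{-1<..<1}"]) (use first in auto)
  ultimately have "dir_deriv x (dir_deriv x u) (x + 0 *\<^sub>R x) = 2 * u x" by (rule vector_derivative_unique_at)
  thus ?thesis by simp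
qed

section \<open>The Hessian as the bilinear form of second derivatives\<close>

lemma hessian_eq_dir_deriv: "hessian f x $ i $ j = dir_deriv (axis i 1) (dir_deriv (axis j 1) f) x"
  unfolding hessian_def partial_deriv_def dir_deriv_def by simp

lemma dir_deriv_coordinates:
  fixes f :: "real^'n \<Rightarrow> real"
  assumes "smooth_on S f" "x \<in> S"
  shows "dir_deriv v f x = (\<Sum>i\<in>UNIV. v $ i * dir_deriv (axis i 1) f x)"
proof -
  have "dir_deriv v f x = dir_deriv (\<Sum>i\<in>UNIV. v $ i *\<^sub>R axis i 1) f x"
    using basis_expansion[of v] by (simp add: scalar_mult_eq_scaleR)
  also have "\<dots> = (\<Sum>i\<in>UNIV. dir_deriv (v $ i *\<^sub>R axis i 1) f x)"
    by (rule linear_sum[OF linear_dir_deriv[OF assms]])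
  also have "\<dots> = (\<Sum>i\<in>UNIV. v $ i * dir_deriv (axis i 1) f x)"
    using linear_cmul[OF linear_dir_deriv[OF assms]] by simp
  finally show ?thesis .
qed

lemma second_dir_deriv_eq_hessian:
  fixes f :: "real^'n \<Rightarrow> real"
  assumes S: "open S" "x \<in> S" and f: "smooth_on S f"
  shows "dir_deriv v (dir_deriv w f) x = v \<bullet> (hessian f x *v w)"
proof -
  have "((\<lambda>y. \<Sum>j\<in>UNIV. w $ j * dir_deriv (axis j 1) f y) has_derivative
     (\<lambda>v. \<Sum>j\<in>UNIV. w $ j * dir_deriv v (dir_deriv (axis j 1) f) x)) (at x)"
    using S f by (intro has_derivative_sum has_derivative_mult_right smooth_on_has_derivative smooth_on_dir_deriv)
  hence "(dir_deriv w f has_derivative (\<lambda>v. \<Sum>j\<in>UNIV. w $ j * dir_deriv v (dir_deriv (axis j 1) f) x)) (at x)"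
    by (rule has_derivative_transform_within_open[OF _ S]) (rule dir_deriv_coordinates[OF f, symmetric])
  hence "dir_deriv v (dir_deriv w f) x = (\<Sum>j\<in>UNIV. w $ j * dir_deriv v (dir_deriv (axis j 1) f) x)"
    by (rule has_derivative_imp_dir_deriv_eq)
  also have "\<dots> = (\<Sum>j\<in>UNIV. w $ j * (\<Sum>i\<in>UNIV. v $ i * hessian f x $ i $ j))"
    unfolding hessian_eq_dir_deriv
    by (intro sum.cong refl arg_cong2[where f = "(*)"] dir_deriv_coordinates[OF smooth_on_dir_deriv[OF f] S(2)])
  also have "\<dots> = v \<bullet> (hessian f x *v w)"
    unfolding inner_vec_def matrix_vector_mult_def sum_distrib_left
    by (subst sum.swap) (simp add: sum_distrib_left mult_ac)
  finally show ?thesis .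
qed

lemma transpose_hessian:
  fixes f :: "real^'n \<Rightarrow> real"
  assumes "open S" "x \<in> S" "smooth_on S f"
  shows "transpose (hessian f x) = hessian f x"
  using dir_deriv_commute[OF assms] by (simp add: vec_eq_iff transpose_def hessian_eq_dir_deriv)

section \<open>Eigenvalues of symmetric matrices\<close>

text \<open>A maximizer \<open>v\<close> of the Rayleigh quotient on the unit sphere of
  \<open>T\<close> is an eigenvector. The form \<open>\<mu> |x|^2 - x \<bullet> A x\<close> is
  nonnegative on \<open>T\<close> and vanishes at \<open>v\<close>, so its first variation in the
  direction of the residual \<open>w = \<mu> v - A v\<close> must vanish; that variation is
  \<open>2 * (w \<bullet> w)\<close>.\<close>

lemma self_adjoint_eigenvector_exists:
  fixes A :: "real^'n^'n"
  assumes sym: "transpose A = A" and T: "subspace T" and inv: "\<And>x. x \<in> T \<Longrightarrow> A *v x \<in> T"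
    and ne: "T \<noteq> {0}"
  obtains v \<mu> where "v \<in> T" "norm v = 1" "A *v v = \<mu> *\<^sub>R v"
proof -
  obtain z where z: "z \<in> T" "z \<noteq> 0" using ne T subspace_0 by blast
  have adj: "x \<bullet> (A *v y) = (A *v x) \<bullet> y" for x y
    using dot_lmul_matrix[of x A y] transpose_matrix_vector[of A x] unfolding sym by metis
  let ?K = "T \<inter> sphere 0 1"
  have K: "compact ?K" by (intro closed_Int_compact closed_subspace T compact_sphere)
  have "(1 / norm z) *\<^sub>R z \<in> ?K" using z T by (simp add: subspace_scale)
  hence K': "?K \<noteq> {}" by blast
  have "continuous_on ?K (\<lambda>x. x \<bullet> (A *v x))"
    by (intro continuous_on_inner continuous_on_id linear_continuous_on matrix_vector_mul_bounded_linear)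
  from continuous_attains_sup[OF K K' this] obtain v
    where v: "v \<in> ?K" and max: "\<And>y. y \<in> ?K \<Longrightarrow> y \<bullet> (A *v y) \<le> v \<bullet> (A *v v)" by blast
  define \<mu> where "\<mu> = v \<bullet> (A *v v)"
  have quad: "\<mu> * (x \<bullet> x) - x \<bullet> (A *v x) \<ge> 0" if "x \<in> T" for x
  proof (cases "x = 0")
    case False
    have "(1 / norm x) *\<^sub>R x \<in> ?K" using that False T by (simp add: subspace_scale)
    from max[OF this] have "(x \<bullet> (A *v x)) / (norm x)^2 \<le> \<mu>"
      by (simp add: \<mu>_def matrix_vector_mult_scaleR power2_eq_square)
    thus ?thesis using False by (simp add: field_simps power2_norm_eq_inner[symmetric])
  qed simp
  define w where "w = \<mu> *\<^sub>R v - A *v v"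
  have w: "w \<in> T" using v inv T by (auto simp: w_def intro!: subspace_diff subspace_scale)
  have vv: "v \<bullet> v = 1" using v by (simp add: power2_norm_eq_inner[symmetric])
  define b where "b = \<mu> * (w \<bullet> w) - w \<bullet> (A *v w)"
  have bnn: "b \<ge> 0" using quad[OF w] by (simp add: b_def)
  have expand: "0 \<le> 2 * t * (w \<bullet> w) + t^2 * b" for t
  proof -
    have "v + t *\<^sub>R w \<in> T" using v w T by (auto intro!: subspace_add subspace_scale)
    from quad[OF this] have "0 \<le> \<mu> * ((v + t *\<^sub>R w) \<bullet> (v + t *\<^sub>R w)) - (v + t *\<^sub>R w) \<bullet> (A *v (v + t *\<^sub>R w))" .
    also have "\<dots> = 2 * t * (\<mu> * (v \<bullet> w) - (A *v v) \<bullet> w) + t^2 * b"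
    proof -
      have "(v + t *\<^sub>R w) \<bullet> (v + t *\<^sub>R w) = 1 + 2 * t * (v \<bullet> w) + t^2 * (w \<bullet> w)"
        using vv by (simp add: inner_add_left inner_add_right inner_commute power2_eq_square)
      moreover have "(v + t *\<^sub>R w) \<bullet> (A *v (v + t *\<^sub>R w)) = \<mu> + 2 * t * ((A *v v) \<bullet> w) + t^2 * (w \<bullet> (A *v w))"
        using adj[of v w] by (simp add: inner_add_left inner_add_right matrix_vector_right_distrib
            matrix_vector_mult_scaleR \<mu>_def power2_eq_square distrib_left inner_commute[of w "A *v v"])
      ultimately show ?thesis by (simp add: b_def algebra_simps)
    qed
    also have "\<mu> * (v \<bullet> w) - (A *v v) \<bullet> w = w \<bullet> w"
      by (subst (3) w_def) (simp add: inner_diff_left)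
    finally show ?thesis .
  qed
  have "w \<bullet> w = 0"
  proof (rule ccontr)
    assume "w \<bullet> w \<noteq> 0"
    hence p: "w \<bullet> w > 0" using inner_ge_zero[of w] by linarith
    \<comment> \<open>A negative step so short that the quadratic term stays below half of the
      linear one; the summand 1 covers \<open>b = 0\<close>.\<close>
    let ?t = "- (w \<bullet> w) / (b + 1)"
    have "?t * b \<ge> - (w \<bullet> w)" using p bnn by (simp add: field_simps)
    have "0 \<le> ?t * (2 * (w \<bullet> w) + ?t * b)" using expand[of ?t] by (simp add: algebra_simps power2_eq_square)
    moreover have "?t < 0" using p bnn by (simp add: field_simps)
    moreover have "2 * (w \<bullet> w) + ?t * b > 0" using \<open>?t * b \<ge> _\<close> p by linarith
    ultimately show False by (meson mult_neg_pos not_le)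
  qed
  hence "A *v v = \<mu> *\<^sub>R v" by (simp add: w_def)
  thus ?thesis using that[of v \<mu>] v by auto
qed

text \<open>The dimension is fixed by the type, so a maximal orthonormal set of eigenvectors
  replaces induction on the dimension. Its cardinality is bounded by linear independence, and an
  eigenvector in its orthogonal complement would enlarge it.\<close>

theorem symmetric_matrix_diagonalization:
  fixes A :: "real^'n^'n"
  assumes sym: "transpose A = A"
  obtains Q \<Lambda> where "orthogonal_matrix Q" "\<And>j. A *v column j Q = \<Lambda> j *\<^sub>R column j Q"
proof -
  define good where "good B \<longleftrightarrow> pairwise orthogonal B \<and> (\<forall>b\<in>B. norm b = 1 \<and> (\<exists>\<mu>. A *v b = \<mu> *\<^sub>R b))"
    for B :: "(real^'n) set"
  have indep: "independent B" if "good B" for B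
  proof (rule pairwise_orthogonal_independent)
    show "pairwise orthogonal B" "0 \<notin> B" using that unfolding good_def by (blast, force)
  qed
  have bound: "card B \<le> CARD('n)" if "good B" for B
    using independent_card_le[OF indep[OF that]] by simp
  have "good {}" by (simp add: good_def)
  moreover have "\<forall>B. good B \<longrightarrow> card B < Suc CARD('n)" using bound by (simp add: less_Suc_eq_le)
  ultimately obtain B where B: "good B" and Bmax: "\<And>B'. good B' \<Longrightarrow> card B' \<le> card B"
    using ex_has_greatest_nat[of good "{}" card "Suc CARD('n)"] by blast
  have Bp: "pairwise orthogonal B" and Bn: "\<And>b. b \<in> B \<Longrightarrow> norm b = 1"
    and Be: "\<And>b. b \<in> B \<Longrightarrow> \<exists>\<mu>. A *v b = \<mu> *\<^sub>R b"
    using B unfolding good_def by auto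
  have finB: "finite B" using indep[OF B] independent_imp_finite by blast
  have adj: "x \<bullet> (A *v y) = (A *v x) \<bullet> y" for x y
    using dot_lmul_matrix[of x A y] transpose_matrix_vector[of A x] unfolding sym by metis
  \<comment> \<open>The orthogonal complement of a set of eigenvectors is invariant, because
    \<open>A\<close> is self-adjoint.\<close>
  define T where "T = {x. \<forall>b\<in>B. orthogonal b x}"
  have T: "subspace T" by (auto simp: T_def subspace_def orthogonal_def inner_add)
  have Tinv: "A *v x \<in> T" if "x \<in> T" for x
    unfolding T_def
  proof safe
    fix b assume b: "b \<in> B"
    then obtain \<mu> where "A *v b = \<mu> *\<^sub>R b" using Be by blast
    thus "orthogonal b (A *v x)" using that b by (simp add: T_def orthogonal_def adj)
  qed
  have "T = {0}"
  proof (rule ccontr)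
    assume "T \<noteq> {0}"
    then obtain v \<mu> where v: "v \<in> T" "norm v = 1" "A *v v = \<mu> *\<^sub>R v"
      using self_adjoint_eigenvector_exists[OF sym T Tinv] by blast
    have "v \<notin> B" using v by (auto simp: T_def orthogonal_def)
    have "orthogonal b v \<and> orthogonal v b" if "b \<in> B" for b
      using that v(1) by (auto simp: T_def orthogonal_commute)
    hence "pairwise orthogonal (insert v B)"
      using Bp by (simp add: pairwise_insert)
    hence "good (insert v B)" using Bn Be v(2,3) unfolding good_def by blast
    from Bmax[OF this] show False using \<open>v \<notin> B\<close> finB by simp
  qed
  have "span B = UNIV"
  proof (rule ccontr)
    assume "span B \<noteq> UNIV"
    hence "span B \<subset> span UNIV" by auto
    from orthogonal_to_subspace_exists_gen[OF this] obtain x where x: "x \<noteq> 0" "\<And>y. y \<in> span B \<Longrightarrow> orthogonal x y"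
      by blast
    hence "x \<in> T" unfolding T_def by (simp add: orthogonal_commute[of _ x] span_base)
    thus False using x \<open>T = {0}\<close> by simp
  qed
  hence "card B = CARD('n)"
    using dim_eq_card_independent[OF indep[OF B]] dim_span[of B] by (simp add: dim_UNIV)
  then obtain f :: "'n \<Rightarrow> real^'n" where f: "bij_betw f UNIV B"
    using finite_same_card_bij[of "UNIV::'n set" B] finB by auto
  define Q where "Q = (\<chi> i j. f j $ i)"
  have col: "column j Q = f j" for j by (simp add: Q_def column_def vec_eq_iff)
  have fB: "f j \<in> B" for j using f by (auto simp: bij_betw_def)
  have "orthogonal_matrix Q"
    unfolding orthogonal_matrix_orthonormal_columns col
  proof (intro conjI allI impI)
    fix i show "norm (f i) = 1" using fB by (rule Bn)
  next
    fix i j :: 'n assume "i \<noteq> j"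
    hence "f i \<noteq> f j" using f by (auto simp: bij_betw_def inj_on_def)
    thus "orthogonal (f i) (f j)" using fB Bp by (auto simp: pairwise_def)
  qed
  moreover have "\<forall>j. \<exists>\<mu>. A *v column j Q = \<mu> *\<^sub>R column j Q"
    unfolding col using fB Be by blast
  then obtain \<Lambda> where "\<forall>j. A *v column j Q = \<Lambda> j *\<^sub>R column j Q" by (rule choice[THEN exE])
  ultimately show ?thesis using that by blast
qed

text \<open>The relation \<open>A Q = Q diag \<Lambda>\<close> is lifted to matrices over the
  polynomial ring, \<open>(X - A) Q = Q diag (X - \<Lambda>)\<close>. Taking determinants, the
  factor of \<open>Q\<close> cancels, since the constant matrices of \<open>transpose Q\<close> and
  \<open>Q\<close> multiply to 1.\<close>

lemma charpoly_diagonalized: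
  fixes A Q :: "real^'n^'n"
  assumes Q: "orthogonal_matrix Q" and eig: "\<And>j. A *v column j Q = \<Lambda> j *\<^sub>R column j Q"
  shows "charpoly A = (\<Prod>j\<in>UNIV. [:- \<Lambda> j, 1:])"
proof -
  let ?c = "\<lambda>M::real^'n^'n. (\<chi> i j. [:M $ i $ j:]) :: real poly^'n^'n"
  let ?D = "(\<chi> i j. if i = j then [:- \<Lambda> j, 1:] else 0) :: real poly^'n^'n"
  have const_sum: "(\<Sum>k\<in>S. [:f k:]) = [:\<Sum>k\<in>S. f k:]" for f :: "'n \<Rightarrow> real" and S
    by (induction S rule: infinite_finite_induct) auto
  have AQ: "(\<Sum>k\<in>UNIV. A $ i $ k * Q $ k $ j) = \<Lambda> j * Q $ i $ j" for i j
    using eig[of j] by (simp add: vec_eq_iff matrix_vector_mult_def column_def)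
  have "(mat [:0,1:] - ?c A) ** ?c Q = ?c Q ** ?D"
  proof (simp only: vec_eq_iff matrix_matrix_mult_def mat_def vec_lambda_beta vector_minus_component, intro allI)
    fix i j
    have "(\<Sum>k\<in>UNIV. ((if i = k then [:0, 1:] else 0) - [:A $ i $ k:]) * [:Q $ k $ j:])
        = (\<Sum>k\<in>UNIV. (if i = k then [:0,1:] * [:Q $ k $ j:] else 0)) - (\<Sum>k\<in>UNIV. [:A $ i $ k * Q $ k $ j:])"
      unfolding sum_subtractf[symmetric] by (intro sum.cong) (auto simp: algebra_simps)
    also have "\<dots> = [:0,1:] * [:Q $ i $ j:] - [:\<Lambda> j * Q $ i $ j:]"
      by (simp add: const_sum AQ)
    also have "\<dots> = (\<Sum>k\<in>UNIV. if k = j then [:Q $ i $ k:] * [:- \<Lambda> j, 1:] else 0)"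
      by (simp add: mult.commute)
    also have "\<dots> = (\<Sum>k\<in>UNIV. [:Q $ i $ k:] * (if k = j then [:- \<Lambda> j, 1:] else 0))"
      by (intro sum.cong) auto
    finally show "(\<Sum>k\<in>UNIV. ((if i = k then [:0, 1:] else 0) - [:A $ i $ k:]) * [:Q $ k $ j:]) =
       (\<Sum>k\<in>UNIV. [:Q $ i $ k:] * (if k = j then [:- \<Lambda> j, 1:] else 0))" .
  qed
  hence "charpoly A * det (?c Q) = det (?c Q) * det ?D"
    unfolding charpoly_def det_mul[symmetric] by simp
  moreover have "det (?c (transpose Q)) * det (?c Q) = 1"
  proof -
    have "?c (transpose Q) ** ?c Q = mat 1"
      using Q by (auto simp: orthogonal_matrix vec_eq_iff matrix_matrix_mult_def const_sum mat_def mult.commute one_pCons)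
    thus ?thesis unfolding det_mul[symmetric] by simp
  qed
  hence "det (?c Q) \<noteq> 0" by auto
  ultimately have "charpoly A = det ?D" by simp
  also have "\<dots> = (\<Prod>j\<in>UNIV. [:- \<Lambda> j, 1:])" by (subst det_diagonal) auto
  finally show ?thesis .
qed

lemma sorted_proots_charpoly_diagonalized:
  fixes A Q :: "real^'n^'n"
  assumes "orthogonal_matrix Q" "\<And>j. A *v column j Q = \<Lambda> j *\<^sub>R column j Q"
  defines "xs \<equiv> sorted_list_of_multiset (proots (charpoly A))"
  shows "mset xs = image_mset \<Lambda> (mset_set UNIV)" "sorted xs" "length xs = CARD('n)"
proof -
  have "proots (charpoly A) = (\<Sum>j\<in>UNIV. {#\<Lambda> j#})"
    unfolding charpoly_diagonalized[OF assms(1,2)] by (subst proots_prod) auto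
  also have "\<dots> = image_mset \<Lambda> (mset_set UNIV)"
    by (simp add: sum_unfold_sum_mset)
  finally show *: "mset xs = image_mset \<Lambda> (mset_set UNIV)" by (simp add: xs_def)
  show "sorted xs" by (simp add: xs_def)
  show "length xs = CARD('n)" using arg_cong[OF *, of size] by simp
qed

text \<open>A sum over eigenvalues depends only on their multiset. This is the passage from the
  sorted list behind \<open>eigval\<close>, indexed from 1, to eigenvalues indexed by the columns of
  an eigenframe, which carry no order.\<close>

lemma sum_eigval_diagonalized:
  fixes A Q :: "real^'n^'n"
  assumes "orthogonal_matrix Q" "\<And>j. A *v column j Q = \<Lambda> j *\<^sub>R column j Q"
  shows "(\<Sum>i = 1..CARD('n). f (eigval i A)) = (\<Sum>j\<in>UNIV. f (\<Lambda> j))"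
proof -
  let ?xs = "sorted_list_of_multiset (proots (charpoly A))"
  note xs = sorted_proots_charpoly_diagonalized[OF assms]
  have "(\<Sum>i = 1..CARD('n). f (eigval i A)) = (\<Sum>i<length ?xs. f (?xs ! i))"
    unfolding eigval_def xs(3)
    by (rule sum.reindex_bij_witness[where i = "\<lambda>i. i + 1" and j = "\<lambda>i. i - 1"]) auto
  also have "\<dots> = sum_list (map f ?xs)" by (simp add: sum_list_sum_nth atLeast0LessThan)
  also have "\<dots> = sum_mset (image_mset f (mset ?xs))" by (metis mset_map sum_mset_sum_list)
  also have "\<dots> = (\<Sum>j\<in>UNIV. f (\<Lambda> j))" unfolding xs(1) 
    by (simp add: sum_unfold_sum_mset multiset.map_comp comp_def)
  finally show ?thesis .
qed

lemma eigval_min_max_diagonalized: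
  fixes A Q :: "real^'n^'n"
  assumes "orthogonal_matrix Q" "\<And>j. A *v column j Q = \<Lambda> j *\<^sub>R column j Q"
  shows "eigval_min A \<le> \<Lambda> j" "\<Lambda> j \<le> eigval_max A"
proof -
  let ?xs = "sorted_list_of_multiset (proots (charpoly A))"
  note xs = sorted_proots_charpoly_diagonalized[OF assms]
  have "\<Lambda> j \<in># mset ?xs" unfolding xs(1) by simp
  then obtain k where k: "k < CARD('n)" "?xs ! k = \<Lambda> j" using xs(3) by (metis in_set_conv_nth set_mset_mset)
  show "eigval_min A \<le> \<Lambda> j"
    using sorted_nth_mono[OF xs(2), of 0 k] k xs(3) by (simp add: eigval_min_def eigval_def)
  show "\<Lambda> j \<le> eigval_max A"
    using sorted_nth_mono[OF xs(2), of k "CARD('n) - 1"] k xs(3) by (simp add: eigval_max_def eigval_def)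
qed

section \<open>Second derivatives of determinants\<close>

lemma det_has_derivative:
  fixes W :: "'x::real_normed_vector \<Rightarrow> 'a::real_normed_field^'n^'n"
  assumes "\<And>i j. ((\<lambda>t. W t $ i $ j) has_derivative W' i j) (at s)"
  shows "((\<lambda>t. det (W t)) has_derivative
    (\<lambda>h. \<Sum>p | p permutes UNIV. of_int (sign p) * (\<Sum>k\<in>UNIV. W' k (p k) h * (\<Prod>j\<in>UNIV - {k}. W s $ j $ p j)))) (at s)"
  unfolding det_def by (intro has_derivative_sum has_derivative_mult_right has_derivative_prod assms)

text \<open>A permutation other than the identity moves at least two points, so an off-diagonal zero
  remains even after factor \<open>k\<close> is deleted. Hence only the identity permutation
  contributes to the derivative of \<open>det\<close> at the identity matrix, which leaves the
  trace.\<close>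

lemma permutation_off_diagonal_prod:
  assumes p: "p permutes (UNIV :: 'n::finite set)" "p \<noteq> id"
  shows "(\<Prod>j\<in>UNIV - {k}. (mat 1 :: 'a::comm_semiring_1^'n^'n) $ j $ p j) = 0"
proof -
  have inj: "inj p" using p(1) permutes_inj by blast
  have "\<exists>j. j \<noteq> k \<and> p j \<noteq> j"
  proof (cases "p k = k")
    case True
    from p(2) obtain j where "p j \<noteq> j" by (auto simp: fun_eq_iff)
    with True show ?thesis by metis
  next
    case False
    then have "p (p k) \<noteq> p k" using inj by (auto dest: injD)
    with False show ?thesis by blast
  qed
  then obtain j where "j \<in> UNIV - {k}" "(mat 1 :: 'a^'n^'n) $ j $ p j = 0" by (auto simp: mat_def)
  thus ?thesis by (intro prod_zero) auto
qed

lemma det_has_vector_derivative_at_identity: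
  fixes W :: "real \<Rightarrow> 'a::real_normed_field^'n^'n"
  assumes W: "\<And>i j. ((\<lambda>t. W t $ i $ j) has_vector_derivative W' $ i $ j) (at s)" and id: "W s = mat 1"
  shows "((\<lambda>t. det (W t)) has_vector_derivative (\<Sum>k\<in>UNIV. W' $ k $ k)) (at s)"
proof -
  have *: "(\<Sum>p | p permutes UNIV. of_int (sign p) * (\<Sum>k\<in>UNIV. (h *\<^sub>R W' $ k $ p k) *
        (\<Prod>j\<in>UNIV - {k}. W s $ j $ p j))) = h *\<^sub>R (\<Sum>k\<in>UNIV. W' $ k $ k)" (is "?L = ?R") for h
  proof -
    have "?L = (\<Sum>p\<in>{id}. of_int (sign p) * (\<Sum>k\<in>UNIV. (h *\<^sub>R W' $ k $ p k) * (\<Prod>j\<in>UNIV - {k}. W s $ j $ p j)))"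
      by (rule sum.mono_neutral_right)
        (auto simp: id permutation_off_diagonal_prod permutes_id finite_permutations)
    also have "\<dots> = ?R" by (simp add: id mat_def scaleR_sum_right sign_id)
    finally show ?thesis .
  qed
  show ?thesis
    using det_has_derivative[of W "\<lambda>i j h. h *\<^sub>R W' $ i $ j" s] W
    unfolding has_vector_derivative_def * by simp
qed

lemma matrix_inv_mult:
  fixes A :: "'a::field^'n^'n"
  assumes "det A \<noteq> 0"
  shows "A ** matrix_inv A = mat 1" "matrix_inv A ** A = mat 1"
proof -
  from assms have "invertible A" by (simp add: invertible_det_nz)
  then obtain B where "A ** B = mat 1 \<and> B ** A = mat 1" unfolding invertible_def by blast
  hence "A ** matrix_inv A = mat 1 \<and> matrix_inv A ** A = mat 1"
    unfolding matrix_inv_def by (rule someI)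
  thus "A ** matrix_inv A = mat 1" "matrix_inv A ** A = mat 1" by auto
qed

text \<open>Exhibits the entries of the inverse as quotients of determinants, from which their
  differentiability is read off.\<close>

lemma matrix_inv_eq_cramer:
  fixes A :: "'a::field^'n^'n"
  assumes "det A \<noteq> 0"
  shows "matrix_inv A $ k $ j = det (\<chi> i l. if l = k then (axis j 1) $ i else A $ i $ l) / det A"
proof -
  have "A *v column j (matrix_inv A) = axis j 1"
    using matrix_inv_mult(1)[OF assms]
    by (simp add: vec_eq_iff matrix_vector_mult_def matrix_matrix_mult_def column_def mat_def axis_def)
  from cramer[OF assms, THEN iffD1, OF this] show ?thesis
    by (simp add: vec_eq_iff column_def)
qed

text \<open>Jacobi's formula. Factoring out \<open>Z s\<close> moves the base point to the identity
  matrix.\<close>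

lemma det_has_vector_derivative:
  fixes Z :: "real \<Rightarrow> 'a::real_normed_field^'n^'n"
  assumes Z: "\<And>i j. ((\<lambda>t. Z t $ i $ j) has_vector_derivative Z' $ i $ j) (at s)" and nz: "det (Z s) \<noteq> 0"
  shows "((\<lambda>t. det (Z t)) has_vector_derivative
    det (Z s) * (\<Sum>k\<in>UNIV. \<Sum>j\<in>UNIV. matrix_inv (Z s) $ k $ j * Z' $ j $ k)) (at s)"
proof -
  let ?B = "matrix_inv (Z s)"
  have *: "det (Z t) = det (Z s) * det (?B ** Z t)" for t
    unfolding det_mul[symmetric] matrix_mul_assoc matrix_inv_mult(1)[OF nz] by simp
  have "((\<lambda>t. det (?B ** Z t)) has_vector_derivative (\<Sum>k\<in>UNIV. (?B ** Z') $ k $ k)) (at s)"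
  proof (rule det_has_vector_derivative_at_identity)
    show "?B ** Z s = mat 1" using matrix_inv_mult(2)[OF nz] .
    show "((\<lambda>t. (?B ** Z t) $ i $ j) has_vector_derivative (?B ** Z') $ i $ j) (at s)" for i j
      unfolding matrix_matrix_mult_def vec_lambda_beta
      by (intro has_vector_derivative_sum has_vector_derivative_mult_right Z)
  qed
  from has_vector_derivative_mult_right[OF this, of "det (Z s)"] show ?thesis
    unfolding *[symmetric] by (simp add: matrix_matrix_mult_def)
qed

lemma matrix_inv_diagonal:
  fixes A :: "'a::field^'n^'n"
  assumes A: "\<And>i j. A $ i $ j = (if i = j then d i else 0)" and d: "\<And>i. d i \<noteq> 0"
  shows "det A \<noteq> 0" "matrix_inv A $ i $ j = (if i = j then 1 / d i else 0)"
proof -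
  have "det A = (\<Prod>i\<in>UNIV. d i)" using A by (subst det_diagonal) auto
  thus nz: "det A \<noteq> 0" using d by simp
  have "(A ** matrix_inv A) $ i $ j = (if i = j then 1 else 0)"
    unfolding matrix_inv_mult(1)[OF nz] by (simp add: mat_def)
  moreover have "(A ** matrix_inv A) $ i $ j = (\<Sum>k\<in>UNIV. if i = k then d i * matrix_inv A $ k $ j else 0)"
    unfolding matrix_matrix_mult_def vec_lambda_beta by (intro sum.cong) (auto simp: A)
  ultimately show "matrix_inv A $ i $ j = (if i = j then 1 / d i else 0)" using d[of i]
    by (auto simp: field_simps)
qed

lemma matrix_inv_differentiable:
  fixes Z :: "real \<Rightarrow> 'a::real_normed_field^'n^'n"
  assumes Z: "\<And>i j. (\<lambda>t. Z t $ i $ j) differentiable (at s)"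
    and nz: "\<forall>\<^sub>F t in nhds s. det (Z t) \<noteq> 0"
  shows "(\<lambda>t. matrix_inv (Z t) $ k $ j) differentiable (at s)"
proof -
  have D: "(\<lambda>t. det (V t)) differentiable (at s)"
    if "\<And>i j. (\<lambda>t. V t $ i $ j) differentiable (at s)" for V :: "real \<Rightarrow> 'a^'n^'n"
  proof -
    from that obtain V' where "\<And>i j. ((\<lambda>t. V t $ i $ j) has_derivative V' i j) (at s)"
      unfolding differentiable_def by metis
    from det_has_derivative[OF this] show ?thesis by (rule differentiableI)
  qed
  have "(\<lambda>t. det (\<chi> i l. if l = k then (axis j 1) $ i else Z t $ i $ l)) differentiable (at s)"
  proof (rule D)
    show "(\<lambda>t. (\<chi> i l. if l = k then (axis j 1) $ i else Z t $ i $ l) $ a $ b) differentiable (at s)" for a b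
      using Z by (cases "b = k") auto
  qed
  moreover have "det (Z s) \<noteq> 0" using eventually_nhds_x_imp_x[OF nz] .
  ultimately have "(\<lambda>t. det (\<chi> i l. if l = k then (axis j 1) $ i else Z t $ i $ l) / det (Z t)) differentiable (at s)"
    by (intro differentiable_divide D[OF Z]) auto
  then obtain f' where f': "((\<lambda>t. det (\<chi> i l. if l = k then (axis j 1) $ i else Z t $ i $ l) / det (Z t)) has_derivative f') (at s)"
    unfolding differentiable_def by blast
  have "((\<lambda>t. matrix_inv (Z t) $ k $ j) has_derivative f') (at s)"
  proof (rule has_derivative_transform_eventually[OF f'])
    show "\<forall>\<^sub>F t in at s. det (\<chi> i l. if l = k then (axis j 1) $ i else Z t $ i $ l) / det (Z t) = matrix_inv (Z t) $ k $ j"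
      using nz unfolding eventually_nhds_conv_at by (auto elim!: eventually_mono simp: matrix_inv_eq_cramer)
  qed (use eventually_nhds_x_imp_x[OF nz] in \<open>auto simp: matrix_inv_eq_cramer\<close>)
  thus ?thesis by (rule differentiableI)
qed

text \<open>Differentiability is already available from Cramer's rule, so the value follows by
  differentiating \<open>Z^-1 Z = 1\<close>. It is the general formula
  \<open>- Z^-1 Z' Z^-1\<close>, read at a diagonal matrix.\<close>

lemma matrix_inv_has_vector_derivative_at_diagonal:
  fixes Z :: "real \<Rightarrow> 'a::real_normed_field^'n^'n"
  assumes Z: "\<And>i j. ((\<lambda>t. Z t $ i $ j) has_vector_derivative Z' $ i $ j) (at s)"
    and nz: "\<forall>\<^sub>F t in nhds s. det (Z t) \<noteq> 0"
    and diag: "\<And>i j. Z s $ i $ j = (if i = j then d i else 0)" and d: "\<And>i. d i \<noteq> 0"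
  shows "((\<lambda>t. matrix_inv (Z t) $ a $ b) has_vector_derivative - (Z' $ a $ b / (d a * d b))) (at s)"
proof -
  have "(\<lambda>t. matrix_inv (Z t) $ i $ j) differentiable (at s)" for i j
    by (intro matrix_inv_differentiable nz differentiableI_vector[OF Z])
  then have Y: "((\<lambda>t. matrix_inv (Z t) $ i $ j) has_vector_derivative
      vector_derivative (\<lambda>t. matrix_inv (Z t) $ i $ j) (at s)) (at s)" for i j
    by (simp add: vector_derivative_works)
  define Y' where "Y' i j = vector_derivative (\<lambda>t. matrix_inv (Z t) $ i $ j) (at s)" for i j
  note Y = Y[folded Y'_def]
  have 1: "((\<lambda>t. \<Sum>k\<in>UNIV. matrix_inv (Z t) $ a $ k * Z t $ k $ b) has_vector_derivative
      (\<Sum>k\<in>UNIV. matrix_inv (Z s) $ a $ k * Z' $ k $ b + Y' a k * Z s $ k $ b)) (at s)"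
    by (intro has_vector_derivative_sum has_vector_derivative_mult Y Z)
  have 2: "((\<lambda>t. \<Sum>k\<in>UNIV. matrix_inv (Z t) $ a $ k * Z t $ k $ b) has_vector_derivative 0) (at s)"
  proof -
    have "\<forall>\<^sub>F t in nhds s. (\<Sum>k\<in>UNIV. matrix_inv (Z t) $ a $ k * Z t $ k $ b) = (mat 1 :: 'a^'n^'n) $ a $ b"
      using nz
    proof eventually_elim
      case (elim t)
      show ?case unfolding matrix_inv_mult(2)[OF elim, symmetric] by (simp add: matrix_matrix_mult_def)
    qed
    hence "((\<lambda>t. \<Sum>k\<in>UNIV. matrix_inv (Z t) $ a $ k * Z t $ k $ b) has_vector_derivative 0) (at s) =
      ((\<lambda>t. (mat 1 :: 'a^'n^'n) $ a $ b) has_vector_derivative 0) (at s)"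
      by (intro has_vector_derivative_cong_ev) (auto dest: eventually_nhds_x_imp_x)
    thus ?thesis by simp
  qed
  have "(\<Sum>k\<in>UNIV. matrix_inv (Z s) $ a $ k * Z' $ k $ b + Y' a k * Z s $ k $ b) = 0"
    using vector_derivative_unique_at[OF 1 2] .
  also have "(\<Sum>k\<in>UNIV. matrix_inv (Z s) $ a $ k * Z' $ k $ b + Y' a k * Z s $ k $ b)
     = (\<Sum>k\<in>UNIV. if a = k then Z' $ k $ b / d a else 0) + (\<Sum>k\<in>UNIV. if k = b then Y' a k * d b else 0)"
    unfolding sum.distrib[symmetric]
    by (intro sum.cong) (auto simp: matrix_inv_diagonal[OF diag d] diag)
  finally have "Y' a b = - (Z' $ a $ b / (d a * d b))" using d[of a] d[of b] by (simp add: field_simps add_eq_0_iff)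
  thus ?thesis using Y[of a b] by simp
qed

text \<open>The function \<open>\<kappa>\<close> is the trace of \<open>Z^-1 Z'\<close>, the
  logarithmic derivative of \<open>det Z\<close>. Working with \<open>\<kappa>\<close> instead of a
  logarithm lets one statement serve both the real and the complex pencil, with no choice of
  branch.\<close>

lemma det_second_log_derivative_at_diagonal:
  fixes Z Z1 :: "real \<Rightarrow> 'a::real_normed_field^'n^'n"
  assumes Z: "\<forall>\<^sub>F t in nhds s. \<forall>i j. ((\<lambda>t. Z t $ i $ j) has_vector_derivative Z1 t $ i $ j) (at t)"
    and Z1: "\<And>i j. ((\<lambda>t. Z1 t $ i $ j) has_vector_derivative Z2 $ i $ j) (at s)"
    and diag: "\<And>i j. Z s $ i $ j = (if i = j then d i else 0)" and d: "\<And>i. d i \<noteq> 0"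
  obtains \<kappa> where "\<kappa> s = (\<Sum>a\<in>UNIV. Z1 s $ a $ a / d a)"
    "\<forall>\<^sub>F t in nhds s. det (Z t) \<noteq> 0 \<and> ((\<lambda>t. det (Z t)) has_vector_derivative det (Z t) * \<kappa> t) (at t)"
    "(\<kappa> has_vector_derivative
       (\<Sum>a\<in>UNIV. Z2 $ a $ a / d a) - (\<Sum>a\<in>UNIV. \<Sum>b\<in>UNIV. Z1 s $ a $ b * Z1 s $ b $ a / (d a * d b))) (at s)"
proof -
  have Zs: "((\<lambda>t. Z t $ i $ j) has_vector_derivative Z1 s $ i $ j) (at s)" for i j
    using eventually_nhds_x_imp_x[OF Z] by blast
  have nz0: "det (Z s) \<noteq> 0" using matrix_inv_diagonal(1)[OF diag d] .
  have "isCont (\<lambda>t. det (Z t)) s"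
    using det_has_vector_derivative[OF Zs nz0] has_vector_derivative_continuous by blast
  hence nz: "\<forall>\<^sub>F t in nhds s. det (Z t) \<noteq> 0"
    using nz0 unfolding isCont_def eventually_nhds_conv_at by (auto intro: tendsto_imp_eventually_ne)
  define \<kappa> where "\<kappa> t = (\<Sum>k\<in>UNIV. \<Sum>j\<in>UNIV. matrix_inv (Z t) $ k $ j * Z1 t $ j $ k)" for t
  have "\<forall>\<^sub>F t in nhds s. det (Z t) \<noteq> 0 \<and> ((\<lambda>t. det (Z t)) has_vector_derivative det (Z t) * \<kappa> t) (at t)"
    using nz Z by eventually_elim (auto simp: \<kappa>_def intro!: det_has_vector_derivative)
  moreover have "(\<kappa> has_vector_derivative (\<Sum>a\<in>UNIV. \<Sum>b\<in>UNIV. matrix_inv (Z s) $ a $ b * Z2 $ b $ a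
      + - (Z1 s $ a $ b / (d a * d b)) * Z1 s $ b $ a)) (at s)"
    unfolding \<kappa>_def
    by (intro has_vector_derivative_sum has_vector_derivative_mult Z1
        matrix_inv_has_vector_derivative_at_diagonal[OF Zs nz diag d])
  moreover have "(\<Sum>a\<in>UNIV. \<Sum>b\<in>UNIV. matrix_inv (Z s) $ a $ b * Z2 $ b $ a + - (Z1 s $ a $ b / (d a * d b)) * Z1 s $ b $ a)
    = (\<Sum>a\<in>UNIV. \<Sum>b\<in>UNIV. if a = b then Z2 $ b $ a / d a else 0) - (\<Sum>a\<in>UNIV. \<Sum>b\<in>UNIV. Z1 s $ a $ b * Z1 s $ b $ a / (d a * d b))"
    unfolding sum_subtractf[symmetric]
    by (intro sum.cong) (auto simp: matrix_inv_diagonal[OF diag d])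
  moreover have "\<kappa> s = (\<Sum>a\<in>UNIV. Z1 s $ a $ a / d a)"
  proof -
    have "\<kappa> s = (\<Sum>a\<in>UNIV. \<Sum>b\<in>UNIV. if a = b then Z1 s $ b $ a / d a else 0)"
      unfolding \<kappa>_def by (intro sum.cong) (auto simp: matrix_inv_diagonal[OF diag d])
    thus ?thesis by simp
  qed
  ultimately show ?thesis using that[of \<kappa>] by simp
qed

section \<open>A trace-free cubic form weighted by cotangents\<close>

text \<open>Two angles suffice, by induction: \<open>tan x + tan y\<close> is
  \<open>sin (x + y)\<close> divided by \<open>cos x * cos y\<close>, and this denominator is at
  least \<open>cos (x + y)\<close>.\<close>

lemma sum_tan_le_tan_sum:
  assumes "finite I" "\<And>a. a \<in> I \<Longrightarrow> 0 < A a" "(\<Sum>a\<in>I. A a) < pi / 2"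
  shows "(\<Sum>a\<in>I. tan (A a)) \<le> tan (\<Sum>a\<in>I. A a)"
  using assms
proof (induction I rule: finite_induct)
  case (insert k I)
  define x y where "x = A k" and "y = (\<Sum>a\<in>I. A a)"
  have x: "0 < x" and xy: "x + y < pi / 2" using insert by (auto simp: x_def y_def)
  have y: "0 \<le> y" unfolding y_def using insert by (intro sum_nonneg less_imp_le) auto
  have pos: "cos x > 0" "cos y > 0" "cos (x + y) > 0" using x y xy by (auto intro!: cos_gt_zero_pi)
  have "tan x + tan y = sin (x + y) / (cos x * cos y)"
    using pos by (simp add: tan_def sin_add field_simps)
  also have "\<dots> \<le> sin (x + y) / cos (x + y)"
  proof (intro divide_left_mono)
    show "cos (x + y) \<le> cos x * cos y" using x y xy by (simp add: cos_add sin_ge_zero)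
    show "0 \<le> sin (x + y)" using x y xy by (intro sin_ge_zero) auto
  qed (use pos in auto)
  finally have "tan x + tan y \<le> tan (x + y)" by (simp add: tan_def)
  moreover have "(\<Sum>a\<in>I. tan (A a)) \<le> tan y"
    unfolding y_def using insert.prems x xy by (intro insert.IH) (auto simp: y_def)
  ultimately show ?case using insert by (simp add: x_def y_def)
qed simp

text \<open>What is used about the cotangents of positive angles with sum \<open>\<pi>\<close>: at most one is negative,
  and the tangents of the remaining angles are then superadditive.\<close>

definition cotangent_triangle :: "('n::finite \<Rightarrow> real) \<Rightarrow> bool" where
  "cotangent_triangle t \<longleftrightarrow>
    (\<forall>m. t m < 0 \<longrightarrow> (\<forall>a. a \<noteq> m \<longrightarrow> 0 < t a) \<and> (\<Sum>a\<in>UNIV - {m}. 1 / t a) \<le> 1 / - t m)"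

text \<open>A negative cotangent means an obtuse angle, so the other angles have sum below
  \<open>pi / 2\<close>, namely \<open>pi - A m\<close>. They are acute, and superadditivity of the
  tangent gives the inequality on reciprocals.\<close>

lemma cotangent_triangle_cot:
  fixes A :: "'n::finite \<Rightarrow> real"
  assumes A: "\<And>a. 0 < A a" "\<And>a. A a < pi" and sum: "(\<Sum>a\<in>UNIV. A a) = pi"
  shows "cotangent_triangle (\<lambda>a. cot (A a))"
  unfolding cotangent_triangle_def
proof safe
  fix m assume m: "cot (A m) < 0"
  have "pi / 2 < A m"
  proof (rule ccontr)
    assume "\<not> pi / 2 < A m"
    hence "0 \<le> cos (A m)" "0 \<le> sin (A m)"
      using A(1)[of m] A(2)[of m] by (auto intro!: cos_ge_zero sin_ge_zero)
    hence "0 \<le> cot (A m)" by (simp add: cot_def)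
    with m show False by simp
  qed
  have rest: "(\<Sum>a\<in>UNIV - {m}. A a) = pi - A m" using sum by (simp add: sum_diff1)
  have less: "A a < pi / 2" if "a \<noteq> m" for a
  proof -
    have "A a \<le> (\<Sum>a\<in>UNIV - {m}. A a)" using that A by (intro member_le_sum) (auto intro: less_imp_le)
    thus ?thesis using rest \<open>pi / 2 < A m\<close> by simp
  qed
  show "0 < cot (A a)" if "a \<noteq> m" for a
    using less[OF that] A[of a] by (auto simp: cot_def intro!: divide_pos_pos cos_gt_zero_pi sin_gt_zero)
  have "(\<Sum>a\<in>UNIV - {m}. 1 / cot (A a)) = (\<Sum>a\<in>UNIV - {m}. tan (A a))"
    by (simp add: tan_def cot_def)
  also have "\<dots> \<le> tan (pi - A m)"
    unfolding rest[symmetric] using rest \<open>pi / 2 < A m\<close> A by (intro sum_tan_le_tan_sum) auto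
  also have "\<dots> = 1 / - cot (A m)" by (simp add: tan_def cot_def)
  finally show "(\<Sum>a\<in>UNIV - {m}. 1 / cot (A a)) \<le> 1 / - cot (A m)" .
qed

section \<open>Weighted quadratic inequalities for a single row\<close>

lemma sum_squares_le_square_bound:
  fixes r :: "'i \<Rightarrow> real"
  assumes "finite J" "\<And>a. a \<in> J \<Longrightarrow> 0 < r a" "(\<Sum>a\<in>J. r a) \<le> q"
  shows "(\<Sum>a\<in>J. (r a)^2) \<le> q^2"
proof -
  have le: "r a \<le> q" if "a \<in> J" for a
    using member_le_sum[of a J r] assms that by (force intro: less_imp_le)
  have q: "0 \<le> q" using assms by (meson less_imp_le order_trans sum_nonneg)
  have "(\<Sum>a\<in>J. (r a)^2) \<le> (\<Sum>a\<in>J. r a * q)"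
    unfolding power2_eq_square using le assms by (intro sum_mono mult_left_mono) (auto intro: less_imp_le)
  also have "\<dots> \<le> q * q" unfolding sum_distrib_right[symmetric] using assms q by (intro mult_right_mono) auto
  finally show ?thesis by (simp add: power2_eq_square)
qed

text \<open>At most one weight exceeds \<open>1 / 2\<close>; eliminating the others by Cauchy--Schwarz leaves a perfect
  square. The same elimination gives the next lemma.\<close>

lemma quadratic_form_nonneg_obtuse_apex:
  fixes r w :: "'i \<Rightarrow> real"
  assumes I: "finite I" "\<And>a. a \<in> I \<Longrightarrow> 0 < r a" "(\<Sum>a\<in>I. r a) \<le> 1"
  shows "0 \<le> (\<Sum>a\<in>I. r a * w a)^2 + (\<Sum>a\<in>I. (1 - 2 * r a) * (w a)^2)"
proof (cases "\<forall>a\<in>I. r a \<le> 1/2")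
  case True
  thus ?thesis by (intro add_nonneg_nonneg sum_nonneg mult_nonneg_nonneg) auto
next
  case False
  then obtain k where k: "k \<in> I" "r k > 1/2" by force
  define J q X W where "J = I - {k}" and "q = 1 - r k" and "X = (\<Sum>a\<in>J. r a * w a)" and "W = (\<Sum>a\<in>J. (w a)^2)"
  have split: "(\<Sum>a\<in>I. f a) = f k + (\<Sum>a\<in>J. f a)" for f :: "'i \<Rightarrow> real"
    using I(1) k(1) by (simp add: J_def sum.remove)
  have J: "finite J" "\<And>a. a \<in> J \<Longrightarrow> 0 < r a" "(\<Sum>a\<in>J. r a) \<le> q"
    using I k split[of r] by (auto simp: J_def q_def)
  have q: "0 \<le> q" using J by (meson less_imp_le order_trans sum_nonneg)
  have W: "0 \<le> W" by (simp add: W_def sum_nonneg)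
  have "X^2 \<le> (\<Sum>a\<in>J. (r a)^2) * W" unfolding X_def W_def by (rule Cauchy_Schwarz_ineq_sum)
  also have "\<dots> \<le> q^2 * W" using W sum_squares_le_square_bound[OF J] by (intro mult_right_mono) auto
  finally have XW: "X^2 \<le> q^2 * W" .
  have "(2 * r k - 1) * W \<le> (\<Sum>a\<in>J. (1 - 2 * r a) * (w a)^2)"
    unfolding W_def sum_distrib_left
  proof (intro sum_mono mult_right_mono)
    fix a assume "a \<in> J"
    then have "r a \<le> q" using member_le_sum[of a J r] J by (force intro: less_imp_le)
    thus "2 * r k - 1 \<le> 1 - 2 * r a" by (simp add: q_def)
  qed auto
  moreover have "0 \<le> (r k * w k + X)^2 + (1 - 2 * r k) * (w k)^2 + (2 * r k - 1) * W"
  proof (cases "q = 0")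
    case True
    hence "X = 0" "r k = 1" using XW by (auto simp: q_def)
    thus ?thesis using W by simp
  next
    case False
    \<comment> \<open>Completing the square in \<open>w k\<close>: its total coefficient is
      \<open>(r k)^2 + 1 - 2 * r k = q^2\<close>, and
      \<open>q^2 + 2 * r k - 1 = (r k)^2\<close>.\<close>
    have "(q^2 * w k + r k * X)^2 = q^2 * ((r k * w k + X)^2 + (1 - 2 * r k) * (w k)^2) + (2 * r k - 1) * X^2"
      by (simp add: q_def power2_eq_square algebra_simps)
    also have "\<dots> \<le> q^2 * ((r k * w k + X)^2 + (1 - 2 * r k) * (w k)^2) + (2 * r k - 1) * (q^2 * W)"
      using k XW by (intro add_left_mono mult_left_mono) auto
    also have "\<dots> = q^2 * ((r k * w k + X)^2 + (1 - 2 * r k) * (w k)^2 + (2 * r k - 1) * W)"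
      by (simp add: algebra_simps)
    finally have "0 \<le> q^2 * ((r k * w k + X)^2 + (1 - 2 * r k) * (w k)^2 + (2 * r k - 1) * W)"
      by (rule order_trans[OF zero_le_power2])
    thus ?thesis using False by (simp add: zero_le_mult_iff)
  qed
  ultimately show ?thesis unfolding split X_def[symmetric] by linarith
qed

lemma quadratic_form_nonneg_acute_apex:
  fixes r w :: "'i \<Rightarrow> real"
  assumes J: "finite J" "\<And>a. a \<in> J \<Longrightarrow> 0 < r a" and \<rho>: "0 < \<rho>" "\<rho> + (\<Sum>a\<in>J. r a) \<le> 1"
  shows "(2 / \<rho> - 1) * (\<rho> * v + (\<Sum>a\<in>J. r a * w a))^2 \<le> v^2 + (\<Sum>a\<in>J. (1 + 2 * r a / \<rho>) * (w a)^2)"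
proof -
  define q X S where "q = 1 - \<rho>" and "X = (\<Sum>a\<in>J. r a * w a)" and "S = (\<Sum>a\<in>J. (1 + 2 * r a / \<rho>) * (w a)^2)"
  have rq: "(\<Sum>a\<in>J. r a) \<le> q" using \<rho> by (simp add: q_def)
  have q: "0 \<le> q" using J rq by (meson less_imp_le order_trans sum_nonneg)
  have pos: "0 < 1 + 2 * r a / \<rho>" if "a \<in> J" for a using J(2)[OF that] \<rho> by (simp add: add_pos_pos)
  have S: "0 \<le> S" unfolding S_def using pos by (intro sum_nonneg mult_nonneg_nonneg) (auto intro: less_imp_le)
  \<comment> \<open>The weights of the quadratic form itself are split off before Cauchy-Schwarz, so
    that the second factor is exactly \<open>S\<close>.\<close>
  have Xeq: "X = (\<Sum>a\<in>J. (r a / sqrt (1 + 2 * r a / \<rho>)) * (sqrt (1 + 2 * r a / \<rho>) * w a))"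
    unfolding X_def
  proof (intro sum.cong refl)
    fix a assume "a \<in> J"
    from pos[OF this] have "sqrt (1 + 2 * r a / \<rho>) \<noteq> 0" by simp
    thus "r a * w a = r a / sqrt (1 + 2 * r a / \<rho>) * (sqrt (1 + 2 * r a / \<rho>) * w a)" by simp
  qed
  have CS: "X^2 \<le> (\<Sum>a\<in>J. (r a / sqrt (1 + 2 * r a / \<rho>))^2) * (\<Sum>a\<in>J. (sqrt (1 + 2 * r a / \<rho>) * w a)^2)"
    unfolding Xeq by (rule Cauchy_Schwarz_ineq_sum)
  have Seq: "(\<Sum>a\<in>J. (sqrt (1 + 2 * r a / \<rho>) * w a)^2) = S"
    unfolding S_def
  proof (intro sum.cong refl)
    fix a assume "a \<in> J"
    from pos[OF this] show "(sqrt (1 + 2 * r a / \<rho>) * w a)^2 = (1 + 2 * r a / \<rho>) * (w a)^2"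
      by (simp only: power_mult_distrib real_sqrt_pow2[OF less_imp_le])
  qed
  note CS[unfolded Seq]
  also have "(\<Sum>a\<in>J. (r a / sqrt (1 + 2 * r a / \<rho>))^2) * S \<le> (\<rho> * q^2 / (2 - \<rho>)) * S"
  proof (intro mult_right_mono[OF _ S])
    have "(\<Sum>a\<in>J. (r a / sqrt (1 + 2 * r a / \<rho>))^2) \<le> (\<Sum>a\<in>J. r a * (\<rho> * q / (2 - \<rho>)))"
    proof (intro sum_mono)
      fix a assume a: "a \<in> J"
      have le: "r a \<le> q" using member_le_sum[of a J r] J rq a by (force intro: less_imp_le)
      have "(r a / sqrt (1 + 2 * r a / \<rho>))^2 = (r a)^2 / (1 + 2 * r a / \<rho>)"
        by (simp only: power_divide real_sqrt_pow2[OF less_imp_le[OF pos[OF a]]])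
      also have "\<dots> = r a * (\<rho> * r a / (\<rho> + 2 * r a))"
      proof -
        have "1 + 2 * r a / \<rho> = (\<rho> + 2 * r a) / \<rho>" using \<rho> by (simp add: add_divide_distrib)
        thus ?thesis by (simp add: power2_eq_square)
      qed
      \<comment> \<open>The map \<open>x \<mapsto> x / (\<rho> + 2 * x)\<close> is increasing and
        \<open>r a \<le> q\<close>; moreover \<open>\<rho> + 2 * q = 2 - \<rho>\<close>.\<close>
      also have "\<dots> \<le> r a * (\<rho> * q / (\<rho> + 2 * q))"
      proof (intro mult_left_mono)
        have "r a * \<rho> \<le> q * \<rho>" using le \<rho> by (intro mult_right_mono) auto
        hence "\<rho> * r a * (\<rho> + 2 * q) \<le> \<rho> * q * (\<rho> + 2 * r a)"
          using \<rho> by (simp add: distrib_left mult_ac)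
        thus "\<rho> * r a / (\<rho> + 2 * r a) \<le> \<rho> * q / (\<rho> + 2 * q)"
          using \<rho> J(2)[OF a] q by (simp add: divide_le_eq pos_le_divide_eq add_pos_pos add_pos_nonneg)
      qed (use J(2)[OF a] in simp)
      finally show "(r a / sqrt (1 + 2 * r a / \<rho>))^2 \<le> r a * (\<rho> * q / (2 - \<rho>))" by (simp add: q_def)
    qed
    also have "\<dots> \<le> q * (\<rho> * q / (2 - \<rho>))"
      unfolding sum_distrib_right[symmetric] using rq \<rho> q by (intro mult_right_mono) (auto simp: q_def)
    finally show "(\<Sum>a\<in>J. (r a / sqrt (1 + 2 * r a / \<rho>))^2) \<le> \<rho> * q^2 / (2 - \<rho>)"
      by (simp add: power2_eq_square mult_ac)
  qed
  finally have "X^2 \<le> \<rho> * q^2 * S / (2 - \<rho>)" by simp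
  moreover have \<rho>2: "0 < 2 - \<rho>" using q by (simp add: q_def)
  ultimately have XS: "(2 - \<rho>) * X^2 \<le> \<rho> * q^2 * S" by (simp only: pos_le_divide_eq mult.commute[of _ "2 - \<rho>"])
  have "(2 - \<rho>) * (\<rho> * v + X)^2 \<le> \<rho> * (v^2 + S)"
  proof (cases "q = 0")
    case True
    hence "X = 0" "\<rho> = 1" using XS by (auto simp: q_def)
    thus ?thesis using S by simp
  next
    case False
    \<comment> \<open>Completing the square in \<open>v\<close>, using
      \<open>\<rho> - (2 - \<rho>) * \<rho>^2 = \<rho> * q^2\<close> and
      \<open>1 - q^2 = \<rho> * (2 - \<rho>)\<close>.\<close>
    have "0 \<le> \<rho> * (q^2 * v - (2 - \<rho>) * X)^2" using \<rho> by simp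
    also have "\<dots> = q^2 * (\<rho> * v^2 - (2 - \<rho>) * (\<rho> * v + X)^2) + (2 - \<rho>) * X^2"
      by (simp add: q_def power2_eq_square algebra_simps)
    also have "\<dots> \<le> q^2 * (\<rho> * v^2 - (2 - \<rho>) * (\<rho> * v + X)^2) + \<rho> * q^2 * S" using XS by simp
    also have "\<dots> = q^2 * (\<rho> * (v^2 + S) - (2 - \<rho>) * (\<rho> * v + X)^2)" by (simp add: algebra_simps)
    finally show ?thesis using False by (simp add: zero_le_mult_iff)
  qed
  hence "(2 - \<rho>) * (\<rho> * v + X)^2 / \<rho> \<le> v^2 + S" using \<rho> by (simp only: pos_divide_le_eq mult.commute)
  moreover have "2 / \<rho> - 1 = (2 - \<rho>) / \<rho>" using \<rho> by (simp add: diff_divide_distrib)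
  ultimately show ?thesis unfolding X_def[symmetric] S_def[symmetric] by simp
qed

text \<open>Here \<open>y\<close> stands for the row \<open>h a a i\<close> with \<open>i\<close>
  fixed. Only a negative \<open>t m\<close> can spoil the sign. The trace condition expresses
  \<open>y m\<close> through the other entries, and the bound on the reciprocals makes the weights
  \<open>r a\<close> sum to at most 1. The cases \<open>m = i\<close> and
  \<open>m \<noteq> i\<close> are the two quadratic inequalities with obtuse and acute apex.\<close>

lemma trace_free_row_nonneg:
  fixes t y :: "'n::finite \<Rightarrow> real"
  assumes t: "cotangent_triangle t" and y: "(\<Sum>a\<in>UNIV. y a) = 0"
  shows "0 \<le> (t i)^2 * (y i)^2 + (\<Sum>a\<in>UNIV - {i}. ((t a)^2 + 2 * t a * t i) * (y a)^2)"
proof (cases "\<forall>m. 0 \<le> t m")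
  case True
  thus ?thesis by (intro add_nonneg_nonneg sum_nonneg mult_nonneg_nonneg) auto
next
  case False
  then obtain m where m: "t m < 0" by (auto simp: not_le)
  \<comment> \<open>This scaling turns every \<open>(t a)^2 * (y a)^2\<close> into
    \<open>\<tau>^2 * (w a)^2\<close>, so that only the ratios \<open>r a\<close> remain in the
    inequality.\<close>
  define \<tau> r w where "\<tau> = - t m" and "r a = \<tau> / t a" and "w a = y a * t a / \<tau>" for a
  have \<tau>: "\<tau> > 0" using m by (simp add: \<tau>_def)
  have tpos: "0 < t a" if "a \<noteq> m" for a using t m that by (auto simp: cotangent_triangle_def)
  have rpos: "0 < r a" if "a \<noteq> m" for a using tpos[OF that] \<tau> by (simp add: r_def)
  have "(\<Sum>a\<in>UNIV - {m}. r a) = \<tau> * (\<Sum>a\<in>UNIV - {m}. 1 / t a)"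
    by (simp add: r_def sum_distrib_left)
  also have "\<dots> \<le> \<tau> * (1 / \<tau>)"
    using t m \<tau> by (intro mult_left_mono) (auto simp: cotangent_triangle_def \<tau>_def)
  finally have rsum: "(\<Sum>a\<in>UNIV - {m}. r a) \<le> 1" using \<tau> by simp
  have yw: "y a = r a * w a" if "a \<noteq> m" for a using tpos[OF that] \<tau> by (simp add: r_def w_def)
  have sq: "(t a)^2 * (y a)^2 = \<tau>^2 * (w a)^2" for a using \<tau> by (simp add: w_def power_mult_distrib power_divide)
  show ?thesis
  proof (cases "m = i")
    case True
    have "y i = - (\<Sum>a\<in>UNIV - {i}. r a * w a)"
      using y yw True by (simp add: sum.remove[of UNIV i] add_eq_0_iff2)
    moreover have "((t a)^2 + 2 * t a * t i) * (y a)^2 = \<tau>^2 * ((1 - 2 * r a) * (w a)^2)" if "a \<noteq> i" for a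
    proof -
      have "2 * t a * t i * (y a)^2 = - 2 * \<tau>^2 * r a * (w a)^2"
        using tpos[of a] that True \<tau> by (simp add: w_def r_def \<tau>_def field_simps power2_eq_square)
      thus ?thesis by (simp add: distrib_right sq algebra_simps)
    qed
    ultimately have "(t i)^2 * (y i)^2 + (\<Sum>a\<in>UNIV - {i}. ((t a)^2 + 2 * t a * t i) * (y a)^2) =
       \<tau>^2 * ((\<Sum>a\<in>UNIV - {i}. r a * w a)^2 + (\<Sum>a\<in>UNIV - {i}. (1 - 2 * r a) * (w a)^2))"
      using True by (simp add: \<tau>_def distrib_left sum_distrib_left)
    also have "\<dots> \<ge> 0"
      using rpos rsum True by (intro mult_nonneg_nonneg quadratic_form_nonneg_obtuse_apex) auto
    finally show ?thesis .
  next
    case False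
    define J where "J = UNIV - {m} - {i}"
    have split: "(\<Sum>a\<in>UNIV - {m}. f a) = f i + (\<Sum>a\<in>J. f a)" for f :: "'n \<Rightarrow> real"
      using False by (simp add: J_def sum.remove)
    have split': "(\<Sum>a\<in>UNIV - {i}. f a) = f m + (\<Sum>a\<in>J. f a)" for f :: "'n \<Rightarrow> real"
      using False by (subst sum.remove[of _ m]) (auto simp: J_def intro!: sum.cong)
    have "y m = - (\<Sum>a\<in>UNIV - {m}. y a)" using y by (simp add: sum.remove[of UNIV m] add_eq_0_iff2)
    also have "(\<Sum>a\<in>UNIV - {m}. y a) = r i * w i + (\<Sum>a\<in>J. r a * w a)"
      unfolding split using False by (auto simp: yw J_def)
    finally have ym: "(y m)^2 = (r i * w i + (\<Sum>a\<in>J. r a * w a))^2" by (simp only: power2_minus)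
    \<comment> \<open>From \<open>t i = \<tau> / r i\<close>. This is the only negative coefficient
      of the row, since \<open>r i \<le> 1\<close>.\<close>
    have m': "((t m)^2 + 2 * t m * t i) = - (\<tau>^2 * (2 / r i - 1))"
      using tpos[of i] False \<tau> by (simp add: r_def \<tau>_def field_simps power2_eq_square)
    have a': "((t a)^2 + 2 * t a * t i) * (y a)^2 = \<tau>^2 * ((1 + 2 * r a / r i) * (w a)^2)" if "a \<in> J" for a
    proof -
      have "2 * t a * t i * (y a)^2 = 2 * \<tau>^2 * (r a / r i) * (w a)^2"
        using tpos[of a] tpos[of i] that False \<tau> by (simp add: w_def r_def J_def field_simps power2_eq_square)
      thus ?thesis by (simp add: distrib_right sq algebra_simps)
    qed
    have J': "(\<Sum>a\<in>J. ((t a)^2 + 2 * t a * t i) * (y a)^2) = \<tau>^2 * (\<Sum>a\<in>J. (1 + 2 * r a / r i) * (w a)^2)"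
      unfolding sum_distrib_left by (intro sum.cong refl a')
    have "(t i)^2 * (y i)^2 + (\<Sum>a\<in>UNIV - {i}. ((t a)^2 + 2 * t a * t i) * (y a)^2) =
       \<tau>^2 * ((w i)^2 + (\<Sum>a\<in>J. (1 + 2 * r a / r i) * (w a)^2)
          - (2 / r i - 1) * (r i * w i + (\<Sum>a\<in>J. r a * w a))^2)"
    proof -
      have "p * q + (- (p * R) * x + p * S) = p * (q + S - R * x)" for p q R x S :: real
        by (simp add: algebra_simps)
      thus ?thesis unfolding split' m' ym sq J' .
    qed
    also have "\<dots> \<ge> 0"
    proof (intro mult_nonneg_nonneg)
      have "(2 / r i - 1) * (r i * w i + (\<Sum>a\<in>J. r a * w a))^2 \<le> (w i)^2 + (\<Sum>a\<in>J. (1 + 2 * r a / r i) * (w a)^2)"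
        using rpos rsum False unfolding split by (intro quadratic_form_nonneg_acute_apex) (auto simp: J_def)
      thus "0 \<le> (w i)^2 + (\<Sum>a\<in>J. (1 + 2 * r a / r i) * (w a)^2)
          - (2 / r i - 1) * (r i * w i + (\<Sum>a\<in>J. r a * w a))^2" by simp
    qed simp
    finally show ?thesis .
  qed
qed

text \<open>Only the case of one negative value has content. There it is the inequality
  \<open>1 / t x + 1 / t y \<le> 1 / - t m\<close> with denominators cleared. For the three angles
  of a Euclidean triangle the expression would equal 1.\<close>

lemma cotangent_triangle_distinct:
  assumes t: "cotangent_triangle t" and "a \<noteq> b" "b \<noteq> i" "a \<noteq> i"
  shows "0 \<le> t a * t b + t b * t i + t i * t a"
proof -
  have neg: "0 \<le> t x * t y + t m * (t x + t y)" if m: "t m < 0" and d: "x \<noteq> y" "x \<noteq> m" "y \<noteq> m" for x y m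
  proof -
    have p: "0 < t x" "0 < t y" using t m d by (auto simp: cotangent_triangle_def)
    have "1 / t x + 1 / t y = (\<Sum>a\<in>{x, y}. 1 / t a)" using d by simp
    also have "\<dots> \<le> (\<Sum>a\<in>UNIV - {m}. 1 / t a)"
      using t m d by (intro sum_mono2) (auto simp: cotangent_triangle_def less_imp_le)
    also have "\<dots> \<le> 1 / - t m" using t m by (auto simp: cotangent_triangle_def)
    finally show ?thesis using p m by (simp add: field_simps)
  qed
  consider "t a < 0" | "t b < 0" | "t i < 0" | "0 \<le> t a" "0 \<le> t b" "0 \<le> t i" by linarith
  thus ?thesis
  proof cases
    case 1 then show ?thesis using neg[of a b i] assms by (simp add: algebra_simps)
  next
    case 2 then show ?thesis using neg[of b a i] assms by (simp add: algebra_simps)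
  next
    case 3 then show ?thesis using neg[of i a b] assms by (simp add: algebra_simps)
  qed simp
qed

text \<open>The claim is \<open>P \<ge> 0\<close>. By symmetry of \<open>h\<close>,
  \<open>3 * P\<close> carries the weight \<open>t a * t b + t b * t i + t i * t a\<close>. Distinct
  triples are nonnegative and are dropped; the others are regrouped into the rows
  \<open>h a a i\<close>, one for each \<open>i\<close>, to which the trace condition
  applies.\<close>

theorem trace_free_cubic_form_bound:
  fixes h :: "'n::finite \<Rightarrow> 'n \<Rightarrow> 'n \<Rightarrow> real"
  assumes t: "cotangent_triangle t" and sym: "\<And>a b i. h a b i = h b a i" "\<And>a b i. h a b i = h a i b"
    and tr: "\<And>i. (\<Sum>a\<in>UNIV. h a a i) = 0"
  shows "(\<Sum>a\<in>UNIV. \<Sum>b\<in>UNIV. \<Sum>i\<in>UNIV. (h a b i)^2) \<le> (\<Sum>a\<in>UNIV. \<Sum>b\<in>UNIV. \<Sum>i\<in>UNIV. (1 + t a * t b) * (h a b i)^2)"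
proof -
  define P where "P = (\<Sum>a\<in>UNIV. \<Sum>b\<in>UNIV. \<Sum>i\<in>UNIV. t a * t b * (h a b i)^2)"
  define T where "T a i = ((t a)^2 + 2 * t a * t i) * (h a a i)^2" for a i
  have P2: "P = (\<Sum>a\<in>UNIV. \<Sum>b\<in>UNIV. \<Sum>i\<in>UNIV. t i * t a * (h a b i)^2)"
  proof -
    have "P = (\<Sum>a\<in>UNIV. \<Sum>i\<in>UNIV. \<Sum>b\<in>UNIV. t a * t b * (h a b i)^2)"
      unfolding P_def by (intro sum.cong refl sum.swap)
    also have "\<dots> = (\<Sum>a\<in>UNIV. \<Sum>b\<in>UNIV. \<Sum>i\<in>UNIV. t i * t a * (h a b i)^2)"
      using sym(2) by (simp add: mult.commute)
    finally show ?thesis .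
  qed
  have P3: "P = (\<Sum>a\<in>UNIV. \<Sum>b\<in>UNIV. \<Sum>i\<in>UNIV. t b * t i * (h a b i)^2)"
    unfolding P2 by (subst sum.swap) (simp add: sym(1) mult.commute)
  have "3 * P = (\<Sum>a\<in>UNIV. \<Sum>b\<in>UNIV. \<Sum>i\<in>UNIV. (t a * t b + t b * t i + t i * t a) * (h a b i)^2)"
    using P_def P2 P3 by (simp add: distrib_right sum.distrib)
  \<comment> \<open>A triple with all indices equal satisfies all three conditions but is to be
    counted once, hence the correction by 2.\<close>
  also have "\<dots> \<ge> (\<Sum>a\<in>UNIV. \<Sum>b\<in>UNIV. \<Sum>i\<in>UNIV. (if a = b then T a i else 0) + (if b = i then T b a else 0)
      + (if i = a then T a b else 0) - 2 * (if a = b then if b = i then T a a else 0 else 0))"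
  proof (intro sum_mono)
    fix a b i :: 'n
    have h1: "h x y y = h y y x" and h2: "h y x y = h y y x" for x y using sym by metis+
    consider "a = b" | "a \<noteq> b" "b = i" | "a \<noteq> b" "b \<noteq> i" "i = a" | "a \<noteq> b" "b \<noteq> i" "i \<noteq> a" by blast
    thus "(if a = b then T a i else 0) + (if b = i then T b a else 0)
      + (if i = a then T a b else 0) - 2 * (if a = b then if b = i then T a a else 0 else 0)
      \<le> (t a * t b + t b * t i + t i * t a) * (h a b i)^2"
    proof cases
      case 1
      thus ?thesis by (simp add: T_def power2_eq_square algebra_simps)
    next
      case 2
      thus ?thesis by (simp add: T_def h1[of a] power2_eq_square algebra_simps)
    next
      case 3
      thus ?thesis by (simp add: T_def h2[of a b] power2_eq_square algebra_simps)
    next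
      case 4
      thus ?thesis using cotangent_triangle_distinct[OF t, of a b i] by simp
    qed
  qed
  also have "(\<Sum>a\<in>UNIV. \<Sum>b\<in>UNIV. \<Sum>i\<in>UNIV. (if a = b then T a i else 0) + (if b = i then T b a else 0)
      + (if i = a then T a b else 0) - 2 * (if a = b then if b = i then T a a else 0 else 0))
    = 3 * (\<Sum>i\<in>UNIV. \<Sum>a\<in>UNIV. T a i) - 2 * (\<Sum>i\<in>UNIV. T i i)"
  proof -
    have "(\<Sum>a\<in>UNIV. \<Sum>b\<in>UNIV. \<Sum>i\<in>UNIV. if a = b then T a i else 0) = (\<Sum>i\<in>UNIV. \<Sum>a\<in>UNIV. T a i)"
    proof -
      have "(\<Sum>a\<in>UNIV. \<Sum>b\<in>UNIV. \<Sum>i\<in>UNIV. if a = b then T a i else 0)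
          = (\<Sum>a\<in>UNIV. \<Sum>b\<in>UNIV. if a = b then \<Sum>i\<in>UNIV. T a i else 0)"
        by (intro sum.cong) auto
      also have "\<dots> = (\<Sum>a\<in>UNIV. \<Sum>i\<in>UNIV. T a i)" by simp
      also have "\<dots> = (\<Sum>i\<in>UNIV. \<Sum>a\<in>UNIV. T a i)" by (rule sum.swap)
      finally show ?thesis .
    qed
    moreover have "(\<Sum>a\<in>UNIV. \<Sum>b\<in>UNIV. \<Sum>i\<in>UNIV. if b = i then T b a else 0) = (\<Sum>i\<in>UNIV. \<Sum>a\<in>UNIV. T a i)"
      by simp
    moreover have "(\<Sum>a\<in>UNIV. \<Sum>b\<in>UNIV. \<Sum>i\<in>UNIV. if i = a then T a b else 0) = (\<Sum>i\<in>UNIV. \<Sum>a\<in>UNIV. T a i)"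
      by simp (rule sum.swap)
    moreover have "(\<Sum>a\<in>UNIV. \<Sum>b\<in>UNIV. \<Sum>i\<in>UNIV. if a = b then if b = i then T a a else 0 else 0) = (\<Sum>i\<in>UNIV. T i i)"
    proof -
      have "(\<Sum>a\<in>UNIV. \<Sum>b\<in>UNIV. \<Sum>i\<in>UNIV. if a = b then if b = i then T a a else 0 else 0) =
          (\<Sum>a\<in>UNIV. \<Sum>b\<in>UNIV. if a = b then T a a else 0)"
        by (intro sum.cong) auto
      thus ?thesis by simp
    qed
    ultimately show ?thesis
      by (simp only: sum.distrib sum_subtractf sum_distrib_left[symmetric])
  qed
  also have "\<dots> = 3 * (\<Sum>i\<in>UNIV. (t i)^2 * (h i i i)^2 + (\<Sum>a\<in>UNIV - {i}. T a i))"
  proof -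
    have "(\<Sum>a\<in>UNIV. T a i) = 3 * ((t i)^2 * (h i i i)^2) + (\<Sum>a\<in>UNIV - {i}. T a i)" for i
      by (simp add: sum.remove[of UNIV i] T_def power2_eq_square)
    moreover have "T i i = 3 * ((t i)^2 * (h i i i)^2)" for i by (simp add: T_def power2_eq_square)
    ultimately have "3 * (\<Sum>a\<in>UNIV. T a i) - 2 * T i i = 3 * ((t i)^2 * (h i i i)^2 + (\<Sum>a\<in>UNIV - {i}. T a i))" for i
      by (simp add: algebra_simps)
    hence "(\<Sum>i\<in>UNIV. 3 * (\<Sum>a\<in>UNIV. T a i) - 2 * T i i) =
      (\<Sum>i\<in>UNIV. 3 * ((t i)^2 * (h i i i)^2 + (\<Sum>a\<in>UNIV - {i}. T a i)))" by (simp only:)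
    thus ?thesis by (simp only: sum_distrib_left[symmetric] sum_subtractf)
  qed
  also have "\<dots> \<ge> 0"
    unfolding T_def using trace_free_row_nonneg[OF t tr] by (intro mult_nonneg_nonneg sum_nonneg) auto
  finally have "0 \<le> P" by simp
  thus ?thesis by (simp add: P_def distrib_right sum.distrib)
qed

section \<open>The strong minimum principle\<close>

text \<open>The barrier argument tests \<open>G\<close> only along the lines spanned by a frame, so
  the notion speaks of one line at a time; \<open>g1\<close> is the first derivative along it near
  the base point.\<close>

definition second_line_deriv :: "('a::real_normed_vector \<Rightarrow> real) \<Rightarrow> 'a \<Rightarrow> 'a \<Rightarrow> real \<Rightarrow> bool" where
  "second_line_deriv G x q D \<longleftrightarrow> (\<exists>g1. (\<forall>\<^sub>F t in nhds 0. ((\<lambda>t. G (x + t *\<^sub>R q)) has_real_derivative g1 t) (at t)) \<and>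
     (g1 has_real_derivative D) (at 0))"

lemma second_derivative_nonneg_at_min:
  fixes g :: "real \<Rightarrow> real"
  assumes min: "\<forall>\<^sub>F t in nhds 0. g 0 \<le> g t"
    and g: "\<forall>\<^sub>F t in nhds 0. (g has_real_derivative g1 t) (at t)" and g1: "(g1 has_real_derivative D) (at 0)"
  shows "0 \<le> D"
proof (rule ccontr)
  assume "\<not> 0 \<le> D"
  then obtain d1 where d1: "d1 > 0" "\<And>h. 0 < h \<Longrightarrow> h < d1 \<Longrightarrow> g1 h < g1 0"
    using DERIV_neg_dec_right[OF g1] by auto
  obtain d2 where d2: "d2 > 0" "\<And>t. \<bar>t\<bar> < d2 \<Longrightarrow> g 0 \<le> g t \<and> (g has_real_derivative g1 t) (at t)"
    using eventually_conj[OF min g] unfolding eventually_nhds_metric by (auto simp: dist_real_def)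
  have "g1 0 = 0"
    using d2 by (intro DERIV_local_min[of g "g1 0" 0 d2]) auto
  define h where "h = min d1 d2 / 2"
  have h: "0 < h" "h < d1" "h < d2" using d1 d2 by (auto simp: h_def)
  have "(g has_real_derivative g1 t) (at t)" if "0 \<le> t" "t \<le> h" for t using d2 h that by auto
  from MVT2[OF h(1) this] obtain z where z: "0 < z" "z < h" "g h - g 0 = (h - 0) * g1 z" by blast
  have "g1 z < 0" using d1(2)[of z] z h \<open>g1 0 = 0\<close> by simp
  hence "h * g1 z < 0" using h by (simp add: mult_pos_neg)
  hence "g h < g 0" using z(3) by simp
  moreover have "g 0 \<le> g h" using d2(2)[of h] h by simp
  ultimately show False by simp
qed

lemma second_line_deriv_nonneg_at_min:
  assumes "second_line_deriv G x q D" "open U" "x \<in> U" "\<And>y. y \<in> U \<Longrightarrow> G x \<le> G y"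
  shows "0 \<le> D"
proof -
  from assms(1) obtain g1 where g1: "\<forall>\<^sub>F t in nhds 0. ((\<lambda>t. G (x + t *\<^sub>R q)) has_real_derivative g1 t) (at t)"
     "(g1 has_real_derivative D) (at 0)" unfolding second_line_deriv_def by blast
  have "open ((\<lambda>t. x + t *\<^sub>R q) -` U)" by (intro open_vimage assms(2) continuous_intros)
  from eventually_nhds_in_open[OF this, of 0] assms(3) have "\<forall>\<^sub>F t in nhds 0. x + t *\<^sub>R q \<in> U" by simp
  hence "\<forall>\<^sub>F t in nhds 0. G (x + 0 *\<^sub>R q) \<le> G (x + t *\<^sub>R q)" by eventually_elim (simp add: assms(4))
  from second_derivative_nonneg_at_min[OF this g1] show ?thesis .
qed

lemma second_line_deriv_diff:
  assumes "second_line_deriv G x q D" "second_line_deriv H x q E"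
  shows "second_line_deriv (\<lambda>y. G y - e * H y) x q (D - e * E)"
proof -
  from assms obtain g1 h1 where 1: "\<forall>\<^sub>F t in nhds 0. ((\<lambda>t. G (x + t *\<^sub>R q)) has_real_derivative g1 t) (at t)"
     "(g1 has_real_derivative D) (at 0)" "\<forall>\<^sub>F t in nhds 0. ((\<lambda>t. H (x + t *\<^sub>R q)) has_real_derivative h1 t) (at t)"
     "(h1 has_real_derivative E) (at 0)" unfolding second_line_deriv_def by blast
  have "\<forall>\<^sub>F t in nhds 0. ((\<lambda>t. G (x + t *\<^sub>R q) - e * H (x + t *\<^sub>R q)) has_real_derivative g1 t - e * h1 t) (at t)"
    using 1(1,3) by eventually_elim (intro DERIV_diff DERIV_cmult)
  moreover have "((\<lambda>t. g1 t - e * h1 t) has_real_derivative D - e * E) (at 0)"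
    using 1 by (intro DERIV_diff DERIV_cmult)
  ultimately show ?thesis unfolding second_line_deriv_def by (intro exI[of _ "\<lambda>t. g1 t - e * h1 t"]) simp
qed

lemma second_line_deriv_gaussian:
  fixes x :: "'a::real_inner"
  assumes "norm q = 1"
  shows "second_line_deriv (\<lambda>y. exp (- a * (norm (y - z))^2) - k) x q
    (exp (- a * (norm (x - z))^2) * (4 * a^2 * (q \<bullet> (x - z))^2 - 2 * a))"
proof -
  define b where "b = q \<bullet> (x - z)"
  have sq: "(norm (d + t *\<^sub>R q))^2 = (norm d)^2 + 2 * t * (q \<bullet> d) + t^2" for d t
    unfolding power2_norm_eq_inner using assms
    by (simp add: inner_add_left inner_add_right inner_commute[of d q] norm_eq_1 power2_eq_square distrib_left)
  have eq: "(norm (x + t *\<^sub>R q - z))^2 = (norm (x - z))^2 + 2 * t * b + t^2" for t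
    using sq[of "x - z" t] unfolding b_def by (simp add: diff_add_eq)
  let ?g = "\<lambda>t. exp (- a * ((norm (x - z))^2 + 2 * t * b + t^2)) - k"
  let ?g1 = "\<lambda>t. exp (- a * ((norm (x - z))^2 + 2 * t * b + t^2)) * (- a * (2 * b + 2 * t))"
  have "(?g has_real_derivative ?g1 t) (at t)" for t by (auto intro!: derivative_eq_intros)
  moreover have "(?g1 has_real_derivative exp (- a * (norm (x - z))^2) * (4 * a^2 * b^2 - 2 * a)) (at 0)"
    by (auto intro!: derivative_eq_intros simp: power2_eq_square algebra_simps)
  ultimately show ?thesis unfolding second_line_deriv_def eq b_def[symmetric]
    by (intro exI[of _ ?g1] conjI always_eventually allI)
qed

text \<open>Parseval's identity. It makes the lower bound for the elliptic operator on the barrier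
  independent of the frame.\<close>

lemma sum_column_inner_squares:
  fixes Q :: "real^'n^'n"
  assumes "orthogonal_matrix Q"
  shows "(\<Sum>i\<in>UNIV. (column i Q \<bullet> d)^2) = (norm d)^2"
proof -
  have "(transpose Q *v d) \<bullet> (transpose Q *v d) = d \<bullet> (Q *v (transpose Q *v d))"
    by (metis dot_lmul_matrix transpose_matrix_vector)
  also have "\<dots> = (norm d)^2"
    using assms by (simp only: matrix_vector_mul_assoc orthogonal_matrix_def matrix_vector_mul_lid power2_norm_eq_inner)
  finally have "(norm d)^2 = (transpose Q *v d) \<bullet> (transpose Q *v d)" by (rule sym)
  also have "\<dots> = (\<Sum>i\<in>UNIV. (column i Q \<bullet> d)^2)"
    by (simp add: inner_vec_def matrix_vector_mult_def transpose_def column_def power2_eq_square)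
  finally show ?thesis by simp
qed

text \<open>The operator is given pointwise, by an orthonormal frame and its weights, with no
  continuity in \<open>x\<close>: eigenframes cannot in general be chosen continuously. The bounds
  \<open>c\<close> and 1 are the ellipticity constants.\<close>

definition elliptic_supersolution :: "(real^'n) set \<Rightarrow> real \<Rightarrow> (real^'n \<Rightarrow> real) \<Rightarrow> bool" where
  "elliptic_supersolution S c G \<longleftrightarrow> continuous_on S G \<and> (\<forall>x\<in>S. \<exists>Q w D. orthogonal_matrix Q \<and>
     (\<forall>i. c \<le> w i \<and> w i \<le> 1 \<and> second_line_deriv G x (column i Q) (D i)) \<and> (\<Sum>i\<in>UNIV. w i * D i) \<le> 0)"

text \<open>The comparison function is Hopf's barrier \<open>exp (- a |x - y|\<^sup>2)\<close>.\<close>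

lemma hopf_touching_ball:
  fixes G :: "real^'n \<Rightarrow> real"
  assumes c: "0 < c" and G: "elliptic_supersolution S c G" and S: "open S"
    and min: "\<And>x. x \<in> S \<Longrightarrow> G z \<le> G x" and z: "z \<in> S"
    and R: "R > 0" "dist z y = R" and ball: "\<And>x. x \<in> S \<Longrightarrow> dist x y \<le> R \<Longrightarrow> x \<noteq> z \<Longrightarrow> G z < G x"
  shows False
proof -
  define n where "n = real CARD('n)"
  \<comment> \<open>Chosen so that \<open>a * c * R^2 > 2 * n\<close>; this makes the operator
    positive on the barrier at every distance of at least \<open>R / 2\<close> from the centre
    \<open>y\<close>.\<close>
  define a where "a = 2 * n / (c * R^2) + 1"
  have n: "n > 0" by (simp add: n_def)
  have a: "a > 0" using n c R by (simp add: a_def add_nonneg_pos)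
  have acr: "a * c * R^2 > 2 * n" using c R by (simp add: a_def field_simps)
  define \<psi> where "\<psi> x = exp (- a * (norm (x - y))^2) - exp (- a * R^2)" for x :: "real^'n"
  have \<psi>z: "\<psi> z = 0" using R by (simp add: \<psi>_def dist_norm)
  have \<psi>neg: "\<psi> x < 0" if "dist x y > R" for x
    using that a R power_strict_mono[of R "norm (x - y)" 2] by (simp add: \<psi>_def dist_norm)
  have \<psi>1: "\<psi> x \<le> 1" for x using a by (simp add: \<psi>_def) (smt (verit) exp_gt_zero exp_le_one_iff mult_nonneg_nonneg zero_le_power2)
  obtain r0 where r0: "r0 > 0" "cball z r0 \<subseteq> S" using S z open_contains_cball by blast
  \<comment> \<open>The bound \<open>R / 2\<close> keeps the small ball at \<open>z\<close> at
    distance at least \<open>R / 2\<close> from \<open>y\<close>.\<close>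
  define r where "r = min r0 (R / 2)"
  have r: "r > 0" "cball z r \<subseteq> S" "r \<le> R / 2" using r0 R by (auto simp: r_def)
  have Gc: "continuous_on S G" using G by (simp add: elliptic_supersolution_def)
  have \<psi>c: "continuous_on X \<psi>" for X unfolding \<psi>_def by (intro continuous_intros)
  let ?B = "sphere z r \<inter> cball y R"
  \<comment> \<open>On the compact part of the small sphere inside the touching ball,
    \<open>G\<close> exceeds \<open>G z\<close> by a positive gap. Since
    \<open>\<psi> \<le> 1\<close>, half of this gap is small enough for \<open>e\<close>; outside
    the touching ball \<open>\<psi>\<close> is negative and any positive \<open>e\<close>
    works.\<close>
  obtain e where e: "e > 0" and eB: "\<And>x. x \<in> ?B \<Longrightarrow> G z < G x - e * \<psi> x"
  proof (cases "?B = {}")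
    case True
    thus ?thesis using that[of 1] by auto
  next
    case False
    have "compact ?B" by (intro compact_Int_closed compact_sphere closed_cball)
    moreover have sub: "?B \<subseteq> S" using r by (meson Int_lower1 order_trans sphere_cball)
    hence "continuous_on ?B G" using Gc continuous_on_subset by blast
    ultimately obtain b where b: "b \<in> ?B" "\<And>x. x \<in> ?B \<Longrightarrow> G b \<le> G x"
      using continuous_attains_inf[of ?B G] False by blast
    have "b \<noteq> z" using b r by auto
    hence gb: "G z < G b" using ball[of b] subsetD[OF sub b(1)] b(1) by (simp add: dist_commute)
    have *: "G z < G x - (G b - G z) / 2 * \<psi> x" if "x \<in> ?B" for x
    proof -
      have "(G b - G z) / 2 * \<psi> x \<le> (G b - G z) / 2 * 1" using gb \<psi>1 by (intro mult_left_mono) auto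
      thus ?thesis using b(2)[OF that] gb by argo
    qed
    show ?thesis using that[of "(G b - G z) / 2"] gb * by simp
  qed
  define H where "H x = G x - e * \<psi> x" for x
  have Hsphere: "H z < H x" if "x \<in> sphere z r" for x
  proof (cases "x \<in> cball y R")
    case True
    thus ?thesis using eB[of x] that \<psi>z by (simp add: H_def)
  next
    case False
    hence "e * \<psi> x < 0" using \<psi>neg[of x] e by (simp add: dist_commute mult_pos_neg)
    moreover have "G z \<le> G x" using that r by (intro min) auto
    ultimately show ?thesis using \<psi>z by (simp add: H_def)
  qed
  have "continuous_on (cball z r) H"
    unfolding H_def using continuous_on_subset[OF Gc r(2)] \<psi>c by (intro continuous_intros) auto
  \<comment> \<open>The perturbed function exceeds \<open>H z\<close> on the small sphere, so its
    minimum over the small ball is interior. There second derivatives are nonnegative, against the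
    strict sign of the operator on the barrier.\<close>
  then obtain p where p: "p \<in> cball z r" "\<And>x. x \<in> cball z r \<Longrightarrow> H p \<le> H x"
    using continuous_attains_inf[of "cball z r" H] r by auto
  have "H p \<le> H z" using p r by auto
  hence "p \<notin> sphere z r" using Hsphere by force
  hence pb: "p \<in> ball z r" using p by auto
  have pS: "p \<in> S" using p r by blast
  obtain Q w D where Q: "orthogonal_matrix Q" and w: "\<And>i. c \<le> w i" "\<And>i. w i \<le> 1"
    and D: "\<And>i. second_line_deriv G p (column i Q) (D i)" and sum: "(\<Sum>i\<in>UNIV. w i * D i) \<le> 0"
    using G pS unfolding elliptic_supersolution_def by blast
  define E where "E i = exp (- a * (norm (p - y))^2) * (4 * a^2 * (column i Q \<bullet> (p - y))^2 - 2 * a)" for i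
  have "second_line_deriv \<psi> p (column i Q) (E i)" for i
    unfolding \<psi>_def E_def using Q
    by (intro second_line_deriv_gaussian) (simp add: orthogonal_matrix_orthonormal_columns)
  hence "second_line_deriv H p (column i Q) (D i - e * E i)" for i
    unfolding H_def by (intro second_line_deriv_diff D)
  hence DE: "0 \<le> D i - e * E i" for i
    by (rule second_line_deriv_nonneg_at_min[OF _ open_ball pb]) (use p in auto)
  have "e * (\<Sum>i\<in>UNIV. w i * E i) \<le> (\<Sum>i\<in>UNIV. w i * D i)"
    unfolding sum_distrib_left
  proof (intro sum_mono)
    fix i
    have "0 \<le> w i * (D i - e * E i)" using DE w(1)[of i] c by (intro mult_nonneg_nonneg) auto
    thus "e * (w i * E i) \<le> w i * D i" by (simp add: algebra_simps)
  qed
  hence "(\<Sum>i\<in>UNIV. w i * E i) \<le> 0" using sum e by (smt (verit) mult_pos_pos)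
  moreover have "(\<Sum>i\<in>UNIV. w i * E i) > 0"
  proof -
    let ?d = "p - y"
    have "R / 2 \<le> norm ?d"
      using dist_triangle[of z y p] p r R by (simp add: dist_norm norm_minus_commute)
    hence "(R / 2)^2 \<le> (norm ?d)^2" using R by (intro power_mono) auto
    hence "4 * a^2 * c * (R/2)^2 \<le> 4 * a^2 * c * (norm ?d)^2" using c by (intro mult_left_mono) auto
    moreover have "4 * a^2 * c * (R/2)^2 - 2 * a * n = a * (a * c * R^2 - 2 * n)"
      by (simp add: power2_eq_square algebra_simps)
    moreover have "0 < a * (a * c * R^2 - 2 * n)" using a acr by simp
    ultimately have pos: "0 < 4 * a^2 * c * (norm ?d)^2 - 2 * a * n" by linarith
    have "4 * a^2 * c * (norm ?d)^2 - 2 * a * n = (\<Sum>i\<in>UNIV. c * (4 * a^2 * (column i Q \<bullet> ?d)^2) - 1 * (2 * a))"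
      unfolding sum_column_inner_squares[OF Q, symmetric]
      by (simp add: sum_subtractf sum_distrib_left n_def mult_ac)
    also have "\<dots> \<le> (\<Sum>i\<in>UNIV. w i * (4 * a^2 * (column i Q \<bullet> ?d)^2) - w i * (2 * a))"
      using w a by (intro sum_mono diff_mono mult_right_mono) auto
    finally have "0 < (\<Sum>i\<in>UNIV. w i * (4 * a^2 * (column i Q \<bullet> ?d)^2) - w i * (2 * a))" using pos by linarith
    hence "0 < exp (- a * (norm ?d)^2) * (\<Sum>i\<in>UNIV. w i * (4 * a^2 * (column i Q \<bullet> ?d)^2) - w i * (2 * a))"
      by (intro mult_pos_pos exp_gt_zero)
    also have "\<dots> = (\<Sum>i\<in>UNIV. w i * E i)"
      by (simp add: E_def sum_distrib_left algebra_simps)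
    finally show ?thesis .
  qed
  ultimately show False by simp
qed

text \<open>If the minimum set \<open>Z\<close> were not open, a point \<open>y\<close> outside it
  but close to it would have a nearest point \<open>k\<close> in \<open>Z\<close>, and a ball
  touching \<open>Z\<close> only at \<open>k\<close> would contradict the barrier lemma.\<close>

theorem strong_minimum_principle:
  fixes G :: "real^'n \<Rightarrow> real"
  assumes c: "0 < c" and G: "elliptic_supersolution S c G" and S: "open S" "connected S"
    and z: "z \<in> S" and min: "\<And>x. x \<in> S \<Longrightarrow> G z \<le> G x" and x: "x \<in> S"
  shows "G x = G z"
proof -
  have Gc: "continuous_on S G" using G by (simp add: elliptic_supersolution_def)
  define Z where "Z = {x \<in> S. G x = G z}"
  have ZS: "Z \<subseteq> S" by (auto simp: Z_def)
  have "closedin (top_of_set S) Z" unfolding Z_def by (rule continuous_closedin_preimage_constant[OF Gc])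
  moreover have "open Z"
  proof (rule ccontr)
    assume "\<not> open Z"
    then obtain z0 where z0: "z0 \<in> Z" "\<And>e. e > 0 \<Longrightarrow> \<not> ball z0 e \<subseteq> Z" unfolding open_contains_ball by blast
    obtain r where r: "r > 0" "cball z0 r \<subseteq> S" using S z0 ZS open_contains_cball by blast
    obtain y where y: "y \<in> ball z0 (r / 2)" "y \<notin> Z" using z0(2)[of "r/2"] r by (meson half_gt_zero subsetI)
    \<comment> \<open>Cutting \<open>Z\<close> with a closed ball inside \<open>S\<close> makes it
      closed in the whole space, so nearest points exist. As \<open>y\<close> is within
      \<open>r / 2\<close> of \<open>z0\<close>, points of \<open>Z\<close> as near to
      \<open>y\<close> as \<open>k\<close> are not lost.\<close>
    define K where "K = cball z0 r \<inter> Z"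
    have "K = {x \<in> cball z0 r. G x = G z}" using r by (auto simp: K_def Z_def)
    hence "closed K" using continuous_closed_preimage_constant[OF continuous_on_subset[OF Gc r(2)]] by auto
    moreover have "z0 \<in> K" using z0 r by (simp add: K_def)
    ultimately obtain k where k: "k \<in> K" "\<And>x. x \<in> K \<Longrightarrow> dist y k \<le> dist y x"
      using distance_attains_inf[of K y] by blast
    have yk: "dist y k < r / 2" using k(2)[OF \<open>z0 \<in> K\<close>] y by (simp add: dist_commute)
    have Gk: "G k = G z" using k by (auto simp: K_def Z_def)
    have kS: "k \<in> S" using k ZS by (auto simp: K_def)
    \<comment> \<open>The ball about \<open>y\<close> may meet \<open>Z\<close> at several boundary
      points. The ball of half the radius about the midpoint is internally tangent to it at
      \<open>k\<close>, so \<open>k\<close> is the only contact.\<close>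
    define m where "m = midpoint y k"
    have "y \<noteq> k" using k y by (auto simp: K_def)
    hence mk: "dist k m = dist y k / 2" "dist y k > 0" by (auto simp: m_def dist_midpoint)
    show False
    proof (rule hopf_touching_ball[OF c G S(1) _ kS _ mk(1)])
      show "G k \<le> G x" if "x \<in> S" for x using min[OF that] Gk by simp
      show "dist y k / 2 > 0" using mk by simp
      fix x assume x: "x \<in> S" "dist x m \<le> dist y k / 2" "x \<noteq> k"
      show "G k < G x"
      proof (rule ccontr)
        assume "\<not> G k < G x"
        hence "x \<in> Z" using min[OF x(1)] Gk x(1) by (simp add: Z_def)
        have my: "dist m y = dist y k / 2" by (simp add: m_def dist_midpoint)
        have "dist x y \<le> dist y k" using dist_triangle[of x y m] x(2) my by simp
        hence "dist z0 x \<le> r" using dist_triangle[of z0 x y] y yk by (simp add: dist_commute)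
        hence "x \<in> K" using \<open>x \<in> Z\<close> by (simp add: K_def)
        hence xy: "dist y k \<le> dist y x" by (rule k(2))
        define d e where "d = x - m" and "e = m - y"
        have de: "norm d \<le> dist y k / 2" "norm e = dist y k / 2" "norm (d + e) \<ge> dist y k"
          using x(2) my xy by (auto simp: d_def e_def dist_norm norm_minus_commute)
        \<comment> \<open>The parallelogram law gives the equality case of the triangle inequality:
          a contact point at full distance from \<open>y\<close> must be opposite to
          \<open>y\<close> through \<open>m\<close>, that is, \<open>k\<close>.\<close>
        have "(norm (d + e))^2 + (norm (d - e))^2 = 2 * (norm d)^2 + 2 * (norm e)^2"
          by (simp add: power2_norm_eq_inner inner_add_left inner_add_right inner_diff_left inner_diff_right)
        moreover have "(dist y k)^2 \<le> (norm (d + e))^2" using de by (intro power_mono) auto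
        moreover have "(norm d)^2 \<le> (dist y k / 2)^2" using de by (intro power_mono) auto
        moreover have "(dist y k / 2)^2 = (dist y k)^2 / 4" by (simp add: power_divide)
        ultimately have "(norm (d - e))^2 \<le> 0" unfolding de(2) by linarith
        hence "d = e" by simp
        moreover have "k - m = e" by (simp add: e_def m_def midpoint_def algebra_simps flip: scaleR_add_left)
        ultimately have "x - m = k - m" by (simp add: d_def)
        hence "x = k" by simp
        with x(3) show False ..
      qed
    qed
  qed
  hence "openin (top_of_set S) Z" using ZS S(1) by (simp add: openin_open_eq)
  ultimately have "Z = {} \<or> Z = S" using S(2) unfolding connected_clopen by blast
  moreover have "z \<in> Z" using z by (simp add: Z_def)
  ultimately show ?thesis using x by (auto simp: Z_def)
qed

section \<open>The linearized special Lagrangian operator\<close>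

text \<open>The matrix \<open>\<alpha> M + \<beta>\<close>. The field is generic so that
  \<open>N\<close>, with real coefficients \<open>cos c\<close> and \<open>- sin c\<close>, and
  \<open>Z\<close>, with complex coefficients \<open>\<i>\<close> and 1, are treated
  together.\<close>

definition pencil :: "'a::real_normed_field \<Rightarrow> 'a \<Rightarrow> real^'n^'n \<Rightarrow> 'a^'n^'n" where
  "pencil \<alpha> \<beta> M = (\<chi> i j. \<alpha> * of_real (M $ i $ j) + (if i = j then \<beta> else 0))"

text \<open>Conjugation by the image of \<open>Q\<close> in the field commutes with forming the
  pencil. The determinant along a whole line may therefore be computed in an eigenframe chosen at
  one point, where the matrix is diagonal.\<close>

lemma det_pencil_conjugate:
  fixes M Q :: "real^'n^'n" and \<alpha> \<beta> :: "'a::real_normed_field"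
  assumes Q: "orthogonal_matrix Q"
  shows "det (pencil \<alpha> \<beta> (transpose Q ** M ** Q)) = det (pencil \<alpha> \<beta> M)"
proof -
  define P :: "'a^'n^'n" where "P = (\<chi> i j. of_real (Q $ i $ j))"
  have PP: "transpose P ** P = mat 1"
  proof -
    have "(\<Sum>k\<in>UNIV. Q $ k $ i * Q $ k $ j) = (if i = j then 1 else 0)" for i j
      using Q by (simp add: orthogonal_matrix vec_eq_iff matrix_matrix_mult_def transpose_def mat_def)
    hence "(\<Sum>k\<in>UNIV. of_real (Q $ k $ i) * of_real (Q $ k $ j)) = (if i = j then 1 else (0::'a))" for i j
      unfolding of_real_mult[symmetric] of_real_sum[symmetric] by simp
    thus ?thesis by (simp add: P_def vec_eq_iff matrix_matrix_mult_def transpose_def mat_def)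
  qed
  have "pencil \<alpha> \<beta> (transpose Q ** M ** Q) = transpose P ** pencil \<alpha> \<beta> M ** P"
  proof (simp only: vec_eq_iff, intro allI)
    fix i j
    have "(transpose P ** pencil \<alpha> \<beta> M ** P) $ i $ j =
      (\<Sum>l\<in>UNIV. (\<Sum>k\<in>UNIV. of_real (Q $ k $ i) * (\<alpha> * of_real (M $ k $ l))) * of_real (Q $ l $ j)) +
      (\<Sum>l\<in>UNIV. (\<Sum>k\<in>UNIV. of_real (Q $ k $ i) * (if k = l then \<beta> else 0)) * of_real (Q $ l $ j))"
      by (simp add: matrix_matrix_mult_def transpose_def P_def pencil_def distrib_left sum.distrib distrib_right)
    also have "(\<Sum>l\<in>UNIV. (\<Sum>k\<in>UNIV. of_real (Q $ k $ i) * (\<alpha> * of_real (M $ k $ l))) * of_real (Q $ l $ j))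
      = \<alpha> * of_real ((transpose Q ** M ** Q) $ i $ j)"
      by (simp add: matrix_matrix_mult_def transpose_def sum_distrib_left sum_distrib_right mult_ac)
    also have "(\<Sum>l\<in>UNIV. (\<Sum>k\<in>UNIV. of_real (Q $ k $ i) * (if k = l then \<beta> else 0)) * of_real (Q $ l $ j))
      = \<beta> * (\<Sum>l\<in>UNIV. of_real (Q $ l $ i) * of_real (Q $ l $ j))"
    proof -
      have "(\<Sum>k\<in>UNIV. of_real (Q $ k $ i) * (if k = l then \<beta> else 0)) = of_real (Q $ l $ i) * \<beta>" for l
      proof -
        have "(\<Sum>k\<in>UNIV. of_real (Q $ k $ i) * (if k = l then \<beta> else 0)) = (\<Sum>k\<in>UNIV. if k = l then of_real (Q $ l $ i) * \<beta> else 0)"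
          by (intro sum.cong) auto
        thus ?thesis by simp
      qed
      thus ?thesis by (simp add: sum_distrib_left mult_ac)
    qed
    also have "(\<Sum>l\<in>UNIV. of_real (Q $ l $ i) * of_real (Q $ l $ j)) = (if i = j then 1 else (0::'a))"
      using arg_cong[OF PP, of "\<lambda>X. X $ i $ j"] by (simp add: matrix_matrix_mult_def transpose_def P_def mat_def)
    finally show "pencil \<alpha> \<beta> (transpose Q ** M ** Q) $ i $ j = (transpose P ** pencil \<alpha> \<beta> M ** P) $ i $ j"
      by (auto simp: pencil_def)
  qed
  hence "det (pencil \<alpha> \<beta> (transpose Q ** M ** Q)) = det (transpose P) * det P * det (pencil \<alpha> \<beta> M)"
    by (simp add: det_mul)
  also have "det (transpose P) * det P = 1" unfolding det_mul[symmetric] PP by simp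
  finally show ?thesis by simp
qed

lemma conjugate_entry:
  fixes M Q :: "real^'n^'n"
  shows "(transpose Q ** M ** Q) $ a $ b = column a Q \<bullet> (M *v column b Q)"
proof -
  have "column a Q \<bullet> (M *v column b Q) = (\<Sum>k\<in>UNIV. \<Sum>l\<in>UNIV. Q $ k $ a * (M $ k $ l * Q $ l $ b))"
    by (simp add: inner_vec_def matrix_vector_mult_def column_def sum_distrib_left)
  also have "\<dots> = (\<Sum>l\<in>UNIV. \<Sum>k\<in>UNIV. Q $ k $ a * (M $ k $ l * Q $ l $ b))" by (rule sum.swap)
  also have "\<dots> = (transpose Q ** M ** Q) $ a $ b"
    by (simp add: matrix_matrix_mult_def transpose_def sum_distrib_left sum_distrib_right mult_ac)
  finally show ?thesis by simp
qed

lemma orthonormal_column_inner: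
  fixes Q :: "real^'n^'n"
  assumes "orthogonal_matrix Q"
  shows "column a Q \<bullet> column b Q = (if a = b then 1 else 0)"
  using assms by (auto simp: orthogonal_matrix_orthonormal_columns norm_eq_1 orthogonal_def)

lemma conjugate_eigenbasis:
  fixes M Q :: "real^'n^'n"
  assumes "orthogonal_matrix Q" "\<And>j. M *v column j Q = \<Lambda> j *\<^sub>R column j Q"
  shows "(transpose Q ** M ** Q) $ a $ b = (if a = b then \<Lambda> a else 0)"
  unfolding conjugate_entry assms(2) by (auto simp: orthonormal_column_inner[OF assms(1)])

lemma det_pencil_eigenbasis:
  fixes M Q :: "real^'n^'n" and \<alpha> \<beta> :: "'a::real_normed_field"
  assumes "orthogonal_matrix Q" "\<And>j. M *v column j Q = \<Lambda> j *\<^sub>R column j Q"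
  shows "det (pencil \<alpha> \<beta> M) = (\<Prod>j\<in>UNIV. \<alpha> * of_real (\<Lambda> j) + \<beta>)"
  unfolding det_pencil_conjugate[OF assms(1), of \<alpha> \<beta> M, symmetric]
  by (subst det_diagonal) (auto simp: pencil_def conjugate_eigenbasis[OF assms])

lemma linear_zero_on_columns:
  fixes Q :: "real^'n^'n"
  assumes Q: "orthogonal_matrix Q" and f: "linear f" "\<And>i. f (column i Q) = 0"
  shows "f v = 0"
proof -
  have "v = Q *v (transpose Q *v v)"
    using Q by (simp only: matrix_vector_mul_assoc orthogonal_matrix_def matrix_vector_mul_lid)
  also have "\<dots> = (\<Sum>i\<in>UNIV. (transpose Q *v v) $ i *\<^sub>R column i Q)"
    by (simp add: matrix_mult_sum scalar_mult_eq_scaleR)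
  finally have "f v = f (\<Sum>i\<in>UNIV. (transpose Q *v v) $ i *\<^sub>R column i Q)" by (rule arg_cong)
  also have "\<dots> = 0" by (simp only: linear_sum[OF f(1)] linear_cmul[OF f(1)] f(2)) simp
  finally show ?thesis .
qed

section \<open>Permuting the slots of third and fourth derivatives\<close>

lemma dir_deriv_commute_under:
  fixes f :: "'a::real_normed_vector \<Rightarrow> real"
  assumes S: "open S" "x \<in> S" and f: "smooth_on S f"
  shows "dir_deriv p (dir_deriv v (dir_deriv w f)) x = dir_deriv p (dir_deriv w (dir_deriv v f)) x"
  using dir_deriv_commute[OF S(1) _ f] by (intro dir_deriv_cong[OF S] smooth_on_dir_deriv f) auto

lemma dir_deriv_rotate:
  fixes f :: "'a::real_normed_vector \<Rightarrow> real"
  assumes S: "open S" "x \<in> S" and f: "smooth_on S f"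
  shows "dir_deriv p (dir_deriv v (dir_deriv w f)) x = dir_deriv v (dir_deriv w (dir_deriv p f)) x"
  using dir_deriv_commute[OF S smooth_on_dir_deriv[OF f], of p v w] dir_deriv_commute_under[OF assms, of v p w] by simp

lemma dir_deriv_fourth_swap:
  fixes f :: "'a::real_normed_vector \<Rightarrow> real"
  assumes S: "open S" "x \<in> S" and f: "smooth_on S f"
  shows "dir_deriv p (dir_deriv p (dir_deriv v (dir_deriv v f))) x = dir_deriv v (dir_deriv v (dir_deriv p (dir_deriv p f))) x"
proof -
  have "dir_deriv p (dir_deriv p (dir_deriv v (dir_deriv v f))) x = dir_deriv p (dir_deriv v (dir_deriv v (dir_deriv p f))) x"
    using dir_deriv_rotate[OF S(1) _ f] by (intro dir_deriv_cong[OF S] smooth_on_dir_deriv f) auto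
  also have "\<dots> = dir_deriv v (dir_deriv v (dir_deriv p (dir_deriv p f))) x"
    by (rule dir_deriv_rotate[OF S smooth_on_dir_deriv[OF f]])
  finally show ?thesis .
qed

text \<open>The eigenframe at \<open>p\<close> stays fixed along the line, so no derivative of an
  eigenvector appears: the entries of the rotated pencil involve only directional derivatives of
  \<open>u\<close> along constant directions.\<close>

lemma det_pencil_hessian_along_line:
  fixes u :: "real^'n \<Rightarrow> real" and v p :: "real^'n" and \<alpha> \<beta> :: "'a::real_normed_field"
  assumes S: "open S" "p \<in> S" and u: "smooth_on S u" and Q: "orthogonal_matrix Q"
    and eig: "\<And>j. hessian u p *v column j Q = \<Lambda> j *\<^sub>R column j Q"
    and nz: "\<And>j. \<alpha> * of_real (\<Lambda> j) + \<beta> \<noteq> 0"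
  defines "T \<equiv> \<lambda>a b. dir_deriv v (dir_deriv (column a Q) (dir_deriv (column b Q) u)) p"
    and "F \<equiv> \<lambda>a. dir_deriv v (dir_deriv v (dir_deriv (column a Q) (dir_deriv (column a Q) u))) p"
    and "f \<equiv> \<lambda>t. det (pencil \<alpha> \<beta> (hessian u (p + t *\<^sub>R v)))"
    and "d \<equiv> \<lambda>j. \<alpha> * of_real (\<Lambda> j) + \<beta>"
  obtains \<kappa> where "\<kappa> 0 = (\<Sum>a\<in>UNIV. \<alpha> * of_real (T a a) / d a)"
    "\<forall>\<^sub>F t in nhds 0. f t \<noteq> 0 \<and> (f has_vector_derivative f t * \<kappa> t) (at t)"
    "(\<kappa> has_vector_derivative (\<Sum>a\<in>UNIV. \<alpha> * of_real (F a) / d a)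
       - (\<Sum>a\<in>UNIV. \<Sum>b\<in>UNIV. \<alpha>^2 * of_real ((T a b)^2) / (d a * d b))) (at 0)"
proof -
  let ?q = "\<lambda>j. column j Q"
  define m where "m a b = dir_deriv (?q a) (dir_deriv (?q b) u)" for a b
  have msm: "smooth_on S (m a b)" for a b unfolding m_def by (intro smooth_on_dir_deriv u)
  define Z where "Z t = pencil \<alpha> \<beta> (transpose Q ** hessian u (p + t *\<^sub>R v) ** Q)" for t
  define Z1 :: "real \<Rightarrow> 'a^'n^'n" where "Z1 t = (\<chi> a b. \<alpha> * of_real (dir_deriv v (m a b) (p + t *\<^sub>R v)))" for t
  define Z2 :: "'a^'n^'n" where "Z2 = (\<chi> a b. \<alpha> * of_real (dir_deriv v (dir_deriv v (m a b)) p))"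
  have "open ((\<lambda>t. p + t *\<^sub>R v) -` S)" by (intro open_vimage S continuous_intros)
  from eventually_nhds_in_open[OF this, of 0] S have evS: "\<forall>\<^sub>F t in nhds 0. p + t *\<^sub>R v \<in> S" by simp
  then obtain e where e: "e > 0" "\<And>t. \<bar>t\<bar> < e \<Longrightarrow> p + t *\<^sub>R v \<in> S"
    unfolding eventually_nhds_metric by (auto simp: dist_real_def)
  have Zm: "Z t $ a $ b = \<alpha> * of_real (m a b (p + t *\<^sub>R v)) + (if a = b then \<beta> else 0)" if "p + t *\<^sub>R v \<in> S" for t a b
    unfolding Z_def pencil_def m_def vec_lambda_beta conjugate_entry second_dir_deriv_eq_hessian[OF S(1) that u] ..
  have lift: "((\<lambda>t. \<alpha> * of_real (g t) + \<beta>') has_vector_derivative \<alpha> * of_real D) (at t)"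
    if "(g has_vector_derivative D) (at t)" for g D t and \<beta>' :: 'a
  proof -
    have "((\<lambda>t. of_real (g t) :: 'a) has_vector_derivative of_real D) (at t)"
      by (rule bounded_linear.has_vector_derivative[OF bounded_linear_of_real that])
    from has_vector_derivative_add[OF has_vector_derivative_mult_right[OF this] has_vector_derivative_const]
    show ?thesis by simp
  qed
  have ev1: "\<forall>\<^sub>F t in nhds 0. \<forall>i j. ((\<lambda>t. Z t $ i $ j) has_vector_derivative Z1 t $ i $ j) (at t)"
    unfolding eventually_nhds_metric
  proof (intro exI[of _ e] conjI allI impI e(1))
    fix t :: real and i j assume t: "dist t 0 < e"
    hence tS: "p + t *\<^sub>R v \<in> S" using e(2) by (simp add: dist_real_def)
    have "((\<lambda>t. \<alpha> * of_real (m i j (p + t *\<^sub>R v)) + (if i = j then \<beta> else 0)) has_vector_derivative Z1 t $ i $ j) (at t)"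
      unfolding Z1_def vec_lambda_beta by (intro lift line_has_vector_derivative[OF msm tS])
    thus "((\<lambda>t. Z t $ i $ j) has_vector_derivative Z1 t $ i $ j) (at t)"
      by (rule has_vector_derivative_transform_within_open[where S = "ball 0 e"])
        (use t e(2) Zm in \<open>auto simp: dist_real_def\<close>)
  qed
  have Z1d: "((\<lambda>t. Z1 t $ i $ j) has_vector_derivative Z2 $ i $ j) (at 0)" for i j
  proof -
    have "((\<lambda>t. dir_deriv v (m i j) (p + t *\<^sub>R v)) has_vector_derivative dir_deriv v (dir_deriv v (m i j)) (p + 0 *\<^sub>R v)) (at 0)"
      using S by (intro line_has_vector_derivative[OF smooth_on_dir_deriv[OF msm]]) simp
    from lift[OF this, of 0] show ?thesis by (simp add: Z1_def Z2_def)
  qed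
  have diag: "Z 0 $ i $ j = (if i = j then d i else 0)" for i j
    by (simp add: Z_def pencil_def d_def conjugate_eigenbasis[OF Q eig])
  have detZ: "det (Z t) = f t" for t by (simp add: Z_def f_def det_pencil_conjugate[OF Q])
  have dnz: "d j \<noteq> 0" for j using nz by (simp add: d_def)
  obtain \<kappa> where \<kappa>: "\<kappa> 0 = (\<Sum>a\<in>UNIV. Z1 0 $ a $ a / d a)"
    "\<forall>\<^sub>F t in nhds 0. det (Z t) \<noteq> 0 \<and> ((\<lambda>t. det (Z t)) has_vector_derivative det (Z t) * \<kappa> t) (at t)"
    "(\<kappa> has_vector_derivative
       (\<Sum>a\<in>UNIV. Z2 $ a $ a / d a) - (\<Sum>a\<in>UNIV. \<Sum>b\<in>UNIV. Z1 0 $ a $ b * Z1 0 $ b $ a / (d a * d b))) (at 0)"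
    by (rule det_second_log_derivative_at_diagonal[OF ev1 Z1d diag dnz])
  have Tsym: "T a b = T b a" for a b unfolding T_def by (rule dir_deriv_commute_under[OF S u])
  have Z10: "Z1 0 $ a $ b = \<alpha> * of_real (T a b)" for a b by (simp add: Z1_def T_def m_def)
  have "Z1 0 $ a $ b * Z1 0 $ b $ a = \<alpha>^2 * of_real ((T a b)^2)" for a b
    unfolding Z10 Tsym[of b a] by (simp add: power2_eq_square)
  moreover have "Z2 $ a $ a = \<alpha> * of_real (F a)" for a by (simp add: Z2_def F_def m_def)
  ultimately show ?thesis using that[of \<kappa>] \<kappa> unfolding detZ by (simp add: Z10)
qed

text \<open>Pure algebra at one point. The \<open>g a\<close> are the coefficients of the linearized
  operator and \<open>t a\<close> is the cotangent of the shifted angle. The equation differentiated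
  twice eliminates the fourth derivatives \<open>F\<close>; the key substitution is
  \<open>C / \<nu> a = g a * (t a + \<Lambda> a)\<close>.\<close>

lemma linearized_operator_identity:
  fixes T :: "'n::finite \<Rightarrow> 'n \<Rightarrow> 'n \<Rightarrow> real" and F :: "'n \<Rightarrow> 'n \<Rightarrow> real"
  assumes nz: "\<And>a. C * \<Lambda> a - S \<noteq> 0"
    and T: "\<And>a b i. T a b i = T b a i" "\<And>a b i. T a b i = T a i b" and F: "\<And>a i. F a i = F i a"
  defines "g \<equiv> \<lambda>a. 1 / (1 + (\<Lambda> a)^2)" and "\<nu> \<equiv> \<lambda>a. C * \<Lambda> a - S" and "t \<equiv> \<lambda>a. (C + S * \<Lambda> a) / (C * \<Lambda> a - S)"
  assumes constraint: "\<And>i. (\<Sum>a\<in>UNIV. g a * F a i) = (\<Sum>a\<in>UNIV. \<Sum>b\<in>UNIV. g a * g b * (\<Lambda> a + \<Lambda> b) * (T a b i)^2)"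
  shows "(\<Sum>i\<in>UNIV. g i * ((\<Sum>a\<in>UNIV. (C / \<nu> a - \<Lambda> a * g a) * F a i)
      - (\<Sum>a\<in>UNIV. \<Sum>b\<in>UNIV. (C^2 / (\<nu> a * \<nu> b) + g a * g b * (1 - \<Lambda> a * \<Lambda> b)) * (T a b i)^2))) =
    - (\<Sum>a\<in>UNIV. \<Sum>b\<in>UNIV. \<Sum>i\<in>UNIV. (1 + t a * t b) * (g a * g b * g i * (T a b i)^2))"
proof -
  define W where "W a b i = g a * g b * g i * (T a b i)^2" for a b i
  have W: "W a b i = W b a i" "W a b i = W a i b" for a b i
    unfolding W_def by (simp add: T(1)[of a b i]) (simp add: T(2)[of a b i] mult_ac)
  have W3: "W i j a = W a i j" for a i j using W(1)[of a i j] W(2)[of i j a] by simp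
  have e0: "C / \<nu> a = g a * (t a + \<Lambda> a)" for a
  proof -
    have "1 + (\<Lambda> a)^2 \<noteq> 0" by (metis add_pos_nonneg less_irrefl zero_le_power2 zero_less_one)
    moreover have "t a + \<Lambda> a = C * (1 + (\<Lambda> a)^2) / \<nu> a"
      using nz[of a] by (simp add: t_def \<nu>_def add_divide_eq_iff power2_eq_square algebra_simps)
    ultimately show ?thesis by (simp add: g_def)
  qed
  have e1: "C / \<nu> a - \<Lambda> a * g a = g a * t a" for a unfolding e0 by (simp add: algebra_simps)
  have e2: "C^2 / (\<nu> a * \<nu> b) + g a * g b * (1 - \<Lambda> a * \<Lambda> b)
      = g a * g b * (1 + t a * t b + t a * \<Lambda> b + t b * \<Lambda> a)" for a b
  proof -
    have "C^2 / (\<nu> a * \<nu> b) = (C / \<nu> a) * (C / \<nu> b)" by (simp add: power2_eq_square)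
    thus ?thesis unfolding e0 by (simp add: algebra_simps)
  qed
  \<comment> \<open>The mixed terms, with one cotangent and one eigenvalue. They enter as
    \<open>2 * P\<close> from the fourth derivatives and from the quadratic third-derivative terms,
    and cancel.\<close>
  define P where "P = (\<Sum>a\<in>UNIV. \<Sum>b\<in>UNIV. \<Sum>i\<in>UNIV. t a * \<Lambda> b * W a b i)"
  have P2: "(\<Sum>a\<in>UNIV. \<Sum>b\<in>UNIV. \<Sum>i\<in>UNIV. t b * \<Lambda> a * W a b i) = P"
    unfolding P_def by (subst sum.swap) (simp add: W(1))
  have P3: "(\<Sum>a\<in>UNIV. \<Sum>b\<in>UNIV. \<Sum>i\<in>UNIV. t a * \<Lambda> i * W a b i) = P"
    unfolding P_def by (rule sum.cong[OF refl], subst sum.swap) (simp add: W(2))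
  have first: "(\<Sum>i\<in>UNIV. g i * (\<Sum>a\<in>UNIV. g a * t a * F a i)) = 2 * P"
  proof -
    \<comment> \<open>Symmetry of \<open>F\<close> exchanges the differentiating direction with the
      diagonal slot, so that the inner sum becomes the left-hand side of
      \<open>constraint\<close>.\<close>
    have "(\<Sum>i\<in>UNIV. g i * (\<Sum>a\<in>UNIV. g a * t a * F a i)) = (\<Sum>i\<in>UNIV. \<Sum>a\<in>UNIV. g a * t a * (g i * F i a))"
      unfolding sum_distrib_left by (intro sum.cong refl) (simp add: F mult_ac)
    also have "\<dots> = (\<Sum>a\<in>UNIV. g a * t a * (\<Sum>i\<in>UNIV. g i * F i a))"
      unfolding sum_distrib_left by (rule sum.swap)
    also have "\<dots> = (\<Sum>a\<in>UNIV. \<Sum>i\<in>UNIV. \<Sum>j\<in>UNIV. t a * \<Lambda> i * W a i j + t a * \<Lambda> j * W a i j)"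
    proof -
      have "g a * t a * (g i * g j * (\<Lambda> i + \<Lambda> j) * (T i j a)^2) = t a * \<Lambda> i * W a i j + t a * \<Lambda> j * W a i j" for a i j
        unfolding W3[of i j a, symmetric] by (simp add: W_def algebra_simps)
      thus ?thesis unfolding constraint sum_distrib_left by (simp only:)
    qed
    also have "\<dots> = P + P" by (simp only: sum.distrib P3 P_def[symmetric])
    finally show ?thesis by simp
  qed
  have second: "(\<Sum>i\<in>UNIV. g i * (\<Sum>a\<in>UNIV. \<Sum>b\<in>UNIV. g a * g b * (1 + t a * t b + t a * \<Lambda> b + t b * \<Lambda> a) * (T a b i)^2))
     = (\<Sum>a\<in>UNIV. \<Sum>b\<in>UNIV. \<Sum>i\<in>UNIV. (1 + t a * t b) * W a b i) + 2 * P"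
  proof -
    have "(\<Sum>i\<in>UNIV. g i * (\<Sum>a\<in>UNIV. \<Sum>b\<in>UNIV. g a * g b * (1 + t a * t b + t a * \<Lambda> b + t b * \<Lambda> a) * (T a b i)^2))
       = (\<Sum>i\<in>UNIV. \<Sum>a\<in>UNIV. \<Sum>b\<in>UNIV. (1 + t a * t b) * W a b i + t a * \<Lambda> b * W a b i + t b * \<Lambda> a * W a b i)"
      unfolding sum_distrib_left by (intro sum.cong refl) (simp add: W_def algebra_simps)
    also have "\<dots> = (\<Sum>a\<in>UNIV. \<Sum>i\<in>UNIV. \<Sum>b\<in>UNIV. (1 + t a * t b) * W a b i + t a * \<Lambda> b * W a b i + t b * \<Lambda> a * W a b i)"
      by (rule sum.swap)
    also have "\<dots> = (\<Sum>a\<in>UNIV. \<Sum>b\<in>UNIV. \<Sum>i\<in>UNIV. (1 + t a * t b) * W a b i + t a * \<Lambda> b * W a b i + t b * \<Lambda> a * W a b i)"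
      by (intro sum.cong refl sum.swap)
    also have "\<dots> = (\<Sum>a\<in>UNIV. \<Sum>b\<in>UNIV. \<Sum>i\<in>UNIV. (1 + t a * t b) * W a b i) + P + P"
      by (simp only: sum.distrib P2 P_def[symmetric])
    finally show ?thesis by simp
  qed
  show ?thesis
  proof -
    have "(\<Sum>i\<in>UNIV. g i * (X i - Y i)) = (\<Sum>i\<in>UNIV. g i * X i) - (\<Sum>i\<in>UNIV. g i * Y i)" for X Y :: "'n \<Rightarrow> real"
      by (simp only: right_diff_distrib sum_subtractf)
    thus ?thesis unfolding e1 e2 using first second unfolding W_def by simp
  qed
qed

lemma inverse_one_plus_imaginary:
  fixes x :: real
  shows "1 / (\<i> * of_real x + 1) = Complex (1 / (1 + x^2)) (- x / (1 + x^2))"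
  by (simp add: complex_eq_iff Re_divide Im_divide power2_eq_square)

text \<open>Near 0 the function \<open>cis (- \<Theta>) * fZ\<close> is real and positive with
  logarithmic derivative \<open>\<kappa>Z\<close>, so \<open>\<kappa>Z\<close> is real there. The
  two vanishing imaginary parts are the equation differentiated once and twice, while the real parts
  give the derivatives of \<open>g\<close>.\<close>

lemma second_derivative_of_log_det_difference:
  fixes fN \<kappa>N :: "real \<Rightarrow> real" and fZ \<kappa>Z :: "real \<Rightarrow> complex"
  assumes N: "\<forall>\<^sub>F t in nhds 0. fN t \<noteq> 0 \<and> (fN has_vector_derivative fN t * \<kappa>N t) (at t)"
    and N': "(\<kappa>N has_vector_derivative KN) (at 0)"
    and Z: "\<forall>\<^sub>F t in nhds 0. fZ t \<noteq> 0 \<and> (fZ has_vector_derivative fZ t * \<kappa>Z t) (at t)"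
    and Z': "(\<kappa>Z has_vector_derivative KZ) (at 0)"
    and pos: "\<forall>\<^sub>F t in nhds 0. 0 < fN t" and arg: "\<forall>\<^sub>F t in nhds 0. \<exists>r>0. fZ t = of_real r * cis \<Theta>"
  defines "g \<equiv> \<lambda>t. ln (fN t) - ln (Re (cis (- \<Theta>) * fZ t))"
  shows "\<forall>\<^sub>F t in nhds 0. (g has_real_derivative \<kappa>N t - Re (\<kappa>Z t)) (at t)"
    "((\<lambda>t. \<kappa>N t - Re (\<kappa>Z t)) has_real_derivative KN - Re KZ) (at 0)" "Im (\<kappa>Z 0) = 0" "Im KZ = 0"
proof -
  obtain e where e: "e > 0" and ev: "\<And>t. \<bar>t\<bar> < e \<Longrightarrow> (fN has_vector_derivative fN t * \<kappa>N t) (at t) \<and>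
     (fZ has_vector_derivative fZ t * \<kappa>Z t) (at t) \<and> 0 < fN t \<and> (\<exists>r>0. fZ t = of_real r * cis \<Theta>)"
    using eventually_conj[OF eventually_conj[OF N Z] eventually_conj[OF pos arg]]
    unfolding eventually_nhds_metric by (auto simp: dist_real_def)
  define h where "h t = cis (- \<Theta>) * fZ t" for t
  have h: "Im (h t) = 0" "0 < Re (h t)" "h t = of_real (Re (h t))" if t: "\<bar>t\<bar> < e" for t
  proof -
    obtain r where r: "r > 0" "fZ t = of_real r * cis \<Theta>" using ev[OF t] by blast
    have "h t = of_real r" unfolding h_def r(2) by (simp add: cis_mult mult.left_commute)
    thus "Im (h t) = 0" "0 < Re (h t)" "h t = of_real (Re (h t))" using r by auto
  qed
  have hd: "(h has_vector_derivative of_real (Re (h t)) * \<kappa>Z t) (at t)" if t: "\<bar>t\<bar> < e" for t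
  proof -
    have "(h has_vector_derivative cis (- \<Theta>) * (fZ t * \<kappa>Z t)) (at t)"
      unfolding h_def using ev[OF t] by (intro has_vector_derivative_mult_right) auto
    moreover have "cis (- \<Theta>) * (fZ t * \<kappa>Z t) = of_real (Re (h t)) * \<kappa>Z t"
      using h(3)[OF t] by (simp add: h_def mult.assoc[symmetric])
    ultimately show ?thesis by simp
  qed
  have zero: "D = 0" if "(f has_vector_derivative D) (at t)" "\<bar>t\<bar> < e" "\<And>s. \<bar>s\<bar> < e \<Longrightarrow> f s = 0" 
    for f :: "real \<Rightarrow> real" and D t
  proof -
    have "((\<lambda>s. 0 :: real) has_vector_derivative 0) (at t)" by (rule has_vector_derivative_const)
    hence "(f has_vector_derivative 0) (at t)"
      by (rule has_vector_derivative_transform_within_open[where S = "ball 0 e"])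
        (use that in \<open>auto simp: dist_real_def\<close>)
    with that(1) show ?thesis by (rule vector_derivative_unique_at)
  qed
  have Im\<kappa>: "Im (\<kappa>Z t) = 0" if t: "\<bar>t\<bar> < e" for t
  proof -
    have "((\<lambda>t. Im (h t)) has_vector_derivative Im (of_real (Re (h t)) * \<kappa>Z t)) (at t)"
      by (rule bounded_linear.has_vector_derivative[OF bounded_linear_Im hd[OF t]])
    from zero[OF this t h(1)] show ?thesis using h(2)[OF t] by simp
  qed
  show "Im (\<kappa>Z 0) = 0" using Im\<kappa>[of 0] e by simp
  have "((\<lambda>t. Im (\<kappa>Z t)) has_vector_derivative Im KZ) (at 0)"
    by (rule bounded_linear.has_vector_derivative[OF bounded_linear_Im Z'])
  from zero[OF this _ Im\<kappa>] show "Im KZ = 0" using e by simp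
  have "((\<lambda>t. Re (\<kappa>Z t)) has_real_derivative Re KZ) (at 0)"
    unfolding has_real_derivative_iff_has_vector_derivative
    by (rule bounded_linear.has_vector_derivative[OF bounded_linear_Re Z'])
  thus "((\<lambda>t. \<kappa>N t - Re (\<kappa>Z t)) has_real_derivative KN - Re KZ) (at 0)"
    using N' by (intro DERIV_diff) (simp add: has_real_derivative_iff_has_vector_derivative)
  have "(g has_real_derivative \<kappa>N t - Re (\<kappa>Z t)) (at t)" if t: "\<bar>t\<bar> < e" for t
  proof -
    have fN: "(fN has_real_derivative fN t * \<kappa>N t) (at t)" and p: "0 < fN t"
      using ev[OF t] by (auto simp: has_real_derivative_iff_has_vector_derivative)
    have fR: "((\<lambda>t. Re (h t)) has_real_derivative Re (h t) * Re (\<kappa>Z t)) (at t)"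
      unfolding has_real_derivative_iff_has_vector_derivative
      using bounded_linear.has_vector_derivative[OF bounded_linear_Re hd[OF t]] by simp
    have "((\<lambda>t. ln (fN t) - ln (Re (h t))) has_real_derivative
       1 / fN t * (fN t * \<kappa>N t) - 1 / Re (h t) * (Re (h t) * Re (\<kappa>Z t))) (at t)"
      using p h(2)[OF t] by (intro DERIV_diff DERIV_chain2[OF DERIV_ln_divide] fN fR)
    thus ?thesis using p h(2)[OF t] by (simp add: g_def h_def)
  qed
  thus "\<forall>\<^sub>F t in nhds 0. (g has_real_derivative \<kappa>N t - Re (\<kappa>Z t)) (at t)"
    unfolding eventually_nhds_metric using e by (auto simp: dist_real_def)
qed

text \<open>On solutions \<open>Re (cis (- \<Theta>) * det Z)\<close> equals
  \<open>\<bar>det Z\<bar>\<close>. The form chosen here is linear over the reals in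
  \<open>det Z\<close>, so it differentiates without a square root.\<close>

definition angle_defect :: "real \<Rightarrow> real \<Rightarrow> (real^'n \<Rightarrow> real) \<Rightarrow> real^'n \<Rightarrow> real" where
  "angle_defect c \<Theta> u x = ln (det (pencil (cos c) (- sin c) (hessian u x)))
     - ln (Re (cis (- \<Theta>) * det (pencil \<i> 1 (hessian u x))))"

text \<open>All three formulas come from
  \<open>1 / (1 + \<i> \<Lambda>) = g - \<i> \<Lambda> g\<close>. The real part of the second
  logarithmic derivative of \<open>det Z\<close> enters the first formula; its imaginary part is the
  second, and the imaginary part of the first logarithmic derivative is the third.\<close>

lemma angle_defect_along_line:
  fixes u :: "real^'n \<Rightarrow> real" and v p :: "real^'n"
  assumes S: "open S" "p \<in> S" and u: "smooth_on S u" and Q: "orthogonal_matrix Q"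
    and eig: "\<And>j. hessian u p *v column j Q = \<Lambda> j *\<^sub>R column j Q"
    and pos: "\<And>x. x \<in> S \<Longrightarrow> 0 < det (pencil (cos c) (- sin c) (hessian u x))"
    and arg: "\<And>x. x \<in> S \<Longrightarrow> \<exists>r>0. det (pencil \<i> 1 (hessian u x)) = of_real r * cis \<Theta>"
    and nz: "\<And>j. cos c * \<Lambda> j - sin c \<noteq> 0"
  defines "T \<equiv> \<lambda>a b. dir_deriv v (dir_deriv (column a Q) (dir_deriv (column b Q) u)) p"
    and "F \<equiv> \<lambda>a. dir_deriv v (dir_deriv v (dir_deriv (column a Q) (dir_deriv (column a Q) u))) p"
    and "\<nu> \<equiv> \<lambda>a. cos c * \<Lambda> a - sin c" and "g \<equiv> \<lambda>a. 1 / (1 + (\<Lambda> a)^2)"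
  shows "second_line_deriv (angle_defect c \<Theta> u) p v ((\<Sum>a\<in>UNIV. (cos c / \<nu> a - \<Lambda> a * g a) * F a)
      - (\<Sum>a\<in>UNIV. \<Sum>b\<in>UNIV. ((cos c)^2 / (\<nu> a * \<nu> b) + g a * g b * (1 - \<Lambda> a * \<Lambda> b)) * (T a b)^2))" (is ?A)
    and "(\<Sum>a\<in>UNIV. g a * F a) = (\<Sum>a\<in>UNIV. \<Sum>b\<in>UNIV. g a * g b * (\<Lambda> a + \<Lambda> b) * (T a b)^2)" (is ?B)
    and "(\<Sum>a\<in>UNIV. g a * T a a) = 0" (is ?C)
proof -
  define fN where "fN t = det (pencil (cos c) (- sin c) (hessian u (p + t *\<^sub>R v)))" for t
  define fZ where "fZ t = det (pencil \<i> 1 (hessian u (p + t *\<^sub>R v)))" for t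
  define z where "z a = Complex (g a) (- \<Lambda> a * g a)" for a
  have z: "1 / (\<i> * of_real (\<Lambda> a) + 1) = z a" for a
    unfolding inverse_one_plus_imaginary z_def g_def by simp
  have nzN: "cos c * of_real (\<Lambda> j) + - sin c \<noteq> 0" for j using nz[of j] by simp
  have nzZ: "\<i> * of_real (\<Lambda> j) + 1 \<noteq> 0" for j by (simp add: complex_eq_iff)
  obtain \<kappa>N where \<kappa>N: "\<forall>\<^sub>F t in nhds 0. fN t \<noteq> 0 \<and> (fN has_vector_derivative fN t * \<kappa>N t) (at t)"
    "(\<kappa>N has_vector_derivative (\<Sum>a\<in>UNIV. cos c * F a / \<nu> a)
       - (\<Sum>a\<in>UNIV. \<Sum>b\<in>UNIV. (cos c)^2 * (T a b)^2 / (\<nu> a * \<nu> b))) (at 0)"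
    by (rule det_pencil_hessian_along_line[OF S u Q eig nzN, where v = v])
      (auto simp: fN_def[abs_def] T_def F_def \<nu>_def)
  obtain \<kappa>Z where \<kappa>Z: "\<kappa>Z 0 = (\<Sum>a\<in>UNIV. \<i> * of_real (T a a) / (\<i> * of_real (\<Lambda> a) + 1))"
    "\<forall>\<^sub>F t in nhds 0. fZ t \<noteq> 0 \<and> (fZ has_vector_derivative fZ t * \<kappa>Z t) (at t)"
    "(\<kappa>Z has_vector_derivative (\<Sum>a\<in>UNIV. \<i> * of_real (F a) / (\<i> * of_real (\<Lambda> a) + 1))
       - (\<Sum>a\<in>UNIV. \<Sum>b\<in>UNIV. \<i>^2 * of_real ((T a b)^2) / ((\<i> * of_real (\<Lambda> a) + 1) * (\<i> * of_real (\<Lambda> b) + 1)))) (at 0)"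
    (is "(_ has_vector_derivative ?KZ) _")
    by (rule det_pencil_hessian_along_line[OF S u Q eig nzZ, where v = v])
      (auto simp: fZ_def[abs_def] T_def F_def)
  have "open ((\<lambda>t. p + t *\<^sub>R v) -` S)" by (intro open_vimage S continuous_intros)
  from eventually_nhds_in_open[OF this, of 0] S have evS: "\<forall>\<^sub>F t in nhds 0. p + t *\<^sub>R v \<in> S" by simp
  have ev: "\<forall>\<^sub>F t in nhds 0. 0 < fN t" "\<forall>\<^sub>F t in nhds 0. \<exists>r>0. fZ t = of_real r * cis \<Theta>"
    unfolding fN_def fZ_def by (rule eventually_mono[OF evS], erule pos) (rule eventually_mono[OF evS], erule arg)
  note key = second_derivative_of_log_det_difference[OF \<kappa>N \<kappa>Z(2,3) ev]
  have K: "?KZ = (\<Sum>a\<in>UNIV. of_real (F a) * (\<i> * z a)) + (\<Sum>a\<in>UNIV. \<Sum>b\<in>UNIV. of_real ((T a b)^2) * (z a * z b))"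
  proof -
    have "\<i> * of_real (F a) / (\<i> * of_real (\<Lambda> a) + 1) = of_real (F a) * (\<i> * z a)" for a
      unfolding z[symmetric] by simp
    moreover have "\<i>^2 * of_real ((T a b)^2) / ((\<i> * of_real (\<Lambda> a) + 1) * (\<i> * of_real (\<Lambda> b) + 1))
        = - (of_real ((T a b)^2) * (z a * z b))" for a b
      unfolding z[symmetric] by simp
    ultimately show ?thesis by (simp only: sum_negf diff_minus_eq_add)
  qed
  have zz: "z a * z b = Complex (g a * g b * (1 - \<Lambda> a * \<Lambda> b)) (- (g a * g b * (\<Lambda> a + \<Lambda> b)))" for a b
    by (simp add: z_def complex_eq_iff algebra_simps)
  have iz: "\<i> * z a = Complex (\<Lambda> a * g a) (g a)" for a by (simp add: z_def complex_eq_iff)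
  have ReK: "Re ?KZ = (\<Sum>a\<in>UNIV. \<Lambda> a * g a * F a) + (\<Sum>a\<in>UNIV. \<Sum>b\<in>UNIV. g a * g b * (1 - \<Lambda> a * \<Lambda> b) * (T a b)^2)"
    unfolding K zz iz by (simp add: mult_ac)
  have ImK: "Im ?KZ = (\<Sum>a\<in>UNIV. g a * F a) - (\<Sum>a\<in>UNIV. \<Sum>b\<in>UNIV. g a * g b * (\<Lambda> a + \<Lambda> b) * (T a b)^2)"
    unfolding K zz iz by (simp add: mult_ac sum_negf)
  show ?B using key(4) unfolding ImK by simp
  have "\<kappa>Z 0 = (\<Sum>a\<in>UNIV. of_real (T a a) * (\<i> * z a))"
    unfolding \<kappa>Z(1) z[symmetric] by (intro sum.cong refl) simp
  hence "Im (\<kappa>Z 0) = (\<Sum>a\<in>UNIV. g a * T a a)" unfolding iz by (simp add: mult_ac)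
  thus ?C using key(3) by simp
  have "second_line_deriv (angle_defect c \<Theta> u) p v ((\<Sum>a\<in>UNIV. cos c * F a / \<nu> a)
       - (\<Sum>a\<in>UNIV. \<Sum>b\<in>UNIV. (cos c)^2 * (T a b)^2 / (\<nu> a * \<nu> b)) - Re ?KZ)"
    unfolding second_line_deriv_def angle_defect_def fN_def[symmetric] fZ_def[symmetric]
    by (intro exI[of _ "\<lambda>t. \<kappa>N t - Re (\<kappa>Z t)"] conjI key(1,2))
  moreover have "(\<Sum>a\<in>UNIV. cos c * F a / \<nu> a) - (\<Sum>a\<in>UNIV. \<Sum>b\<in>UNIV. (cos c)^2 * (T a b)^2 / (\<nu> a * \<nu> b)) - Re ?KZ
    = (\<Sum>a\<in>UNIV. (cos c / \<nu> a - \<Lambda> a * g a) * F a)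
      - (\<Sum>a\<in>UNIV. \<Sum>b\<in>UNIV. ((cos c)^2 / (\<nu> a * \<nu> b) + g a * g b * (1 - \<Lambda> a * \<Lambda> b)) * (T a b)^2)"
    unfolding ReK by (simp add: left_diff_distrib distrib_right sum.distrib sum_subtractf)
  ultimately show ?A by simp
qed

section \<open>Homogeneous solutions\<close>

lemma hessian_degree_zero:
  fixes u :: "real^'n \<Rightarrow> real"
  assumes u: "smooth_on (- {0}) u" and h: "homogeneous_deg2 u" and t: "0 < t" and x: "x \<noteq> 0"
  shows "hessian u (t *\<^sub>R x) = hessian u x"
proof -
  have 1: "dir_deriv w u (s *\<^sub>R y) = s ^ Suc 0 * dir_deriv w u y" if "0 < s" "y \<noteq> 0" for w s y
    using dir_deriv_homogeneous[OF u, of 1 s y w] h that by (simp add: homogeneous_deg2_def numeral_2_eq_2)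
  have "dir_deriv v (dir_deriv w u) (t *\<^sub>R x) = dir_deriv v (dir_deriv w u) x" for v w
    using dir_deriv_homogeneous[OF smooth_on_dir_deriv[OF u] 1 t x, of v w] by simp
  thus ?thesis by (simp add: vec_eq_iff hessian_eq_dir_deriv)
qed

lemma quadratic_polynomial_of_constant_hessian:
  fixes u :: "real^'n \<Rightarrow> real"
  assumes u: "smooth_on (- {0}) u" and h: "homogeneous_deg2 u" and H: "\<And>x. x \<noteq> 0 \<Longrightarrow> hessian u x = H"
  shows "\<exists>q. quadratic_polynomial q \<and> (\<forall>x. x \<noteq> 0 \<longrightarrow> u x = q x)"
proof (intro exI conjI allI impI)
  let ?q = "\<lambda>x. \<Sum>i\<in>UNIV. \<Sum>j\<in>UNIV. (H $ i $ j / 2) * x $ i * x $ j"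
  show "quadratic_polynomial ?q"
    unfolding quadratic_polynomial_def
    by (intro exI[of _ "\<chi> i j. H $ i $ j / 2"] exI[of _ "\<lambda>_. 0"] exI[of _ 0]) simp
  fix x :: "real^'n" assume x: "x \<noteq> 0"
  have "2 * u x = x \<bullet> (hessian u x *v x)"
    using euler_second_derivative[OF u h x] second_dir_deriv_eq_hessian[OF _ _ u, of x x x] x by (simp add: open_Compl)
  also have "\<dots> = 2 * ?q x"
    unfolding H[OF x] by (simp add: inner_vec_def matrix_vector_mult_def sum_distrib_left mult_ac)
  finally show "u x = ?q x" by simp
qed

lemma abs_eigenvalue_le_sum_entries:
  fixes A :: "real^'n^'n"
  assumes "A *v v = \<mu> *\<^sub>R v" "norm v = 1"
  shows "\<bar>\<mu>\<bar> \<le> (\<Sum>i\<in>UNIV. \<Sum>j\<in>UNIV. \<bar>A $ i $ j\<bar>)"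
proof -
  have "\<bar>\<mu>\<bar> = norm (A *v v)" using assms by simp
  also have "\<dots> \<le> (\<Sum>i\<in>UNIV. \<bar>(A *v v) $ i\<bar>)" by (rule norm_le_l1_cart)
  also have "\<dots> \<le> (\<Sum>i\<in>UNIV. \<Sum>j\<in>UNIV. \<bar>A $ i $ j\<bar>)"
  proof (rule sum_mono)
    fix i
    have "\<bar>(A *v v) $ i\<bar> \<le> (\<Sum>j\<in>UNIV. \<bar>A $ i $ j * v $ j\<bar>)"
      unfolding matrix_vector_mult_def vec_lambda_beta by (rule sum_abs)
    also have "\<dots> \<le> (\<Sum>j\<in>UNIV. \<bar>A $ i $ j\<bar> * 1)"
      unfolding abs_mult using component_le_norm_cart[of v] assms(2) by (intro sum_mono mult_left_mono) auto
    finally show "\<bar>(A *v v) $ i\<bar> \<le> (\<Sum>j\<in>UNIV. \<bar>A $ i $ j\<bar>)" by simp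
  qed
  finally show ?thesis .
qed

lemma continuous_on_hessian:
  fixes u :: "real^'n \<Rightarrow> real"
  assumes "smooth_on S u"
  shows "continuous_on S (\<lambda>x. hessian u x $ i $ j)"
  unfolding hessian_eq_dir_deriv by (intro smooth_on_imp_continuous_on smooth_on_dir_deriv assms)

text \<open>The Hessian has degree 0, so compactness of the unit sphere bounds its entries, and with
  them its eigenvalues. The bound supplies the lower ellipticity constant
  \<open>1 / (1 + B^2)\<close>.\<close>

lemma hessian_eigenvalues_bounded:
  fixes u :: "real^'n \<Rightarrow> real"
  assumes u: "smooth_on (- {0}) u" and h: "homogeneous_deg2 u"
  obtains B where "\<And>x v \<mu>. x \<noteq> 0 \<Longrightarrow> hessian u x *v v = \<mu> *\<^sub>R v \<Longrightarrow> norm v = 1 \<Longrightarrow> \<bar>\<mu>\<bar> \<le> B"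
proof -
  let ?f = "\<lambda>x. \<Sum>i\<in>UNIV. \<Sum>j\<in>UNIV. \<bar>hessian u x $ i $ j\<bar>"
  have "continuous_on (sphere 0 1) ?f"
    by (intro continuous_on_sum continuous_on_rabs continuous_on_subset[OF continuous_on_hessian[OF u]]) auto
  then obtain B where B: "\<And>x. x \<in> sphere 0 1 \<Longrightarrow> ?f x \<le> B"
    using bounded_imp_bdd_above[OF compact_imp_bounded[OF compact_continuous_image[OF _ compact_sphere]]]
    unfolding bdd_above_def by blast
  have "?f x \<le> B" if x: "x \<noteq> 0" for x
  proof -
    have "hessian u ((1 / norm x) *\<^sub>R x) = hessian u x" using x by (intro hessian_degree_zero u h) auto
    with B[of "(1 / norm x) *\<^sub>R x"] x show ?thesis by simp
  qed
  thus ?thesis using that abs_eigenvalue_le_sum_entries order_trans by blast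
qed

section \<open>Polar form of the eigenvalues\<close>

lemma sqrt_one_plus_square_nonzero: "sqrt (1 + x^2) \<noteq> 0" for x :: real
  using add_pos_nonneg[OF zero_less_one zero_le_power2[of x]] by simp

lemma one_plus_imaginary_eq_cis: "\<i> * of_real x + 1 = of_real (sqrt (1 + x^2)) * cis (arctan x)"
  using sqrt_one_plus_square_nonzero[of x] by (simp add: complex_eq_iff cos_arctan sin_arctan del: real_sqrt_eq_zero_cancel_iff)

lemma prod_cis_sum: "finite I \<Longrightarrow> (\<Prod>i\<in>I. of_real (r i) * cis (f i)) = of_real (\<Prod>i\<in>I. r i) * cis (\<Sum>i\<in>I. f i)"
  by (induction I rule: finite_induct) (auto simp: cis_mult mult_ac)

text \<open>Addition formulas with \<open>x = tan \<theta>\<close>. The quotient of the second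
  expression by the first is the cotangent of the shifted angle, which identifies \<open>t\<close>
  in the operator identity.\<close>

lemma cos_sin_arctan_shift:
  "cos c * x - sin c = sqrt (1 + x^2) * sin (arctan x - c)"
  "cos c + sin c * x = sqrt (1 + x^2) * cos (arctan x - c)"
  using sqrt_one_plus_square_nonzero[of x]
  by (simp_all add: sin_diff cos_diff cos_arctan sin_arctan distrib_left right_diff_distrib del: real_sqrt_eq_zero_cancel_iff)

text \<open>The sign \<open>s\<close> covers both hypotheses on the angles: \<open>s = 1\<close> for \<open>A\<^sub>j = \<theta>\<^sub>j - c\<close>, and \<open>s = -1\<close> for
  \<open>A\<^sub>j = (c - \<pi>) - \<theta>\<^sub>j\<close>.\<close>

definition angle_simplex :: "real \<Rightarrow> real \<Rightarrow> ('n::finite \<Rightarrow> real) \<Rightarrow> bool" where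
  "angle_simplex c s \<Lambda> \<longleftrightarrow> (\<exists>A. (\<forall>j. 0 < A j \<and> A j < pi \<and> sin (arctan (\<Lambda> j) - c) = sin (A j) \<and>
     cos (arctan (\<Lambda> j) - c) = s * cos (A j)) \<and> (\<Sum>j\<in>UNIV. A j) = pi)"

text \<open>The quantity \<open>t a\<close> is \<open>s * cot (A a)\<close>, and only products of
  two of them occur, so the sign \<open>s\<close> disappears.\<close>

lemma angle_simplex_cubic_bound:
  fixes h :: "'n::finite \<Rightarrow> 'n \<Rightarrow> 'n \<Rightarrow> real"
  assumes s: "s^2 = 1" and A: "angle_simplex c s \<Lambda>" and sym: "\<And>a b i. h a b i = h b a i" "\<And>a b i. h a b i = h a i b"
    and tr: "\<And>i. (\<Sum>a\<in>UNIV. h a a i) = 0"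
  defines "t \<equiv> \<lambda>a. (cos c + sin c * \<Lambda> a) / (cos c * \<Lambda> a - sin c)"
  shows "\<And>j. 0 < cos c * \<Lambda> j - sin c"
    "(\<Sum>a\<in>UNIV. \<Sum>b\<in>UNIV. \<Sum>i\<in>UNIV. (h a b i)^2) \<le> (\<Sum>a\<in>UNIV. \<Sum>b\<in>UNIV. \<Sum>i\<in>UNIV. (1 + t a * t b) * (h a b i)^2)"
proof -
  obtain A where A: "\<And>j. 0 < A j" "\<And>j. A j < pi" "\<And>j. sin (arctan (\<Lambda> j) - c) = sin (A j)"
     "\<And>j. cos (arctan (\<Lambda> j) - c) = s * cos (A j)" "(\<Sum>j\<in>UNIV. A j) = pi"
    using A unfolding angle_simplex_def by blast
  have r: "0 < sqrt (1 + (\<Lambda> j)^2)" for j by (simp add: add_pos_nonneg)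
  show "0 < cos c * \<Lambda> j - sin c" for j
    unfolding cos_sin_arctan_shift A(3) using A r by (intro mult_pos_pos sin_gt_zero)
  have "t a = s * cot (A a)" for a
    unfolding t_def cos_sin_arctan_shift A(3,4) using r[of a] by (simp add: cot_def)
  hence "t a * t b = cot (A a) * cot (A b)" for a b using s by (simp add: power2_eq_square)
  thus "(\<Sum>a\<in>UNIV. \<Sum>b\<in>UNIV. \<Sum>i\<in>UNIV. (h a b i)^2) \<le> (\<Sum>a\<in>UNIV. \<Sum>b\<in>UNIV. \<Sum>i\<in>UNIV. (1 + t a * t b) * (h a b i)^2)"
    using trace_free_cubic_form_bound[OF cotangent_triangle_cot[OF A(1,2,5)] sym tr] by simp
qed

text \<open>A constant function is at a minimum and at a maximum; the latter is the former for
  \<open>G - 2 G = - G\<close>.\<close>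

lemma second_line_deriv_of_constant:
  assumes "second_line_deriv G x q D" "open S" "x \<in> S" "\<And>y. y \<in> S \<Longrightarrow> G y = G x"
  shows "D = 0"
proof (rule antisym)
  show "0 \<le> D" using second_line_deriv_nonneg_at_min[OF assms(1-3)] assms(4) by simp
  have "second_line_deriv (\<lambda>y. G y - 2 * G y) x q (D - 2 * D)" by (intro second_line_deriv_diff assms(1))
  from second_line_deriv_nonneg_at_min[OF this assms(2,3)] show "D \<le> 0" using assms(4) by simp
qed

theorem special_lagrangian_hessian_constant:
  fixes u :: "real^'n \<Rightarrow> real"
  assumes u: "smooth_on (- {0}) u" and hom: "homogeneous_deg2 u" and n: "2 \<le> CARD('n)" and s: "s^2 = 1"
    and eqn: "\<And>x Q \<Lambda>. x \<noteq> 0 \<Longrightarrow> orthogonal_matrix Q \<Longrightarrow> (\<And>j. hessian u x *v column j Q = \<Lambda> j *\<^sub>R column j Q) \<Longrightarrow>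
       (\<Sum>j\<in>UNIV. arctan (\<Lambda> j)) = \<Theta> \<and> angle_simplex c s \<Lambda>"
    and x: "x \<noteq> 0" and y: "y \<noteq> 0"
  shows "hessian u x = hessian u y"
proof -
  let ?S = "- {0} :: (real^'n) set"
  let ?G = "angle_defect c \<Theta> u"
  have S: "open ?S" by auto
  have conn: "connected ?S" using n by (intro path_connected_imp_connected path_connected_punctured_universe) simp
  have diag: "\<exists>Q \<Lambda>. orthogonal_matrix Q \<and> (\<forall>j. hessian u p *v column j Q = \<Lambda> j *\<^sub>R column j Q)" if "p \<in> ?S" for p
    using symmetric_matrix_diagonalization[OF transpose_hessian[OF S that u]] by metis
  have pos: "0 < det (pencil (cos c) (- sin c) (hessian u p))" if p: "p \<in> ?S" for p
  proof -
    obtain Q \<Lambda> where Q: "orthogonal_matrix Q" and e: "\<And>j. hessian u p *v column j Q = \<Lambda> j *\<^sub>R column j Q"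
      using diag[OF p] by blast
    have A: "angle_simplex c s \<Lambda>" using eqn[OF _ Q e] p by simp
    \<comment> \<open>Positivity of the factors does not involve the cubic form, so the lemma is
      instantiated with the zero form.\<close>
    show ?thesis unfolding det_pencil_eigenbasis[OF Q e]
      using angle_simplex_cubic_bound(1)[OF s A, of "\<lambda>_ _ _. 0"] by (intro prod_pos) simp
  qed
  have arg: "\<exists>r>0. det (pencil \<i> 1 (hessian u p)) = of_real r * cis \<Theta>" if p: "p \<in> ?S" for p
  proof -
    obtain Q \<Lambda> where Q: "orthogonal_matrix Q" and e: "\<And>j. hessian u p *v column j Q = \<Lambda> j *\<^sub>R column j Q"
      using diag[OF p] by blast
    have \<Theta>: "(\<Sum>j\<in>UNIV. arctan (\<Lambda> j)) = \<Theta>" using eqn[OF _ Q e] p by simp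
    have "det (pencil \<i> 1 (hessian u p)) = of_real (\<Prod>j\<in>UNIV. sqrt (1 + (\<Lambda> j)^2)) * cis \<Theta>"
      unfolding det_pencil_eigenbasis[OF Q e] one_plus_imaginary_eq_cis prod_cis_sum[OF finite] \<Theta> ..
    moreover have "0 < (\<Prod>j\<in>UNIV. sqrt (1 + (\<Lambda> j)^2))" by (intro prod_pos) (simp add: add_pos_nonneg)
    ultimately show ?thesis by blast
  qed
  obtain B where B: "\<And>x v \<mu>. x \<noteq> 0 \<Longrightarrow> hessian u x *v v = \<mu> *\<^sub>R v \<Longrightarrow> norm v = 1 \<Longrightarrow> \<bar>\<mu>\<bar> \<le> B"
    using hessian_eigenvalues_bounded[OF u hom] by blast
  define g where "g = (\<lambda>x::real. 1 / (1 + x^2))"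
  \<comment> \<open>The quadratic right-hand side is retained, since the estimate is used twice: its
    sign alone makes \<open>G\<close> a supersolution, and once \<open>G\<close> is constant it
    forces the third derivatives to vanish.\<close>
  have local: "\<exists>Q \<Lambda> D. orthogonal_matrix Q \<and>
      (\<forall>i. 1 / (1 + B^2) \<le> g (\<Lambda> i) \<and> 0 < g (\<Lambda> i) \<and> g (\<Lambda> i) \<le> 1 \<and> second_line_deriv ?G p (column i Q) (D i)) \<and>
      (\<Sum>i\<in>UNIV. g (\<Lambda> i) * D i) \<le> - (\<Sum>a\<in>UNIV. \<Sum>b\<in>UNIV. \<Sum>i\<in>UNIV. g (\<Lambda> a) * g (\<Lambda> b) * g (\<Lambda> i) *
        (dir_deriv (column i Q) (dir_deriv (column a Q) (dir_deriv (column b Q) u)) p)^2)" if p: "p \<in> ?S" for p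
  proof -
    obtain Q \<Lambda> where Q: "orthogonal_matrix Q" and e: "\<And>j. hessian u p *v column j Q = \<Lambda> j *\<^sub>R column j Q"
      using diag[OF p] by blast
    have A: "angle_simplex c s \<Lambda>" using eqn[OF _ Q e] p by simp
    have nu: "0 < cos c * \<Lambda> j - sin c" for j using angle_simplex_cubic_bound(1)[OF s A, of "\<lambda>_ _ _. 0"] by simp
    hence nz: "cos c * \<Lambda> j - sin c \<noteq> 0" for j by (metis less_irrefl)
    define T where "T a b i = dir_deriv (column i Q) (dir_deriv (column a Q) (dir_deriv (column b Q) u)) p" for a b i
    define F where "F a i = dir_deriv (column i Q) (dir_deriv (column i Q) (dir_deriv (column a Q) (dir_deriv (column a Q) u))) p" for a i
    define t where "t a = (cos c + sin c * \<Lambda> a) / (cos c * \<Lambda> a - sin c)" for a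
    have T1: "T a b i = T b a i" for a b i unfolding T_def by (rule dir_deriv_commute_under[OF S p u])
    have T2: "T a b i = T a i b" for a b i
      unfolding T_def dir_deriv_rotate[OF S p u, of "column i Q" "column a Q" "column b Q"]
      by (rule dir_deriv_commute[OF S p smooth_on_dir_deriv[OF u]])
    note T = T1 T2
    have F: "F a i = F i a" for a i unfolding F_def by (rule dir_deriv_fourth_swap[OF S p u])
    note line = angle_defect_along_line[OF S p u Q e pos arg nz, folded T_def F_def g_def]
    define D where "D i = (\<Sum>a\<in>UNIV. (cos c / (cos c * \<Lambda> a - sin c) - \<Lambda> a * g (\<Lambda> a)) * F a i)
      - (\<Sum>a\<in>UNIV. \<Sum>b\<in>UNIV. ((cos c)^2 / ((cos c * \<Lambda> a - sin c) * (cos c * \<Lambda> b - sin c))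
          + g (\<Lambda> a) * g (\<Lambda> b) * (1 - \<Lambda> a * \<Lambda> b)) * (T a b i)^2)" for i
    have DD: "second_line_deriv ?G p (column i Q) (D i)" for i
      using line(1)[of "column i Q"] unfolding D_def T_def F_def g_def by simp
    have con: "(\<Sum>a\<in>UNIV. g (\<Lambda> a) * F a i) = (\<Sum>a\<in>UNIV. \<Sum>b\<in>UNIV. g (\<Lambda> a) * g (\<Lambda> b) * (\<Lambda> a + \<Lambda> b) * (T a b i)^2)" for i
      using line(2)[of "column i Q"] unfolding T_def F_def g_def by simp
    have tr: "(\<Sum>a\<in>UNIV. g (\<Lambda> a) * T a a i) = 0" for i
      using line(3)[of "column i Q"] unfolding T_def g_def by simp
    have gpos: "0 < g x" "g x \<le> 1" for x unfolding g_def by (auto simp: add_pos_nonneg)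
    have gB: "1 / (1 + B^2) \<le> g (\<Lambda> i)" for i
    proof -
      have "\<bar>\<Lambda> i\<bar> \<le> B" using B[OF _ e] p Q by (auto simp: orthogonal_matrix_orthonormal_columns)
      hence "(\<Lambda> i)^2 \<le> B^2" by (metis abs_ge_zero order_trans power2_abs power_mono)
      thus ?thesis unfolding g_def by (intro divide_left_mono) (auto simp: add_pos_nonneg)
    qed
    \<comment> \<open>One factor \<open>sqrt (g (\<Lambda> a))\<close> per slot keeps the form
      symmetric, and the weighted trace identity becomes an ordinary trace condition.\<close>
    define h where "h a b i = sqrt (g (\<Lambda> a)) * sqrt (g (\<Lambda> b)) * sqrt (g (\<Lambda> i)) * T a b i" for a b i
    have h2: "(h a b i)^2 = g (\<Lambda> a) * g (\<Lambda> b) * g (\<Lambda> i) * (T a b i)^2" for a b i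
      using gpos(1)[THEN less_imp_le] by (simp add: h_def power_mult_distrib)
    have hsym1: "h a b i = h b a i" for a b i unfolding h_def T1[of a b i] by (simp only: mult_ac)
    have hsym2: "h a b i = h a i b" for a b i unfolding h_def T2[of a b i] by (simp only: mult_ac)
    have htr: "(\<Sum>a\<in>UNIV. h a a i) = 0" for i
    proof -
      have "(\<Sum>a\<in>UNIV. h a a i) = sqrt (g (\<Lambda> i)) * (\<Sum>a\<in>UNIV. g (\<Lambda> a) * T a a i)"
        unfolding sum_distrib_left h_def using gpos(1)[THEN less_imp_le] by (intro sum.cong refl) simp
      thus ?thesis using tr by simp
    qed
    have "(\<Sum>i\<in>UNIV. g (\<Lambda> i) * D i) = - (\<Sum>a\<in>UNIV. \<Sum>b\<in>UNIV. \<Sum>i\<in>UNIV. (1 + t a * t b) * (h a b i)^2)"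
      unfolding D_def h2 t_def g_def
      by (rule linearized_operator_identity[OF nz T F con[unfolded g_def]])
    also have "\<dots> \<le> - (\<Sum>a\<in>UNIV. \<Sum>b\<in>UNIV. \<Sum>i\<in>UNIV. (h a b i)^2)"
      using angle_simplex_cubic_bound(2)[OF s A hsym1 hsym2 htr] by (simp add: t_def)
    finally have "(\<Sum>i\<in>UNIV. g (\<Lambda> i) * D i) \<le> - (\<Sum>a\<in>UNIV. \<Sum>b\<in>UNIV. \<Sum>i\<in>UNIV. g (\<Lambda> a) * g (\<Lambda> b) * g (\<Lambda> i) * (T a b i)^2)"
      unfolding h2 .
    thus ?thesis unfolding T_def
      by (intro exI[of _ Q] exI[of _ \<Lambda>] exI[of _ D] conjI allI Q gB gpos DD)
  qed
  have "continuous_on ?S ?G"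
  proof -
    have pc: "continuous_on ?S (\<lambda>x. det (pencil \<alpha> \<beta> (hessian u x)))" for \<alpha> \<beta> :: "'b::real_normed_field"
      unfolding det_def pencil_def vec_lambda_beta
      by (intro continuous_intros continuous_on_hessian[OF u])
    have "0 < Re (cis (- \<Theta>) * det (pencil \<i> 1 (hessian u p)))" if p: "p \<in> ?S" for p
    proof -
      obtain r where r: "r > 0" "det (pencil \<i> 1 (hessian u p)) = of_real r * cis \<Theta>" using arg[OF p] by blast
      have "cis (- \<Theta>) * det (pencil \<i> 1 (hessian u p)) = of_real r" unfolding r(2) by (simp add: cis_mult mult.left_commute)
      thus ?thesis using r(1) by (simp only: Re_complex_of_real)
    qed
    thus ?thesis unfolding angle_defect_def using pos
      by (intro continuous_intros pc) (metis less_irrefl)+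
  qed
  moreover have "\<exists>Q w D. orthogonal_matrix Q \<and>
     (\<forall>i. 1 / (1 + B^2) \<le> w i \<and> w i \<le> 1 \<and> second_line_deriv ?G p (column i Q) (D i)) \<and> (\<Sum>i\<in>UNIV. w i * D i) \<le> 0"
    if p: "p \<in> ?S" for p
  proof -
    obtain Q \<Lambda> D where Q: "orthogonal_matrix Q" and *: "\<And>i. 1 / (1 + B^2) \<le> g (\<Lambda> i)" "\<And>i. 0 < g (\<Lambda> i)" "\<And>i. g (\<Lambda> i) \<le> 1"
        "\<And>i. second_line_deriv ?G p (column i Q) (D i)"
      and le: "(\<Sum>i\<in>UNIV. g (\<Lambda> i) * D i) \<le> - (\<Sum>a\<in>UNIV. \<Sum>b\<in>UNIV. \<Sum>i\<in>UNIV. g (\<Lambda> a) * g (\<Lambda> b) * g (\<Lambda> i) *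
        (dir_deriv (column i Q) (dir_deriv (column a Q) (dir_deriv (column b Q) u)) p)^2)"
      using local[OF p] by blast
    have "0 \<le> (\<Sum>a\<in>UNIV. \<Sum>b\<in>UNIV. \<Sum>i\<in>UNIV. g (\<Lambda> a) * g (\<Lambda> b) * g (\<Lambda> i) *
        (dir_deriv (column i Q) (dir_deriv (column a Q) (dir_deriv (column b Q) u)) p)^2)"
      using *(2)[THEN less_imp_le] by (intro sum_nonneg mult_nonneg_nonneg) auto
    hence "(\<Sum>i\<in>UNIV. g (\<Lambda> i) * D i) \<le> 0" using le by linarith
    thus ?thesis using Q * by (intro exI[of _ Q] exI[of _ "\<lambda>i. g (\<Lambda> i)"] exI[of _ D]) blast
  qed
  ultimately have super: "elliptic_supersolution ?S (1 / (1 + B^2)) ?G" unfolding elliptic_supersolution_def by blast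
  have G0: "?G (t *\<^sub>R p) = ?G p" if "0 < t" "p \<noteq> 0" for t p
    using hessian_degree_zero[OF u hom that] by (simp add: angle_defect_def)
  have Gc: "continuous_on (sphere 0 1) ?G"
    using super continuous_on_subset[of ?S ?G "sphere 0 1"] by (auto simp: elliptic_supersolution_def)
  have "sphere (0::real^'n) 1 \<noteq> {}" by simp
  then obtain z where z: "z \<in> sphere 0 1" "\<And>p. p \<in> sphere 0 1 \<Longrightarrow> ?G z \<le> ?G p"
    using continuous_attains_inf[OF compact_sphere _ Gc] by blast
  have zS: "z \<in> ?S" using z by auto
  have min: "?G z \<le> ?G p" if p: "p \<in> ?S" for p
    using z(2)[of "(1 / norm p) *\<^sub>R p"] G0[of "1 / norm p" p] p by simp
  have "0 < 1 / (1 + B^2)" by (simp add: add_pos_nonneg)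
  note const = strong_minimum_principle[OF this super S conn zS min]
  have third: "dir_deriv w (dir_deriv (axis i 1) (dir_deriv (axis j 1) u)) p = 0" if p: "p \<in> ?S" for p w i j
  proof -
    obtain Q \<Lambda> D where Q: "orthogonal_matrix Q" and *: "\<And>i. 0 < g (\<Lambda> i)"
        "\<And>i. second_line_deriv ?G p (column i Q) (D i)"
      and le: "(\<Sum>i\<in>UNIV. g (\<Lambda> i) * D i) \<le> - (\<Sum>a\<in>UNIV. \<Sum>b\<in>UNIV. \<Sum>i\<in>UNIV. g (\<Lambda> a) * g (\<Lambda> b) * g (\<Lambda> i) *
        (dir_deriv (column i Q) (dir_deriv (column a Q) (dir_deriv (column b Q) u)) p)^2)"
      using local[OF p] by blast
    let ?q = "\<lambda>i. column i Q"
    define E where "E a b i = g (\<Lambda> a) * g (\<Lambda> b) * g (\<Lambda> i) * (dir_deriv (?q i) (dir_deriv (?q a) (dir_deriv (?q b) u)) p)^2" for a b i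
    have E: "0 \<le> E a b i" for a b i
      unfolding E_def using *(1)[THEN less_imp_le] by (intro mult_nonneg_nonneg) auto
    \<comment> \<open>With \<open>G\<close> constant the left-hand side of \<open>le\<close> is
      zero, so a sum of nonnegative terms is at most zero.\<close>
    have "D i = 0" for i
      by (rule second_line_deriv_of_constant[OF *(2) S p]) (use const p in metis)
    hence "(\<Sum>a\<in>UNIV. \<Sum>b\<in>UNIV. \<Sum>i\<in>UNIV. E a b i) \<le> 0" using le unfolding E_def by simp
    hence "(\<Sum>a\<in>UNIV. \<Sum>b\<in>UNIV. \<Sum>i\<in>UNIV. E a b i) = 0" using E by (intro antisym sum_nonneg) auto
    hence "E a b i = 0" for a b i using E by (simp add: sum_nonneg_eq_0_iff sum_nonneg)
    moreover have "g (\<Lambda> k) \<noteq> 0" for k using *(1)[of k] by simp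
    ultimately have 0: "dir_deriv (?q i) (dir_deriv (?q a) (dir_deriv (?q b) u)) p = 0" for a b i
      unfolding E_def by simp
    \<comment> \<open>Linearity in the outermost slot extends vanishing from the frame to all
      directions. Rotating the slots brings each of the three to the outside in turn.\<close>
    have ext: "dir_deriv v f p = 0" if "smooth_on ?S f" "\<And>i. dir_deriv (?q i) f p = 0" for f :: "real^'n \<Rightarrow> real" and v
      using linear_zero_on_columns[OF Q linear_dir_deriv[OF that(1) p]] that(2) by blast
    have sm: "smooth_on ?S (dir_deriv v (dir_deriv w u))" for v w by (intro smooth_on_dir_deriv u)
    have 1: "dir_deriv w (dir_deriv (?q a) (dir_deriv (?q b) u)) p = 0" for w a b
      by (rule ext[OF sm 0])
    have 2: "dir_deriv (?q a) (dir_deriv (?q b) (dir_deriv w u)) p = 0" for w a b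
      using 1[of w a b] dir_deriv_rotate[OF S p u, of w "?q a" "?q b"] by simp
    have 3: "dir_deriv v (dir_deriv (?q b) (dir_deriv w u)) p = 0" for v w b
      by (rule ext[OF sm 2])
    have 4: "dir_deriv (?q b) (dir_deriv w (dir_deriv v u)) p = 0" for v w b
      using 3[of v b w] dir_deriv_rotate[OF S p u, of v "?q b" w] by simp
    have "dir_deriv w (dir_deriv (axis i 1) (dir_deriv (axis j 1) u)) p = 0"
      by (rule ext[OF sm 4])
    thus ?thesis .
  qed
  have "hessian u x $ i $ j = hessian u y $ i $ j" for i j
    unfolding hessian_eq_dir_deriv
  proof (rule has_derivative_zero_unique_connected[OF S conn])
    fix p assume p: "p \<in> ?S"
    have "(dir_deriv (axis i 1) (dir_deriv (axis j 1) u) has_derivative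
        (\<lambda>w. dir_deriv w (dir_deriv (axis i 1) (dir_deriv (axis j 1) u)) p)) (at p)"
      by (rule smooth_on_has_derivative[OF smooth_on_dir_deriv[OF smooth_on_dir_deriv[OF u]] p])
    thus "(dir_deriv (axis i 1) (dir_deriv (axis j 1) u) has_derivative (\<lambda>w. 0)) (at p)"
      unfolding third[OF p] .
  qed (use x y in auto)
  thus ?thesis by (simp add: vec_eq_iff)
qed

theorem corollary1p1:
  fixes u :: "real^'n::finite \<Rightarrow> real" and \<Theta> :: real
  assumes "smooth_on (- {0}) u"
    and "homogeneous_deg2 u"
    and "\<forall>x. x \<noteq> 0 \<longrightarrow> (\<Sum>i = 1..CARD('n). arctan (eigval i (hessian u x))) = \<Theta>"
    and "(\<forall>x. x \<noteq> 0 \<longrightarrow> arctan (eigval_min (hessian u x)) > (\<Theta> - pi) / real CARD('n)) \<or>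
         (\<forall>x. x \<noteq> 0 \<longrightarrow> arctan (eigval_max (hessian u x)) < (\<Theta> + pi) / real CARD('n))"
  shows "\<exists>q. quadratic_polynomial q \<and> (\<forall>x. x \<noteq> 0 \<longrightarrow> u x = q x)"
proof -
  let ?n = "real CARD('n)"
  note u = assms(1) and hom = assms(2)
  have sum: "(\<Sum>j\<in>UNIV. arctan (\<Lambda> j)) = \<Theta>"
    if "x \<noteq> 0" "orthogonal_matrix Q" "\<And>j. hessian u x *v column j Q = \<Lambda> j *\<^sub>R column j Q" for x Q \<Lambda>
    using sum_eigval_diagonalized[OF that(2,3), of arctan] assms(3) that(1) by simp
  have "\<exists>H. \<forall>x. x \<noteq> 0 \<longrightarrow> hessian u x = H"
  proof (cases "CARD('n) = 1")
    \<comment> \<open>There is one eigenvalue and its arctangent is \<open>\<Theta>\<close>, so the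
      Hessian is the constant \<open>tan \<Theta>\<close> and no minimum principle is
      involved.\<close>
    case True
    have "hessian u x = mat (tan \<Theta>)" if x: "x \<noteq> 0" for x
    proof -
      have "transpose (hessian u x) = hessian u x" using x u by (intro transpose_hessian[of "- {0}"]) auto
      then obtain Q \<Lambda> where Q: "orthogonal_matrix Q" "\<And>j. hessian u x *v column j Q = \<Lambda> j *\<^sub>R column j Q"
        using symmetric_matrix_diagonalization by metis
      obtain k :: 'n where k: "UNIV = {k}" using True card_1_singletonE by blast
      have "arctan (\<Lambda> j) = \<Theta>" for j
      proof -
        have "j \<in> {k}" unfolding k[symmetric] by simp
        thus ?thesis using sum[OF x Q] unfolding k by simp
      qed
      hence \<Lambda>: "\<Lambda> j = tan \<Theta>" for j by (metis tan_arctan)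
      have "hessian u x *v v - tan \<Theta> *\<^sub>R v = 0" for v
      proof (rule linear_zero_on_columns[OF Q(1), where f = "\<lambda>v. hessian u x *v v - tan \<Theta> *\<^sub>R v"])
        show "linear (\<lambda>v. hessian u x *v v - tan \<Theta> *\<^sub>R v)"
          by (intro linear_compose_sub matrix_vector_mul_linear linear_scaleR)
      qed (simp add: Q(2) \<Lambda>)
      hence "hessian u x *v v = mat (tan \<Theta>) *v v" for v
        by (simp add: vec_eq_iff matrix_vector_mult_def mat_def if_distrib if_distribR cong: if_cong)
      thus ?thesis by (simp add: matrix_eq)
    qed
    thus ?thesis by blast
  next
    case False
    have n: "2 \<le> CARD('n)" using False zero_less_card_finite[where 'a = 'n] by linarith
    \<comment> \<open>With at least two positive angles of sum \<open>pi\<close>, each is strictly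
      below \<open>pi\<close>; this gives positive sines.\<close>
    have lt_pi: "A j < pi" if "\<And>j. 0 < A j" "(\<Sum>j\<in>UNIV. A j) = pi" for A :: "'n \<Rightarrow> real" and j
    proof -
      have "UNIV - {j} \<noteq> {}"
      proof
        assume "UNIV - {j} = {}"
        hence "(UNIV :: 'n set) = {j}" by blast
        hence "CARD('n) = card {j}" by (rule arg_cong)
        with n show False by simp
      qed
      hence "0 < (\<Sum>j\<in>UNIV - {j}. A j)" using that by (intro sum_pos) auto
      thus ?thesis using that(2) by (simp add: sum.remove[of UNIV j])
    qed
    from assms(4) show ?thesis
    proof
      assume min: "\<forall>x. x \<noteq> 0 \<longrightarrow> arctan (eigval_min (hessian u x)) > (\<Theta> - pi) / ?n"
      define c where "c = (\<Theta> - pi) / ?n"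
      have "angle_simplex c 1 \<Lambda>"
        if x: "x \<noteq> 0" and Q: "orthogonal_matrix Q" "\<And>j. hessian u x *v column j Q = \<Lambda> j *\<^sub>R column j Q" for x Q \<Lambda>
      proof -
        have "c < arctan (\<Lambda> j)" for j
          using min x eigval_min_max_diagonalized(1)[OF Q, of j] arctan_le_iff[of "eigval_min (hessian u x)" "\<Lambda> j"]
          unfolding c_def by fastforce
        moreover have "(\<Sum>j\<in>UNIV. arctan (\<Lambda> j) - c) = pi"
          using sum[OF x Q] by (simp add: sum_subtractf c_def)
        ultimately show ?thesis
          unfolding angle_simplex_def using lt_pi[of "\<lambda>j. arctan (\<Lambda> j) - c"]
          by (intro exI[of _ "\<lambda>j. arctan (\<Lambda> j) - c"]) auto
      qed
      with sum have "hessian u x = hessian u y" if "x \<noteq> 0" "y \<noteq> 0" for x y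
        using that by (intro special_lagrangian_hessian_constant[OF u hom n, of 1 \<Theta> c]) auto
      thus ?thesis by metis
    next
      assume max: "\<forall>x. x \<noteq> 0 \<longrightarrow> arctan (eigval_max (hessian u x)) < (\<Theta> + pi) / ?n"
      define c where "c = (\<Theta> + pi) / ?n"
      \<comment> \<open>The shift by \<open>pi\<close> changes the sign of
        \<open>cos c * \<lambda> - sin c\<close>, which is negative in this case; each factor of the
        determinant becomes positive whatever the parity of the dimension.\<close>
      have "angle_simplex (c + pi) (- 1) \<Lambda>"
        if x: "x \<noteq> 0" and Q: "orthogonal_matrix Q" "\<And>j. hessian u x *v column j Q = \<Lambda> j *\<^sub>R column j Q" for x Q \<Lambda>
      proof -
        have "arctan (\<Lambda> j) < c" for j
          using max x eigval_min_max_diagonalized(2)[OF Q, of j] arctan_le_iff[of "\<Lambda> j" "eigval_max (hessian u x)"]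
          unfolding c_def by fastforce
        moreover have "(\<Sum>j\<in>UNIV. c - arctan (\<Lambda> j)) = pi"
          using sum[OF x Q] by (simp add: sum_subtractf c_def)
        ultimately show ?thesis
          unfolding angle_simplex_def using lt_pi[of "\<lambda>j. c - arctan (\<Lambda> j)"]
          by (intro exI[of _ "\<lambda>j. c - arctan (\<Lambda> j)"]) (auto simp: sin_diff cos_diff)
      qed
      with sum have "hessian u x = hessian u y" if "x \<noteq> 0" "y \<noteq> 0" for x y
        using that by (intro special_lagrangian_hessian_constant[OF u hom n, of "- 1" \<Theta> "c + pi"]) auto
      thus ?thesis by metis
    qed
  qed
  thus ?thesis using quadratic_polynomial_of_constant_hessian[OF u hom] by blast
qed

end
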